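(* Let $k$ be a field with $\mathrm{char}(k)\neq 2$, let $q,t\in k$ be nonzero scalars such that $t^{1/2}$ exists in $k$ (a square root being fixed), and put $\alpha=\frac12\left(t^{1/2}-t^{-1/2}\right)$. Let $Q=Q_1*_RQ_2$, where $R$, $Q_1$, $Q_2$ are the algebras (depending on $q,t$) defined in the context. Then there is a $k$-algebra isomorphism $\varphi:Q\to\mathbb{H}_{q,t}(GL_2(k))$ which sends the generators of $Q$ to the following: $$z_1\mapsto X_1,\quad z_2\mapsto X_2,\quad z_3\mapsto Y_1Y_2,\quad x\mapsto T-\alpha,\quad y\mapsto Y_1^{-1}T.$$
   Context: The double affine Hecke algebra $\mathbb{H}_{q,t}(GL_2(k))$ is the associative unital $k$-algebra generated by invertible elements $T,X_1,X_2,Y_1,Y_2$ with defining relations: $X_1X_2=X_2X_1$, $Y_1Y_2=Y_2Y_1$, $(T-t^{1/2})(T+t^{-1/2})=0$, $Y_2^{-1}X_1Y_2X_1^{-1}=T^2$, $T^{-1}Y_1T^{-1}=Y_2$, $TX_1T=X_2$, $Y_1Y_2X_1=qX_1Y_1Y_2$, $Y_1Y_2X_2=qX_2Y_1Y_2$, $X_1X_2Y_1=q^{-1}Y_1X_1X_2$, $X_1X_2Y_2=q^{-1}Y_2X_1X_2$. $R$ is the $k$-algebra generated by invertible variables $z_1^{\pm1},z_2^{\pm1},z_3^{\pm1}$ with defining relations $z_1z_2=z_2z_1$, $z_1z_3=q^{-1}z_3z_1$, $z_2z_3=q^{-1}z_3z_2$ (a three-dimensional quantum torus). For a ring endomorphism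 $\tau$ of $R$, a left $\tau$-derivation is an additive map $\delta:R\to R$ with $\delta(rs)=\tau(r)\delta(s)+\delta(r)s$, and $R[x;\tau,\delta]$ denotes the Ore extension: the ring containing $R$ that is a free left $R$-module on $1,x,x^2,\dots$ with $xr=\tau(r)x+\delta(r)$ for $r\in R$. $\tau_1$ is the $k$-algebra automorphism of $R$ that interchanges $z_1$ and $z_2$ and fixes $z_3$; $\delta_1$ is the $k$-linear left $\tau_1$-derivation of $R$ given by $\delta_1=-\alpha\frac{z_1+z_2}{z_1-z_2}(1-\tau_1)$. $Q_1=R[x;\tau_1,\delta_1]/I_1$, where $I_1$ is the ideal generated by the normal element $x^2-\left(\frac{t^{1/2}+t^{-1/2}}{2}\right)^2$. $\tau_2$ is the $k$-algebra automorphism of $R$ given by $z_1\mapsto z_2$, $z_2\mapsto q^{-1}z_1$, $z_3\mapsto z_3$, and $\delta_2=0$. $Q_2=R[y;\tau_2,\delta_2]/I_2$, where $I_2$ is the ideal generated by the normal element $y^2-z_3^{-1}$. The classes of $x$ in $Q_1$ and $y$ in $Q_2$ are again denoted $x$ and $y$. $Q_1$ and $Q_2$ contain $R$ as a subring, each being a free left $R$-module with basis $\{1,x\}$, resp. $\{1,y\}$. The amalgamated product $Q_1*_RQ_2$ is the pushout, in the category of rings, of the inclusions $R\hookrightarrow Q_1$ and $R\hookrightarrow Q_2$. *)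

theory Defs
  imports "HOL-Algebra.QuotRing" "HOL-Algebra.UnivPoly" "HOL-Library.Poly_Mapping"
begin

section \<open>Algebras over a field\<close>

text \<open>
  The locale \<^locale>\<open>algebra\<close> of HOL-Algebra is restricted to commutative rings, so
  only its record type (a ring together with a scalar multiplication) is used here, with the
  scalars forming a type.
\<close>

definition alg_iso :: "('k, 'a) module \<Rightarrow> ('k, 'b) module \<Rightarrow> ('a \<Rightarrow> 'b) set" where
  "alg_iso A B = {h \<in> ring_iso A B.
     \<forall>c. \<forall>a \<in> carrier A. h (c \<odot>\<^bsub>A\<^esub> a) = c \<odot>\<^bsub>B\<^esub> h a}"

text \<open>On a coset, scalars act as in \<^const>\<open>rcoset_mult\<close>: through all representatives.\<close>

definition alg_quot :: "('k, 'a) module \<Rightarrow> 'a set \<Rightarrow> ('k, 'a set) module" where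
  "alg_quot A I =
    \<lparr>carrier = carrier (A Quot I), mult = mult (A Quot I), one = one (A Quot I),
     zero = zero (A Quot I), add = add (A Quot I),
     smult = (\<lambda>c U. \<Union>u\<in>U. I +>\<^bsub>A\<^esub> (c \<odot>\<^bsub>A\<^esub> u))\<rparr>"


section \<open>Free algebras and presentations\<close>

text \<open>
  Words form the free monoid, written additively so that the convolution product of
  \<^type>\<open>poly_mapping\<close> makes finitely supported functions on words into the free associative
  algebra.
\<close>

datatype 'g word = Word (letters: "'g list")

instantiation word :: (type) monoid_add
begin

definition zero_word :: "'a word" where
  "zero_word = Word []"

definition plus_word :: "'a word \<Rightarrow> 'a word \<Rightarrow> 'a word" where
  "plus_word u v = Word (letters u @ letters v)"

instance
  by standard (simp_all add: zero_word_def plus_word_def)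

end

definition var :: "'g \<Rightarrow> 'g word \<Rightarrow>\<^sub>0 'c::comm_ring_1" where
  "var g = Poly_Mapping.single (Word [g]) 1"

definition scalar :: "'c \<Rightarrow> 'g word \<Rightarrow>\<^sub>0 'c::comm_ring_1" where
  "scalar c = Poly_Mapping.single 0 c"

definition free_alg :: "'g set \<Rightarrow> ('c::comm_ring_1, 'g word \<Rightarrow>\<^sub>0 'c) module" where
  "free_alg S =
    \<lparr>carrier = {p. \<forall>w \<in> Poly_Mapping.keys p. set (letters w) \<subseteq> S},
     mult = (*), one = 1, zero = 0, add = (+), smult = (\<lambda>c p. scalar c * p)\<rparr>"

text \<open>
  A relation \<open>l = r\<close> is encoded by the pair \<open>(l, r)\<close>. Note that \<^const>\<open>genideal\<close> is the
  two-sided ideal generated by a set.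
\<close>

definition pres_ideal ::
    "'g set \<Rightarrow> (('g word \<Rightarrow>\<^sub>0 'c) \<times> ('g word \<Rightarrow>\<^sub>0 'c)) set \<Rightarrow> ('g word \<Rightarrow>\<^sub>0 'c::comm_ring_1) set" where
  "pres_ideal S rels = Idl\<^bsub>free_alg S\<^esub> ((\<lambda>(l, r). l - r) ` rels)"

datatype 'g letter = Pos 'g | Neg 'g

definition inv_rels ::
    "(('g letter word \<Rightarrow>\<^sub>0 'c::comm_ring_1) \<times> ('g letter word \<Rightarrow>\<^sub>0 'c)) set" where
  "inv_rels = (\<Union>g. {(var (Pos g) * var (Neg g), 1), (var (Neg g) * var (Pos g), 1)})"

text \<open>The algebra generated by invertible elements, one for each element of the type
  \<^typ>\<open>'g\<close>, subject to the relations \<open>rels\<close>.\<close>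

definition inv_pres ::
    "(('g letter word \<Rightarrow>\<^sub>0 'c) \<times> ('g letter word \<Rightarrow>\<^sub>0 'c)) set
      \<Rightarrow> ('c::comm_ring_1, ('g letter word \<Rightarrow>\<^sub>0 'c) set) module" where
  "inv_pres rels = alg_quot (free_alg UNIV) (pres_ideal UNIV (inv_rels \<union> rels))"

definition inv_pres_gen ::
    "(('g letter word \<Rightarrow>\<^sub>0 'c) \<times> ('g letter word \<Rightarrow>\<^sub>0 'c)) set
      \<Rightarrow> 'g \<Rightarrow> ('g letter word \<Rightarrow>\<^sub>0 'c::comm_ring_1) set" where
  "inv_pres_gen rels g =
     pres_ideal UNIV (inv_rels \<union> rels) +>\<^bsub>(free_alg UNIV :: ('c, _) module)\<^esub> var (Pos g)"


section \<open>The double affine Hecke algebra of \<open>GL\<^sub>2\<close>\<close>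

text \<open>Here and below the parameter \<open>s\<close> is the chosen square root of \<open>t\<close>.\<close>

datatype daha_gen = T | X1 | X2 | Y1 | Y2

definition daha_rels ::
    "'k \<Rightarrow> 'k \<Rightarrow> ((daha_gen letter word \<Rightarrow>\<^sub>0 'k::field) \<times> (daha_gen letter word \<Rightarrow>\<^sub>0 'k)) set" where
  "daha_rels q s =
    (let v = (\<lambda>g. var (Pos g)); v' = (\<lambda>g. var (Neg g)) in
     {(v X1 * v X2, v X2 * v X1),
      (v Y1 * v Y2, v Y2 * v Y1),
      ((v T - scalar s) * (v T + scalar (inverse s)), 0),
      (v' Y2 * v X1 * v Y2 * v' X1, v T * v T),
      (v' T * v Y1 * v' T, v Y2),
      (v T * v X1 * v T, v X2),
      (v Y1 * v Y2 * v X1, scalar q * v X1 * v Y1 * v Y2),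
      (v Y1 * v Y2 * v X2, scalar q * v X2 * v Y1 * v Y2),
      (v X1 * v X2 * v Y1, scalar (inverse q) * v Y1 * v X1 * v X2),
      (v X1 * v X2 * v Y2, scalar (inverse q) * v Y2 * v X1 * v X2)})"

definition daha :: "'k \<Rightarrow> 'k \<Rightarrow> ('k::field, (daha_gen letter word \<Rightarrow>\<^sub>0 'k) set) module" where
  "daha q s = inv_pres (daha_rels q s)"

definition hgen :: "'k \<Rightarrow> 'k \<Rightarrow> daha_gen \<Rightarrow> (daha_gen letter word \<Rightarrow>\<^sub>0 'k::field) set" where
  "hgen q s = inv_pres_gen (daha_rels q s)"


section \<open>The quantum torus\<close>

datatype torus_gen = Z1 | Z2 | Z3

type_synonym 'k qt = "(torus_gen letter word \<Rightarrow>\<^sub>0 'k) set"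

definition torus_rels ::
    "'k \<Rightarrow> ((torus_gen letter word \<Rightarrow>\<^sub>0 'k::field) \<times> (torus_gen letter word \<Rightarrow>\<^sub>0 'k)) set" where
  "torus_rels q =
    (let v = (\<lambda>g. var (Pos g)) in
     {(v Z1 * v Z2, v Z2 * v Z1),
      (v Z1 * v Z3, scalar (inverse q) * v Z3 * v Z1),
      (v Z2 * v Z3, scalar (inverse q) * v Z3 * v Z2)})"

definition qtorus :: "'k \<Rightarrow> ('k::field, 'k qt) module" where
  "qtorus q = inv_pres (torus_rels q)"

definition zgen :: "'k \<Rightarrow> torus_gen \<Rightarrow> 'k::field qt" where
  "zgen q = inv_pres_gen (torus_rels q)"


section \<open>Ore extensions\<close>

text \<open>
  An element \<open>\<Sum>\<^sub>n p\<^sub>n x\<^sup>n\<close> is represented by its coefficient function \<open>p\<close>. Left multiplication by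
  \<open>x\<close> is \<open>ore_shift\<close>, because \<open>x (\<Sum>\<^sub>n p\<^sub>n x\<^sup>n) = \<Sum>\<^sub>n (\<tau>(p\<^sub>n) x\<^sup>n\<^sup>+\<^sup>1 + \<delta>(p\<^sub>n) x\<^sup>n)\<close>, and the product is
  then forced: \<open>(\<Sum>\<^sub>i p\<^sub>i x\<^sup>i) r = \<Sum>\<^sub>i p\<^sub>i (x\<^sup>i r)\<close>.
\<close>

definition ore_shift ::
    "('k, 'a) module \<Rightarrow> ('a \<Rightarrow> 'a) \<Rightarrow> ('a \<Rightarrow> 'a) \<Rightarrow> (nat \<Rightarrow> 'a) \<Rightarrow> nat \<Rightarrow> 'a" where
  "ore_shift R \<tau> \<delta> p =
     (\<lambda>n. (case n of 0 \<Rightarrow> \<zero>\<^bsub>R\<^esub> | Suc m \<Rightarrow> \<tau> (p m)) \<oplus>\<^bsub>R\<^esub> \<delta> (p n))"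

definition ore_const :: "('k, 'a) module \<Rightarrow> 'a \<Rightarrow> nat \<Rightarrow> 'a" where
  "ore_const R r = (\<lambda>n. if n = 0 then r else \<zero>\<^bsub>R\<^esub>)"

definition ore_var :: "('k, 'a) module \<Rightarrow> nat \<Rightarrow> 'a" where
  "ore_var R = (\<lambda>n. if n = 1 then \<one>\<^bsub>R\<^esub> else \<zero>\<^bsub>R\<^esub>)"

definition ore_ext ::
    "('k, 'a) module \<Rightarrow> ('a \<Rightarrow> 'a) \<Rightarrow> ('a \<Rightarrow> 'a) \<Rightarrow> ('k, nat \<Rightarrow> 'a) module" where
  "ore_ext R \<tau> \<delta> =
    \<lparr>carrier = up R,
     mult = (\<lambda>p r n. \<Oplus>\<^bsub>R\<^esub>i\<in>{i. p i \<noteq> \<zero>\<^bsub>R\<^esub>}. p i \<otimes>\<^bsub>R\<^esub> (ore_shift R \<tau> \<delta> ^^ i) r n),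
     one = ore_const R \<one>\<^bsub>R\<^esub>,
     zero = ore_const R \<zero>\<^bsub>R\<^esub>,
     add = (\<lambda>p r n. p n \<oplus>\<^bsub>R\<^esub> r n),
     smult = (\<lambda>c p n. c \<odot>\<^bsub>R\<^esub> p n)\<rparr>"


section \<open>The algebras \<open>Q\<^sub>1\<close> and \<open>Q\<^sub>2\<close>\<close>

text \<open>Automorphisms are made unique as HOL functions by requiring them to be
  \<^const>\<open>undefined\<close> outside the carrier.\<close>

definition torus_aut :: "'k \<Rightarrow> 'k qt \<Rightarrow> 'k qt \<Rightarrow> 'k qt \<Rightarrow> 'k::field qt \<Rightarrow> 'k qt" where
  "torus_aut q a b c =
    (THE \<tau>. \<tau> \<in> alg_iso (qtorus q) (qtorus q) \<and> \<tau> \<in> extensional (carrier (qtorus q)) \<and>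
       \<tau> (zgen q Z1) = a \<and> \<tau> (zgen q Z2) = b \<and> \<tau> (zgen q Z3) = c)"

definition tau1 :: "'k \<Rightarrow> 'k::field qt \<Rightarrow> 'k qt" where
  "tau1 q = torus_aut q (zgen q Z2) (zgen q Z1) (zgen q Z3)"

definition tau2 :: "'k \<Rightarrow> 'k::field qt \<Rightarrow> 'k qt" where
  "tau2 q = torus_aut q (zgen q Z2) (inverse q \<odot>\<^bsub>qtorus q\<^esub> zgen q Z1) (zgen q Z3)"

definition alpha :: "'k::field \<Rightarrow> 'k" where
  "alpha s = (s - inverse s) / 2"

text \<open>The fraction in \<open>\<delta>\<^sub>1 = - \<alpha> (z\<^sub>1 + z\<^sub>2) / (z\<^sub>1 - z\<^sub>2) (1 - \<tau>\<^sub>1)\<close> is a left fraction: \<open>\<delta>\<^sub>1(r)\<close> is the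
  element \<open>d\<close> of \<open>R\<close> with \<open>(z\<^sub>1 - z\<^sub>2) d = - \<alpha> (z\<^sub>1 + z\<^sub>2) (r - \<tau>\<^sub>1(r))\<close>; it is unique as \<open>R\<close> is a
  domain.\<close>

definition delta1 :: "'k \<Rightarrow> 'k \<Rightarrow> 'k::field qt \<Rightarrow> 'k qt" where
  "delta1 q s r =
    (let R = qtorus q in
     THE d. d \<in> carrier R \<and>
       (zgen q Z1 \<ominus>\<^bsub>R\<^esub> zgen q Z2) \<otimes>\<^bsub>R\<^esub> d =
         (- alpha s) \<odot>\<^bsub>R\<^esub> ((zgen q Z1 \<oplus>\<^bsub>R\<^esub> zgen q Z2) \<otimes>\<^bsub>R\<^esub> (r \<ominus>\<^bsub>R\<^esub> tau1 q r)))"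

definition Ore1 :: "'k \<Rightarrow> 'k \<Rightarrow> ('k::field, nat \<Rightarrow> 'k qt) module" where
  "Ore1 q s = ore_ext (qtorus q) (tau1 q) (delta1 q s)"

definition I1 :: "'k \<Rightarrow> 'k \<Rightarrow> (nat \<Rightarrow> 'k::field qt) set" where
  "I1 q s =
    (let A = Ore1 q s; x = ore_var (qtorus q) in
     Idl\<^bsub>A\<^esub> {x [^]\<^bsub>A\<^esub> (2::nat) \<ominus>\<^bsub>A\<^esub> ((s + inverse s) / 2) ^ 2 \<odot>\<^bsub>A\<^esub> \<one>\<^bsub>A\<^esub>})"

definition Q1 :: "'k \<Rightarrow> 'k \<Rightarrow> ('k::field, (nat \<Rightarrow> 'k qt) set) module" where
  "Q1 q s = alg_quot (Ore1 q s) (I1 q s)"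

definition Q1_incl :: "'k \<Rightarrow> 'k \<Rightarrow> 'k::field qt \<Rightarrow> (nat \<Rightarrow> 'k qt) set" where
  "Q1_incl q s r = I1 q s +>\<^bsub>Ore1 q s\<^esub> ore_const (qtorus q) r"

definition Q1_x :: "'k \<Rightarrow> 'k \<Rightarrow> (nat \<Rightarrow> 'k::field qt) set" where
  "Q1_x q s = I1 q s +>\<^bsub>Ore1 q s\<^esub> ore_var (qtorus q)"

definition Ore2 :: "'k \<Rightarrow> ('k::field, nat \<Rightarrow> 'k qt) module" where
  "Ore2 q = ore_ext (qtorus q) (tau2 q) (\<lambda>_. \<zero>\<^bsub>qtorus q\<^esub>)"

definition I2 :: "'k \<Rightarrow> (nat \<Rightarrow> 'k::field qt) set" where
  "I2 q =
    (let A = Ore2 q; y = ore_var (qtorus q) in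
     Idl\<^bsub>A\<^esub> {y [^]\<^bsub>A\<^esub> (2::nat) \<ominus>\<^bsub>A\<^esub> ore_const (qtorus q) (inv\<^bsub>qtorus q\<^esub> zgen q Z3)})"

definition Q2 :: "'k \<Rightarrow> ('k::field, (nat \<Rightarrow> 'k qt) set) module" where
  "Q2 q = alg_quot (Ore2 q) (I2 q)"

definition Q2_incl :: "'k \<Rightarrow> 'k::field qt \<Rightarrow> (nat \<Rightarrow> 'k qt) set" where
  "Q2_incl q r = I2 q +>\<^bsub>Ore2 q\<^esub> ore_const (qtorus q) r"

definition Q2_y :: "'k \<Rightarrow> (nat \<Rightarrow> 'k::field qt) set" where
  "Q2_y q = I2 q +>\<^bsub>Ore2 q\<^esub> ore_var (qtorus q)"


section \<open>Amalgamated products of rings\<close>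

text \<open>
  The pushout of ring homomorphisms \<open>f : R \<rightarrow> A\<close> and \<open>g : R \<rightarrow> B\<close>: the free (integral) ring on
  symbols for the elements of \<open>A\<close> and of \<open>B\<close>, modulo the relations making the two symbol maps
  \<open>A \<rightarrow> _\<close> and \<open>B \<rightarrow> _\<close> ring homomorphisms (\<open>hom_rels\<close>), and the identification of \<open>f r\<close> with
  \<open>g r\<close>. A ring homomorphism out of this ring is the same as a pair of homomorphisms out of \<open>A\<close> and
  \<open>B\<close> that agree on \<open>R\<close>.
\<close>

definition hom_rels ::
    "('a, 'm) ring_scheme \<Rightarrow> ('a \<Rightarrow> 'r::ring_1) \<Rightarrow> ('r \<times> 'r) set" where
  "hom_rels A e =
     {(e (a \<oplus>\<^bsub>A\<^esub> a'), e a + e a') | a a'. a \<in> carrier A \<and> a' \<in> carrier A} \<union>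
     {(e (a \<otimes>\<^bsub>A\<^esub> a'), e a * e a') | a a'. a \<in> carrier A \<and> a' \<in> carrier A} \<union>
     {(e \<one>\<^bsub>A\<^esub>, 1)}"

definition amalg_ideal ::
    "('r, 'm) ring_scheme \<Rightarrow> ('a, 'n) ring_scheme \<Rightarrow> ('b, 'l) ring_scheme
      \<Rightarrow> ('r \<Rightarrow> 'a) \<Rightarrow> ('r \<Rightarrow> 'b) \<Rightarrow> (('a + 'b) word \<Rightarrow>\<^sub>0 int) set" where
  "amalg_ideal R A B f g =
     pres_ideal (carrier A <+> carrier B)
       (hom_rels A (\<lambda>a. var (Inl a)) \<union> hom_rels B (\<lambda>b. var (Inr b)) \<union>
        {(var (Inl (f r)), var (Inr (g r))) | r. r \<in> carrier R})"

definition amalg ::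
    "('r, 'm) ring_scheme \<Rightarrow> ('a, 'n) ring_scheme \<Rightarrow> ('b, 'l) ring_scheme
      \<Rightarrow> ('r \<Rightarrow> 'a) \<Rightarrow> ('r \<Rightarrow> 'b) \<Rightarrow> (('a + 'b) word \<Rightarrow>\<^sub>0 int) set ring" where
  "amalg R A B f g =
     (free_alg (carrier A <+> carrier B) :: (int, _) module) Quot amalg_ideal R A B f g"

definition amalg_inl ::
    "('r, 'm) ring_scheme \<Rightarrow> ('a, 'n) ring_scheme \<Rightarrow> ('b, 'l) ring_scheme
      \<Rightarrow> ('r \<Rightarrow> 'a) \<Rightarrow> ('r \<Rightarrow> 'b) \<Rightarrow> 'a \<Rightarrow> (('a + 'b) word \<Rightarrow>\<^sub>0 int) set" where
  "amalg_inl R A B f g a =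
     amalg_ideal R A B f g +>\<^bsub>(free_alg (carrier A <+> carrier B) :: (int, _) module)\<^esub> var (Inl a)"

definition amalg_inr ::
    "('r, 'm) ring_scheme \<Rightarrow> ('a, 'n) ring_scheme \<Rightarrow> ('b, 'l) ring_scheme
      \<Rightarrow> ('r \<Rightarrow> 'a) \<Rightarrow> ('r \<Rightarrow> 'b) \<Rightarrow> 'b \<Rightarrow> (('a + 'b) word \<Rightarrow>\<^sub>0 int) set" where
  "amalg_inr R A B f g b =
     amalg_ideal R A B f g +>\<^bsub>(free_alg (carrier A <+> carrier B) :: (int, _) module)\<^esub> var (Inr b)"


section \<open>The algebra \<open>Q\<close>\<close>

type_synonym 'k Qelt = "(((nat \<Rightarrow> 'k qt) set + (nat \<Rightarrow> 'k qt) set) word \<Rightarrow>\<^sub>0 int) set"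

definition Qring :: "'k \<Rightarrow> 'k \<Rightarrow> 'k::field Qelt ring" where
  "Qring q s = amalg (qtorus q) (Q1 q s) (Q2 q) (Q1_incl q s) (Q2_incl q)"

definition from_Q1 :: "'k \<Rightarrow> 'k \<Rightarrow> (nat \<Rightarrow> 'k::field qt) set \<Rightarrow> 'k Qelt" where
  "from_Q1 q s = amalg_inl (qtorus q) (Q1 q s) (Q2 q) (Q1_incl q s) (Q2_incl q)"

definition from_Q2 :: "'k \<Rightarrow> 'k \<Rightarrow> (nat \<Rightarrow> 'k::field qt) set \<Rightarrow> 'k Qelt" where
  "from_Q2 q s = amalg_inr (qtorus q) (Q1 q s) (Q2 q) (Q1_incl q s) (Q2_incl q)"

text \<open>The image of \<open>R\<close> in the pushout; factoring through \<open>Q\<^sub>2\<close> instead gives the same map.\<close>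

definition from_R :: "'k \<Rightarrow> 'k \<Rightarrow> 'k::field qt \<Rightarrow> 'k Qelt" where
  "from_R q s r = from_Q1 q s (Q1_incl q s r)"

text \<open>The pushout is formed in the category of rings; it is a \<open>k\<close>-algebra through the (central)
  image of \<open>k \<subseteq> R\<close>.\<close>

definition Q :: "'k \<Rightarrow> 'k \<Rightarrow> ('k::field, 'k Qelt) module" where
  "Q q s =
    \<lparr>carrier = carrier (Qring q s), mult = mult (Qring q s), one = one (Qring q s),
     zero = zero (Qring q s), add = add (Qring q s),
     smult = (\<lambda>c u. from_R q s (c \<odot>\<^bsub>qtorus q\<^esub> \<one>\<^bsub>qtorus q\<^esub>) \<otimes>\<^bsub>Qring q s\<^esub> u)\<rparr>"

end

theory Submission
  imports Defs
begin

text \<open>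
  Both algebras are given by generators and relations, and the isomorphism is a change of
  generators. In the double affine Hecke algebra put \<open>x = T - \<alpha>\<close> and \<open>y = Y\<^sub>1\<^sup>-\<^sup>1 T\<close>. The quadratic relation
  \<open>T\<^sup>2 = 2\<alpha> T + 1\<close> becomes \<open>x\<^sup>2 = 1 + \<alpha>\<^sup>2\<close>, and \<open>T X\<^sub>1 T = X\<^sub>2\<close>, rewritten as \<open>T X\<^sub>1 = X\<^sub>2 (T - 2\<alpha>)\<close>, becomes the
  commutation rule of \<open>x\<close> with the torus generated by \<open>X\<^sub>1\<close>, \<open>X\<^sub>2\<close> and \<open>Y\<^sub>1 Y\<^sub>2\<close>, where \<open>T\<close> commutes with
  \<open>Y\<^sub>1 Y\<^sub>2\<close>. Since \<open>Y\<^sub>1 = T Y\<^sub>2 T\<close>, also \<open>y = T\<^sup>-\<^sup>1 Y\<^sub>2\<^sup>-\<^sup>1\<close>, whence \<open>y\<^sup>2 = (Y\<^sub>1 Y\<^sub>2)\<^sup>-\<^sup>1\<close>, while the cross relation says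
  \<open>y X\<^sub>1 = X\<^sub>2 y\<close>; conjugation by \<open>y\<^sup>2\<close> then gives \<open>y X\<^sub>2 = q\<^sup>-\<^sup>1 X\<^sub>1 y\<close>. So the relations of \<open>Q\<^sub>1\<close> and \<open>Q\<^sub>2\<close> hold
  (locale \<open>daha_elements\<close>). Conversely \<open>T = x + \<alpha>\<close>, \<open>Y\<^sub>1 = T y\<^sup>-\<^sup>1\<close> and \<open>Y\<^sub>2 = y\<^sup>-\<^sup>1 T\<^sup>-\<^sup>1\<close> recover all the relations of the
  Hecke algebra (locale \<open>amalg_elements\<close>).

  To turn these computations into homomorphisms, each construction is equipped with its universal
  property and with an induction principle over generators: presented algebras (\<open>inv_pres_lift\<close>,
  \<open>inv_pres_induct\<close>), Ore extensions (\<open>ore_lift\<close>), their quotients by \<open>x\<^sup>2 - w\<close> (\<open>QQ_lift\<close>) and pushouts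
  (\<open>amalg_lift\<close>). Homomorphisms out of \<open>Q\<close> are then described by \<open>Q_lift\<close>. A commutation rule with the whole
  torus has to be verified on generators only (\<open>torus_skew_rel\<close>), and composites are identified on
  generators.

  Universal properties do not suffice at one point: \<open>\<delta>\<^sub>1\<close> is a fraction with denominator \<open>z\<^sub>1 - z\<^sub>2\<close>, and
  for it to be a well-defined \<open>\<tau>\<^sub>1\<close>-derivation, without which the Ore extension would not be a ring, \<open>z\<^sub>1 - z\<^sub>2\<close>
  has to be cancellable (\<open>z1_minus_z2_regular\<close>). This uses a faithful action of the torus by weighted shifts on
  finitely supported functions on \<open>\<int>\<^sup>3\<close>, on which a difference of two independent shifts is injective.
\<close>

section \<open>Quotient rings\<close>

text \<open>
  The records of an algebra and of its underlying ring have different types, so ring axioms have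
  to be carried from one to the other field by field.
\<close>

lemma ring_cong:
  assumes "ring A" "carrier B = carrier A" "mult B = mult A" "one B = one A"
    "zero B = zero A" "add B = add A"
  shows "ring B"
proof -
  interpret A: ring A by fact
  show ?thesis
  proof (rule ringI)
    show "abelian_group B"
      by (rule abelian_groupI)
        (use assms A.add.l_inv_ex in \<open>auto simp: A.a_ac\<close>)
    show "Group.monoid B"
      by (rule monoidI) (use assms in \<open>auto simp: A.m_assoc\<close>)
  qed (use assms in \<open>auto simp: A.l_distr A.r_distr\<close>)
qed

lemma ring_hom_diff:
  assumes "ring A" "ring B" "f \<in> ring_hom A B" "a \<in> carrier A" "b \<in> carrier A"
  shows "f (a \<ominus>\<^bsub>A\<^esub> b) = f a \<ominus>\<^bsub>B\<^esub> f b"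
proof -
  interpret ring_hom_ring A B f using assms by (simp add: ring_hom_ringI2)
  show ?thesis using assms by (simp add: R.minus_eq S.minus_eq)
qed

lemma (in ring) minus_zero_iff:
  assumes "a \<in> carrier R" "b \<in> carrier R"
  shows "a \<ominus> b = \<zero> \<longleftrightarrow> a = b"
  using assms by (metis add.inv_solve_right l_zero minus_eq zero_closed)

text \<open>
  The kernel of \<open>f\<close> is one of the ideals whose intersection is the generated ideal.
\<close>

lemma genideal_vanishing:
  assumes "ring A" "ring B" "f \<in> ring_hom A B" "S \<subseteq> carrier A"
    "\<And>s. s \<in> S \<Longrightarrow> f s = \<zero>\<^bsub>B\<^esub>" "i \<in> Idl\<^bsub>A\<^esub> S"
  shows "f i = \<zero>\<^bsub>B\<^esub>"
proof -
  interpret ring_hom_ring A B f using assms by (simp add: ring_hom_ringI2)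
  have "Idl\<^bsub>A\<^esub> S \<subseteq> a_kernel A B f"
  proof (rule R.genideal_minimal)
    show "ideal (a_kernel A B f) A" by (rule kernel_is_ideal)
    show "S \<subseteq> a_kernel A B f"
      using assms(4,5) unfolding a_kernel_def' by blast
  qed
  then show ?thesis using assms(6) unfolding a_kernel_def' by blast
qed

text \<open>
  The factored map evaluates \<open>f\<close> at a chosen representative of a coset. Two representatives
  differ by an element of \<open>I\<close>, so the choice does not matter, and compatibility with the ring operations
  is inherited from the surjection onto the quotient.
\<close>

lemma quot_lift:
  assumes "ring A" "ring B" "ideal I A" "f \<in> ring_hom A B" "\<And>i. i \<in> I \<Longrightarrow> f i = \<zero>\<^bsub>B\<^esub>"
  shows "\<exists>h \<in> ring_hom (A Quot I) B. \<forall>a \<in> carrier A. h (I +>\<^bsub>A\<^esub> a) = f a"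
proof -
  interpret I: ideal I A by fact
  interpret ring_hom_ring A B f using assms by (simp add: ring_hom_ringI2)
  interpret Q: ring "A Quot I" by (rule I.quotient_is_ring)
  define h where "h U = f (SOME a. a \<in> carrier A \<and> U = I +>\<^bsub>A\<^esub> a)" for U
  have h: "h (I +>\<^bsub>A\<^esub> a) = f a" if a: "a \<in> carrier A" for a
  proof -
    let ?b = "SOME b. b \<in> carrier A \<and> I +>\<^bsub>A\<^esub> a = I +>\<^bsub>A\<^esub> b"
    have b: "?b \<in> carrier A" "I +>\<^bsub>A\<^esub> a = I +>\<^bsub>A\<^esub> ?b"
      using someI[of "\<lambda>b. b \<in> carrier A \<and> I +>\<^bsub>A\<^esub> a = I +>\<^bsub>A\<^esub> b" a] a by auto
    then have "a \<ominus>\<^bsub>A\<^esub> ?b \<in> I"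
      using a I.quotient_eq_iff_same_a_r_cos[OF assms(3)] by simp
    then have "f (a \<ominus>\<^bsub>A\<^esub> ?b) = \<zero>\<^bsub>B\<^esub>" by (rule assms(5))
    then have "f a = f ?b"
      using a b S.minus_zero_iff by (simp add: ring_hom_diff[OF assms(1,2,4)])
    then show ?thesis by (simp add: h_def)
  qed
  have surj: "\<exists>a\<in>carrier A. U = I +>\<^bsub>A\<^esub> a" if "U \<in> carrier (A Quot I)" for U
    using that by (auto simp: FactRing_def A_RCOSETS_def')
  note pi = I.rcos_ring_hom
  have "h \<in> ring_hom (A Quot I) B"
  proof (rule ring_hom_memI)
    fix U assume "U \<in> carrier (A Quot I)"
    then obtain a where a: "a \<in> carrier A" "U = I +>\<^bsub>A\<^esub> a" using surj by blast
    then show "h U \<in> carrier B" by (simp add: h)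
    fix V assume "V \<in> carrier (A Quot I)"
    then obtain b where b: "b \<in> carrier A" "V = I +>\<^bsub>A\<^esub> b" using surj by blast
    show "h (U \<otimes>\<^bsub>A Quot I\<^esub> V) = h U \<otimes>\<^bsub>B\<^esub> h V"
      using a b h ring_hom_mult[OF pi a(1) b(1)] by (metis I.m_closed hom_mult)
    show "h (U \<oplus>\<^bsub>A Quot I\<^esub> V) = h U \<oplus>\<^bsub>B\<^esub> h V"
      using a b h ring_hom_add[OF pi a(1) b(1)] by (metis I.a_closed hom_add)
  next
    show "h \<one>\<^bsub>A Quot I\<^esub> = \<one>\<^bsub>B\<^esub>"
      using h[of "\<one>\<^bsub>A\<^esub>"] ring_hom_one[OF pi] by simp
  qed
  with h show ?thesis by blast
qed

lemma ring_alg_quot: "ideal I A \<Longrightarrow> ring (alg_quot A I)"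
  by (rule ring_cong[OF ideal.quotient_is_ring]) (auto simp: alg_quot_def)

lemma ring_hom_alg_quot [simp]:
  "ring_hom (alg_quot A I) B = ring_hom (A Quot I) B"
  "ring_hom B (alg_quot A I) = ring_hom B (A Quot I)"
  by (simp_all add: alg_quot_def ring_hom_def)

lemma carrier_quot: "carrier (A Quot I) = (\<lambda>a. I +>\<^bsub>A\<^esub> a) ` carrier A"
  by (auto simp: FactRing_def A_RCOSETS_def')

lemma carrier_alg_quot: "carrier (alg_quot A I) = (\<lambda>a. I +>\<^bsub>A\<^esub> a) ` carrier A"
  by (simp add: alg_quot_def carrier_quot)

lemma coset_eqI:
  assumes "ring A" "ideal I A" "a \<in> carrier A" "b \<in> carrier A" "a \<ominus>\<^bsub>A\<^esub> b \<in> I"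
  shows "I +>\<^bsub>A\<^esub> a = I +>\<^bsub>A\<^esub> b"
  using ring.quotient_eq_iff_same_a_r_cos[OF assms(1,2,3,4)] assms(5) by simp


section \<open>Free algebras\<close>

text \<open>
  Finitely supported functions are built from one-point functions by addition. The support
  is confined to \<open>W\<close> because the free algebra on a proper subset of the type of generators
  contains only some of the words.
\<close>

lemma poly_mapping_keys_induct:
  assumes "Poly_Mapping.keys p \<subseteq> W"
    and "P 0" "\<And>w c. w \<in> W \<Longrightarrow> P (Poly_Mapping.single w c)"
    and "\<And>p q. P p \<Longrightarrow> P q \<Longrightarrow> P (p + q)"
  shows "P (p :: 'a \<Rightarrow>\<^sub>0 'b::comm_monoid_add)"
  using assms(1)
proof (induction p rule: Poly_Mapping.update_induct)
  case const
  then show ?case using assms(2) by simp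
next
  case (update f a b)
  have eq: "Poly_Mapping.update a b f = f + Poly_Mapping.single a b"
    using update(1) by (intro poly_mapping_eqI)
      (auto simp: lookup_add lookup_update lookup_single when_def in_keys_iff)
  have "Poly_Mapping.keys (Poly_Mapping.update a b f) = insert a (Poly_Mapping.keys f)"
    using update(1,2) by (auto simp: in_keys_iff lookup_update split: if_splits)
  then show ?case using update assms(3,4) by (simp add: eq)
qed

definition scalar_map :: "('b, 'm) ring_scheme \<Rightarrow> ('c::comm_ring_1 \<Rightarrow> 'b) \<Rightarrow> bool" where
  "scalar_map B \<eta> \<longleftrightarrow> (\<forall>c. \<eta> c \<in> carrier B) \<and> \<eta> 1 = \<one>\<^bsub>B\<^esub> \<and>
     (\<forall>c d. \<eta> (c + d) = \<eta> c \<oplus>\<^bsub>B\<^esub> \<eta> d) \<and> (\<forall>c d. \<eta> (c * d) = \<eta> c \<otimes>\<^bsub>B\<^esub> \<eta> d)"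

locale scalars = ring B for B (structure) +
  fixes \<eta> :: "'c::comm_ring_1 \<Rightarrow> 'a"
  assumes scal: "scalar_map B \<eta>"
begin

lemma eta_closed [simp]: "\<eta> c \<in> carrier B"
  and eta_one [simp]: "\<eta> 1 = \<one>"
  and eta_add: "\<eta> (c + d) = \<eta> c \<oplus> \<eta> d"
  and eta_mult: "\<eta> (c * d) = \<eta> c \<otimes> \<eta> d"
  using scal by (auto simp: scalar_map_def)

lemma eta_zero [simp]: "\<eta> 0 = \<zero>"
  using eta_add[of 0 0] by (metis add.l_cancel_one eta_closed add_0)

definition lin_ext :: "('w \<Rightarrow> 'a) \<Rightarrow> ('w \<Rightarrow>\<^sub>0 'c) \<Rightarrow> 'a" where
  "lin_ext m p = (\<Oplus>w\<in>Poly_Mapping.keys p. \<eta> (Poly_Mapping.lookup p w) \<otimes> m w)"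

context
  fixes m :: "'w \<Rightarrow> 'a"
  assumes m: "\<And>w. m w \<in> carrier B"
begin

lemma lin_ext_closed: "lin_ext m p \<in> carrier B"
  by (auto simp: lin_ext_def m)

lemma lin_ext_superset:
  assumes "finite W" "Poly_Mapping.keys p \<subseteq> W"
  shows "lin_ext m p = (\<Oplus>w\<in>W. \<eta> (Poly_Mapping.lookup p w) \<otimes> m w)"
  unfolding lin_ext_def
  by (rule add.finprod_mono_neutral_cong_left) (use assms m in \<open>auto simp: in_keys_iff\<close>)

lemma lin_ext_add: "lin_ext m (p + q) = lin_ext m p \<oplus> lin_ext m q"
proof -
  let ?W = "Poly_Mapping.keys p \<union> Poly_Mapping.keys q"
  have "lin_ext m (p + q) = (\<Oplus>w\<in>?W. \<eta> (Poly_Mapping.lookup (p + q) w) \<otimes> m w)"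
    by (rule lin_ext_superset) (auto simp: Poly_Mapping.keys_add)
  also have "\<dots> = (\<Oplus>w\<in>?W. \<eta> (Poly_Mapping.lookup p w) \<otimes> m w \<oplus> \<eta> (Poly_Mapping.lookup q w) \<otimes> m w)"
    by (simp add: lookup_add eta_add l_distr m)
  also have "\<dots> = (\<Oplus>w\<in>?W. \<eta> (Poly_Mapping.lookup p w) \<otimes> m w) \<oplus>
      (\<Oplus>w\<in>?W. \<eta> (Poly_Mapping.lookup q w) \<otimes> m w)"
    by (rule add.finprod_multf) (auto simp: m)
  also have "\<dots> = lin_ext m p \<oplus> lin_ext m q"
    by (simp add: lin_ext_superset[of ?W])
  finally show ?thesis .
qed

lemma lin_ext_zero [simp]: "lin_ext m 0 = \<zero>"
  by (simp add: lin_ext_def)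

lemma lin_ext_single: "lin_ext m (Poly_Mapping.single w c) = \<eta> c \<otimes> m w"
proof -
  have "lin_ext m (Poly_Mapping.single w c) =
      (\<Oplus>v\<in>{w}. \<eta> (Poly_Mapping.lookup (Poly_Mapping.single w c) v) \<otimes> m v)"
    by (rule lin_ext_superset) auto
  also have "\<dots> = \<eta> c \<otimes> m w"
    by (subst add.finprod_insert) (auto simp: m)
  finally show ?thesis .
qed

end

end

lemma scalar_add: "scalar (c + d) = scalar c + scalar d"
  by (simp add: scalar_def single_add)

lemma scalar_mult: "scalar (c * d) = scalar c * scalar d"
  by (simp add: scalar_def mult_single)

lemma scalar_one [simp]: "scalar 1 = 1"
  by (simp add: scalar_def)

lemma scalar_comm: "scalar c * p = p * scalar c"
  using poly_mapping_keys_induct[of p UNIV "\<lambda>p. scalar c * p = p * scalar c"]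
  by (auto simp: scalar_def mult_single algebra_simps)

lemma word_single_Cons:
  "Poly_Mapping.single (Word (g # w)) c = scalar c * var g * Poly_Mapping.single (Word w) 1"
  by (simp add: scalar_def var_def mult_single plus_word_def zero_word_def)

lemma free_alg_simps [simp]:
  "mult (free_alg S) = (*)" "one (free_alg S) = 1" "zero (free_alg S) = 0"
  "add (free_alg S) = (+)" "smult (free_alg S) = (\<lambda>c p. scalar c * p)"
  by (simp_all add: free_alg_def)

lemma free_alg_carrier_iff:
  "p \<in> carrier (free_alg S) \<longleftrightarrow> (\<forall>w \<in> Poly_Mapping.keys p. set (letters w) \<subseteq> S)"
  by (simp add: free_alg_def)

lemma free_alg_carrier_UNIV [simp]: "carrier (free_alg UNIV) = UNIV"
  by (simp add: free_alg_def)

lemma free_alg_scalar [simp]: "scalar c \<in> carrier (free_alg S)"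
  by (auto simp: free_alg_carrier_iff scalar_def zero_word_def split: if_splits)

lemma free_alg_var: "g \<in> S \<Longrightarrow> var g \<in> carrier (free_alg S)"
  by (auto simp: free_alg_carrier_iff var_def)

lemma free_alg_add: "p \<in> carrier (free_alg S) \<Longrightarrow> q \<in> carrier (free_alg S) \<Longrightarrow> p + q \<in> carrier (free_alg S)"
  unfolding free_alg_carrier_iff using Poly_Mapping.keys_add[of p q] by blast

lemma free_alg_uminus: "p \<in> carrier (free_alg S) \<Longrightarrow> - p \<in> carrier (free_alg S)"
  unfolding free_alg_carrier_iff by (simp add: in_keys_iff)

lemma free_alg_mult: "p \<in> carrier (free_alg S) \<Longrightarrow> q \<in> carrier (free_alg S) \<Longrightarrow> p * q \<in> carrier (free_alg S)"
  unfolding free_alg_carrier_iff using Poly_Mapping.keys_mult[of p q] by (fastforce simp: plus_word_def)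

lemma ring_free_alg: "ring (free_alg S :: ('c::comm_ring_1, _) module)"
proof (rule ringI)
  have 1: "(1 :: _ \<Rightarrow>\<^sub>0 'c) \<in> carrier (free_alg S)"
    by (metis free_alg_scalar scalar_one)
  have 0: "(0 :: _ \<Rightarrow>\<^sub>0 'c) \<in> carrier (free_alg S)"
    by (simp add: free_alg_carrier_iff)
  show "abelian_group (free_alg S :: ('c::comm_ring_1, _) module)"
  proof (rule abelian_groupI)
    fix x :: "_ \<Rightarrow>\<^sub>0 'c"
    assume "x \<in> carrier (free_alg S)"
    then show "\<exists>y\<in>carrier (free_alg S). y \<oplus>\<^bsub>free_alg S\<^esub> x = \<zero>\<^bsub>(free_alg S :: ('c, _) module)\<^esub>"
      by (intro bexI[of _ "-x"]) (auto simp: free_alg_uminus)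
  qed (simp_all add: free_alg_add 0 algebra_simps)
  show "Group.monoid (free_alg S :: ('c::comm_ring_1, _) module)"
    by (rule monoidI) (simp_all add: free_alg_mult 1 mult.assoc)
qed (simp_all add: distrib_left distrib_right)

lemma free_alg_minus:
  assumes "p \<in> carrier (free_alg S)" "q \<in> carrier (free_alg S)"
  shows "p \<ominus>\<^bsub>(free_alg S :: ('c::comm_ring_1, _) module)\<^esub> q = p - q"
proof -
  interpret ring "free_alg S :: ('c::comm_ring_1, _) module" by (rule ring_free_alg)
  have "\<ominus>\<^bsub>free_alg S\<^esub> q = - q"
    using minus_equality[of "-q" q] assms free_alg_uminus[of q S] by simp
  then show ?thesis by (simp add: minus_eq)
qed

lemma free_alg_induct [consumes 1, case_names scalar var add mult]:
  assumes "p \<in> carrier (free_alg S)"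
    and "\<And>c. P (scalar c)" "\<And>g. g \<in> S \<Longrightarrow> P (var g)"
    and "\<And>a b. a \<in> carrier (free_alg S) \<Longrightarrow> b \<in> carrier (free_alg S) \<Longrightarrow> P a \<Longrightarrow> P b \<Longrightarrow> P (a + b)"
    and "\<And>a b. a \<in> carrier (free_alg S) \<Longrightarrow> b \<in> carrier (free_alg S) \<Longrightarrow> P a \<Longrightarrow> P b \<Longrightarrow> P (a * b)"
  shows "P p"
proof -
  let ?P = "\<lambda>p. p \<in> carrier (free_alg S) \<and> P p"
  have word: "?P (Poly_Mapping.single (Word w) c)" if "set w \<subseteq> S" for w c
    using that
  proof (induction w arbitrary: c)
    case Nil
    then show ?case using assms(2)[of c] free_alg_scalar[of c S] by (simp add: scalar_def zero_word_def)
  next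
    case (Cons g w)
    then show ?case using assms(2,3,5)
      by (auto simp: word_single_Cons free_alg_mult free_alg_var)
  qed
  have "?P p"
  proof (rule poly_mapping_keys_induct[of p "{w. set (letters w) \<subseteq> S}"])
    show "Poly_Mapping.keys p \<subseteq> {w. set (letters w) \<subseteq> S}"
      using assms(1) by (auto simp: free_alg_carrier_iff)
    show "?P 0" using assms(2)[of 0] free_alg_scalar[of 0 S] by (simp add: scalar_def)
    show "?P (Poly_Mapping.single w c)" if "w \<in> {w. set (letters w) \<subseteq> S}" for w c
      using that word[of "letters w" c] by simp
    show "?P (p + q)" if "?P p" "?P q" for p q
      using that assms(4) free_alg_add by blast
  qed
  then show ?thesis by blast
qed

text \<open>
  Evaluation of noncommutative polynomials: a word goes to the product of the images of its
  letters, and the map is extended linearly. Moving the coefficient of the second factor past the first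
  word is where it matters that scalars commute with the images of the generators.
\<close>

lemma (in scalars) free_alg_lift:
  assumes "\<And>g. g \<in> S \<Longrightarrow> b g \<in> carrier B"
    and "\<And>c g. g \<in> S \<Longrightarrow> \<eta> c \<otimes> b g = b g \<otimes> \<eta> c"
  shows "\<exists>h \<in> ring_hom (free_alg S) B. (\<forall>c. h (scalar c) = \<eta> c) \<and> (\<forall>g\<in>S. h (var g) = b g)"
proof -
  \<comment> \<open>Generators outside \<open>S\<close> get a harmless value, so that every word can be evaluated.\<close>
  define b' where "b' g = (if g \<in> S then b g else \<one>)" for g
  have b' [simp]: "b' g \<in> carrier B" for g using assms(1) by (simp add: b'_def)
  have comm: "\<eta> c \<otimes> b' g = b' g \<otimes> \<eta> c" for c g using assms(2) by (simp add: b'_def)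
  let ?ev = "\<lambda>l. foldr (\<lambda>g a. b' g \<otimes> a) l \<one>"
  define m where "m w = ?ev (letters w)" for w
  have cl: "?ev l \<in> carrier B" for l by (induction l) auto
  then have m [simp]: "m w \<in> carrier B" for w by (simp add: m_def)
  have app: "?ev (l @ l') =
      ?ev l \<otimes> ?ev l'" for l l'
    by (induction l) (simp_all add: cl m_assoc del: foldr_append)
  have m_add: "m (v + w) = m v \<otimes> m w" for v w
    by (simp add: m_def plus_word_def app del: foldr_append)
  have mc: "\<eta> c \<otimes> ?ev l = ?ev l \<otimes> \<eta> c" for c l
  proof (induction l)
    case (Cons g l)
    have "\<eta> c \<otimes> (b' g \<otimes> ?ev l) =
        b' g \<otimes> (\<eta> c \<otimes> ?ev l)"
      using cl[of l] comm[of c g] by (metis b' eta_closed m_assoc)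
    then show ?case by (simp add: Cons cl m_assoc)
  qed simp
  have m_comm: "\<eta> c \<otimes> m w = m w \<otimes> \<eta> c" for c w by (simp add: m_def mc)
  note [simp] = lin_ext_closed[of m, OF m] lin_ext_add[of m, OF m] lin_ext_zero[of m, OF m]
  note le_single = lin_ext_single[of m, OF m]
  have single: "lin_ext m (Poly_Mapping.single v c * Poly_Mapping.single w d) =
      lin_ext m (Poly_Mapping.single v c) \<otimes> lin_ext m (Poly_Mapping.single w d)" for v c w d
  proof -
    have "\<eta> c \<otimes> \<eta> d \<otimes> (m v \<otimes> m w) = \<eta> c \<otimes> (\<eta> d \<otimes> m v) \<otimes> m w"
      by (simp add: m_assoc)
    also have "\<eta> d \<otimes> m v = m v \<otimes> \<eta> d" by (rule m_comm)
    also have "\<eta> c \<otimes> (m v \<otimes> \<eta> d) \<otimes> m w =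
        (\<eta> c \<otimes> m v) \<otimes> (\<eta> d \<otimes> m w)"
      by (simp add: m_assoc)
    finally show ?thesis by (simp add: le_single mult_single m_add eta_mult)
  qed
  have "lin_ext m (Poly_Mapping.single v c * q) = lin_ext m (Poly_Mapping.single v c) \<otimes> lin_ext m q" for v c q
    by (rule poly_mapping_keys_induct[of q UNIV])
      (simp_all add: single distrib_left r_distr)
  then have mult: "lin_ext m (p * q) = lin_ext m p \<otimes> lin_ext m q" for p q
    using poly_mapping_keys_induct[of p UNIV "\<lambda>p. lin_ext m (p * q) = lin_ext m p \<otimes> lin_ext m q"]
    by (simp add: distrib_right l_distr)
  have m0: "m 0 = \<one>" by (simp add: m_def zero_word_def)
  have sc: "lin_ext m (scalar c) = \<eta> c" for c by (simp add: le_single scalar_def m0)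
  show ?thesis
  proof (intro bexI conjI allI ballI)
    show "lin_ext m \<in> ring_hom (free_alg S) B"
      by (rule ring_hom_memI) (use mult sc[of 1] in simp_all)
    show "lin_ext m (scalar c) = \<eta> c" for c by (rule sc)
    show "lin_ext m (var g) = b g" if "g \<in> S" for g
      using that b'[of g] by (simp add: le_single var_def m_def b'_def)
  qed
qed

section \<open>Algebras presented by invertible generators\<close>

lemma ring_hom_inv:
  assumes "ring A" "ring B" "f \<in> ring_hom A B" "u \<in> Units A"
  shows "f u \<in> Units B" "f (inv\<^bsub>A\<^esub> u) = inv\<^bsub>B\<^esub> f u"
proof -
  interpret A: ring A by fact
  interpret B: ring B by fact
  have u: "u \<in> carrier A" "inv\<^bsub>A\<^esub> u \<in> carrier A" using assms(4) by auto
  have c: "f u \<in> carrier B" "f (inv\<^bsub>A\<^esub> u) \<in> carrier B"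
    using u ring_hom_closed[OF assms(3)] by auto
  have e: "f u \<otimes>\<^bsub>B\<^esub> f (inv\<^bsub>A\<^esub> u) = \<one>\<^bsub>B\<^esub>" "f (inv\<^bsub>A\<^esub> u) \<otimes>\<^bsub>B\<^esub> f u = \<one>\<^bsub>B\<^esub>"
    using ring_hom_mult[OF assms(3)] u assms(4) ring_hom_one[OF assms(3)]
    by (metis A.Units_r_inv, metis A.Units_l_inv assms(4) ring_hom_mult[OF assms(3)] u ring_hom_one[OF assms(3)])
  show "f u \<in> Units B" using c e unfolding Units_def by blast
  show "f (inv\<^bsub>A\<^esub> u) = inv\<^bsub>B\<^esub> f u" using B.inv_char[OF c e] by simp
qed

lemma pres_ideal_ideal:
  assumes "\<And>l r. (l, r) \<in> rels \<Longrightarrow> l \<in> carrier (free_alg S) \<and> r \<in> carrier (free_alg S)"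
  shows "ideal (pres_ideal S rels) (free_alg S :: ('c::comm_ring_1, _) module)"
  unfolding pres_ideal_def
proof (rule ring.genideal_ideal[OF ring_free_alg])
  show "(\<lambda>(l, r). l - r) ` rels \<subseteq> carrier (free_alg S)"
  proof clarsimp
    fix l r assume "(l, r) \<in> rels"
    then show "l - r \<in> carrier (free_alg S)"
      using assms free_alg_add[of l S "-r"] free_alg_uminus[of r S] by auto
  qed
qed

lemma pres_ideal_coset_eq:
  assumes "\<And>l r. (l, r) \<in> rels \<Longrightarrow> l \<in> carrier (free_alg S) \<and> r \<in> carrier (free_alg S)"
    and "(l, r) \<in> rels"
  shows "pres_ideal S rels +>\<^bsub>(free_alg S :: ('c::comm_ring_1, _) module)\<^esub> l =
    pres_ideal S rels +>\<^bsub>(free_alg S :: ('c, _) module)\<^esub> r"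
proof (rule coset_eqI[OF ring_free_alg pres_ideal_ideal])
  let ?F = "free_alg S :: ('c::comm_ring_1, _) module"
  show lr: "l \<in> carrier ?F" "r \<in> carrier ?F" using assms by auto
  have sub: "(\<lambda>(l, r). l - r) ` rels \<subseteq> carrier ?F"
  proof clarsimp
    fix l r assume "(l, r) \<in> rels"
    then show "l - r \<in> carrier (free_alg S)"
      using assms(1) free_alg_add[of l S "-r"] free_alg_uminus[of r S] by auto
  qed
  have "l - r \<in> pres_ideal S rels"
    unfolding pres_ideal_def
    using ring.genideal_self[OF ring_free_alg sub] assms(2) by (auto simp: image_iff)
  then show "l \<ominus>\<^bsub>?F\<^esub> r \<in> pres_ideal S rels" using lr by (simp add: free_alg_minus)
qed (use assms in auto)

text \<open>
  Universal property of a presentation: an evaluation that respects the relations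
  factors through the quotient by the ideal they generate.
\<close>

lemma pres_lift:
  assumes C: "ring C"
    and rels: "\<And>l r. (l, r) \<in> rels \<Longrightarrow> l \<in> carrier (free_alg S) \<and> r \<in> carrier (free_alg S)"
    and h: "h \<in> ring_hom (free_alg S :: ('c::comm_ring_1, _) module) C"
    and eq: "\<And>l r. (l, r) \<in> rels \<Longrightarrow> h l = h r"
  shows "\<exists>k \<in> ring_hom ((free_alg S :: ('c, _) module) Quot pres_ideal S rels) C.
    \<forall>p \<in> carrier (free_alg S). k (pres_ideal S rels +>\<^bsub>(free_alg S :: ('c, _) module)\<^esub> p) = h p"
proof (rule quot_lift[OF ring_free_alg C pres_ideal_ideal[OF rels] h])
  let ?F = "free_alg S :: ('c::comm_ring_1, _) module"
  interpret C: ring C by fact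
  fix i assume i: "i \<in> pres_ideal S rels"
  have lr: "h (l - r) = \<zero>\<^bsub>C\<^esub>" "l - r \<in> carrier ?F" if lr: "(l, r) \<in> rels" for l r
  proof -
    have c: "l \<in> carrier ?F" "r \<in> carrier ?F" using rels[OF lr] by auto
    then have "h (l \<ominus>\<^bsub>?F\<^esub> r) = h l \<ominus>\<^bsub>C\<^esub> h r" by (intro ring_hom_diff ring_free_alg C h)
    then show "h (l - r) = \<zero>\<^bsub>C\<^esub>"
      using c eq[OF lr] ring_hom_closed[OF h c(2)] by (simp add: free_alg_minus C.minus_zero_iff)
    show "l - r \<in> carrier ?F"
      using c free_alg_add[of l S "-r"] free_alg_uminus[of r S] by auto
  qed
  show "h i = \<zero>\<^bsub>C\<^esub>"
    by (rule genideal_vanishing[OF ring_free_alg C h _ _ i[unfolded pres_ideal_def]])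
      (use lr in auto)
qed auto

context
  fixes rels :: "(('g letter word \<Rightarrow>\<^sub>0 'c::comm_ring_1) \<times> ('g letter word \<Rightarrow>\<^sub>0 'c)) set"
begin

private abbreviation (input) A where "A \<equiv> inv_pres rels"
private abbreviation (input) F where "F \<equiv> free_alg UNIV :: ('c, 'g letter word \<Rightarrow>\<^sub>0 'c) module"
private abbreviation (input) I where "I \<equiv> pres_ideal UNIV (inv_rels \<union> rels)"

definition pres_cls :: "('g letter word \<Rightarrow>\<^sub>0 'c) \<Rightarrow> ('g letter word \<Rightarrow>\<^sub>0 'c) set" where
  "pres_cls p = I +>\<^bsub>F\<^esub> p"

lemma inv_pres_ideal: "ideal I F"
  by (rule pres_ideal_ideal) auto

lemma ring_inv_pres: "ring A"
  unfolding inv_pres_def by (rule ring_alg_quot[OF inv_pres_ideal])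

lemma pres_cls_hom: "pres_cls \<in> ring_hom F A"
  using ideal.rcos_ring_hom[OF inv_pres_ideal]
  by (simp add: inv_pres_def pres_cls_def[abs_def])

lemma inv_pres_carrier: "carrier A = range pres_cls"
  by (simp add: inv_pres_def carrier_alg_quot pres_cls_def[abs_def])

lemma pres_cls_closed [simp]: "pres_cls p \<in> carrier A"
  by (simp add: inv_pres_carrier)

lemma pres_cls_mult: "pres_cls (p * q) = pres_cls p \<otimes>\<^bsub>A\<^esub> pres_cls q"
  using ring_hom_mult[OF pres_cls_hom, of p q] by simp

lemma pres_cls_add: "pres_cls (p + q) = pres_cls p \<oplus>\<^bsub>A\<^esub> pres_cls q"
  using ring_hom_add[OF pres_cls_hom, of p q] by simp

lemma pres_cls_one: "pres_cls 1 = \<one>\<^bsub>A\<^esub>"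
  using ring_hom_one[OF pres_cls_hom] by simp

lemma pres_cls_zero: "pres_cls 0 = \<zero>\<^bsub>A\<^esub>"
  using ring_hom_zero[OF pres_cls_hom ring_free_alg ring_inv_pres] by simp

lemma pres_cls_diff: "pres_cls (p - q) = pres_cls p \<ominus>\<^bsub>A\<^esub> pres_cls q"
  using ring_hom_diff[OF ring_free_alg ring_inv_pres pres_cls_hom, of p q]
  by (simp add: free_alg_minus)

lemma pres_cls_rel: "(l, r) \<in> inv_rels \<union> rels \<Longrightarrow> pres_cls l = pres_cls r"
  unfolding pres_cls_def by (rule pres_ideal_coset_eq) auto

text \<open>
  Scalars act on a coset through all its representatives; the cosets obtained in this way
  coincide because the ideal is closed under multiplication by scalars.
\<close>

lemma pres_cls_smult: "c \<odot>\<^bsub>A\<^esub> pres_cls p = pres_cls (scalar c * p)"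
proof -
  interpret I: ideal I F by (rule inv_pres_ideal)
  have "I +>\<^bsub>F\<^esub> (scalar c * u) = I +>\<^bsub>F\<^esub> (scalar c * p)" if u: "u \<in> I +>\<^bsub>F\<^esub> p" for u
  proof -
    obtain i where i: "i \<in> I" "u = i + p"
      using u unfolding a_r_coset_def r_coset_def by auto
    then have "scalar c * i \<in> I" using I.I_l_closed[of i "scalar c"] by simp
    then show ?thesis
      using i by (intro coset_eqI[OF ring_free_alg inv_pres_ideal])
        (simp_all add: free_alg_minus distrib_left)
  qed
  moreover have "I +>\<^bsub>F\<^esub> p \<noteq> {}" using I.a_rcos_self[of p] by auto
  ultimately have "(\<Union>u\<in>I +>\<^bsub>F\<^esub> p. I +>\<^bsub>F\<^esub> (scalar c * u)) = I +>\<^bsub>F\<^esub> (scalar c * p)"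
    by (intro SUP_eq_const) blast
  then show ?thesis by (simp add: inv_pres_def alg_quot_def pres_cls_def)
qed

lemma inv_pres_smult_one: "c \<odot>\<^bsub>A\<^esub> \<one>\<^bsub>A\<^esub> = pres_cls (scalar c)"
  by (simp flip: pres_cls_one add: pres_cls_smult)

lemma inv_pres_gen_eq: "inv_pres_gen rels g = pres_cls (var (Pos g))"
  by (simp add: inv_pres_gen_def pres_cls_def)

lemma inv_pres_gen_Units: "inv_pres_gen rels g \<in> Units A"
  and inv_pres_gen_inv: "inv\<^bsub>A\<^esub> inv_pres_gen rels g = pres_cls (var (Neg g))"
proof -
  interpret ring A by (rule ring_inv_pres)
  have "pres_cls (var (Pos g) * var (Neg g)) = pres_cls 1"
    by (rule pres_cls_rel) (auto simp: inv_rels_def)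
  moreover have "pres_cls (var (Neg g) * var (Pos g)) = pres_cls 1"
    by (rule pres_cls_rel) (auto simp: inv_rels_def)
  ultimately have e: "pres_cls (var (Pos g)) \<otimes>\<^bsub>A\<^esub> pres_cls (var (Neg g)) = \<one>\<^bsub>A\<^esub>"
    "pres_cls (var (Neg g)) \<otimes>\<^bsub>A\<^esub> pres_cls (var (Pos g)) = \<one>\<^bsub>A\<^esub>"
    by (simp_all add: pres_cls_mult pres_cls_one)
  show "inv_pres_gen rels g \<in> Units A"
    using e unfolding inv_pres_gen_eq Units_def by (auto intro!: bexI[of _ "pres_cls (var (Neg g))"])
  show "inv\<^bsub>A\<^esub> inv_pres_gen rels g = pres_cls (var (Neg g))"
    unfolding inv_pres_gen_eq by (rule inv_char) (simp_all add: e)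
qed

text \<open>
  The classes of the letters \<open>Neg g\<close> are the inverses of the generators, so invertible
  generators, their inverses and the scalars generate.
\<close>

lemma inv_pres_induct:
  assumes "a \<in> carrier A"
    and "\<And>c. P (c \<odot>\<^bsub>A\<^esub> \<one>\<^bsub>A\<^esub>)" "\<And>g. P (inv_pres_gen rels g)" "\<And>g. P (inv\<^bsub>A\<^esub> inv_pres_gen rels g)"
    and "\<And>a b. a \<in> carrier A \<Longrightarrow> b \<in> carrier A \<Longrightarrow> P a \<Longrightarrow> P b \<Longrightarrow> P (a \<oplus>\<^bsub>A\<^esub> b)"
    and "\<And>a b. a \<in> carrier A \<Longrightarrow> b \<in> carrier A \<Longrightarrow> P a \<Longrightarrow> P b \<Longrightarrow> P (a \<otimes>\<^bsub>A\<^esub> b)"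
  shows "P a"
proof -
  have "P (pres_cls p)" for p
  proof (rule free_alg_induct[of p UNIV "\<lambda>p. P (pres_cls p)"])
    fix g :: "'g letter"
    show "P (pres_cls (var g))"
      by (cases g) (use assms(3,4) in \<open>auto simp: inv_pres_gen_eq inv_pres_gen_inv[unfolded inv_pres_gen_eq]\<close>)
  qed (use assms in \<open>auto simp: pres_cls_add pres_cls_mult inv_pres_smult_one\<close>)
  then show ?thesis using assms(1) by (auto simp: inv_pres_carrier)
qed

lemma inv_pres_hom_unique:
  assumes B: "ring B" and f: "f \<in> ring_hom A B" and g: "g \<in> ring_hom A B"
    and "\<And>c. f (c \<odot>\<^bsub>A\<^esub> \<one>\<^bsub>A\<^esub>) = g (c \<odot>\<^bsub>A\<^esub> \<one>\<^bsub>A\<^esub>)"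
    and "\<And>x. f (inv_pres_gen rels x) = g (inv_pres_gen rels x)"
    and "a \<in> carrier A"
  shows "f a = g a"
  using assms(6)
proof (rule inv_pres_induct)
  show "f (inv\<^bsub>A\<^esub> inv_pres_gen rels x) = g (inv\<^bsub>A\<^esub> inv_pres_gen rels x)" for x
    using ring_hom_inv(2)[OF ring_inv_pres B f inv_pres_gen_Units]
      ring_hom_inv(2)[OF ring_inv_pres B g inv_pres_gen_Units] assms(5) by simp
qed (use assms(4,5) in \<open>simp_all add: ring_hom_add[OF f] ring_hom_add[OF g]
      ring_hom_mult[OF f] ring_hom_mult[OF g]\<close>)

text \<open>
  Universal property of an algebra on invertible generators. The premise \<open>rel\<close> speaks
  about an arbitrary evaluation \<open>f\<close> of the free algebra, since its values on scalars and letters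
  allow a concrete relation to be checked by rewriting in \<open>B\<close>.
\<close>

lemma inv_pres_lift:
  assumes B: "ring B" and eta: "scalar_map B (\<eta> :: 'c \<Rightarrow> 'b)"
    and u: "\<And>g. b g \<in> Units B"
    and comm: "\<And>c g. \<eta> c \<otimes>\<^bsub>B\<^esub> b g = b g \<otimes>\<^bsub>B\<^esub> \<eta> c"
    and rel: "\<And>f l r. (l, r) \<in> rels \<Longrightarrow> f \<in> ring_hom F B \<Longrightarrow> (\<And>c. f (scalar c) = \<eta> c) \<Longrightarrow>
      (\<And>g. f (var (Pos g)) = b g) \<Longrightarrow> (\<And>g. f (var (Neg g)) = inv\<^bsub>B\<^esub> b g) \<Longrightarrow> f l = f r"
  shows "\<exists>h \<in> ring_hom A B. (\<forall>c. h (c \<odot>\<^bsub>A\<^esub> \<one>\<^bsub>A\<^esub>) = \<eta> c) \<and> (\<forall>g. h (inv_pres_gen rels g) = b g)"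
proof -
  interpret B: ring B by fact
  have eta_c [simp]: "\<eta> c \<in> carrier B" for c using eta by (simp add: scalar_map_def)
  have b_c [simp]: "b g \<in> carrier B" "inv\<^bsub>B\<^esub> b g \<in> carrier B" for g using u[of g] by auto
  have inv_l: "inv\<^bsub>B\<^esub> b g \<otimes>\<^bsub>B\<^esub> (b g \<otimes>\<^bsub>B\<^esub> y) = y" if "y \<in> carrier B" for g y
    using that u[of g] by (simp flip: B.m_assoc)
  define b' where "b' x = (case x of Pos g \<Rightarrow> b g | Neg g \<Rightarrow> inv\<^bsub>B\<^esub> b g)" for x
  have comm_inv: "\<eta> c \<otimes>\<^bsub>B\<^esub> inv\<^bsub>B\<^esub> b g = inv\<^bsub>B\<^esub> b g \<otimes>\<^bsub>B\<^esub> \<eta> c" for c g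
  proof -
    have "\<eta> c \<otimes>\<^bsub>B\<^esub> inv\<^bsub>B\<^esub> b g = inv\<^bsub>B\<^esub> b g \<otimes>\<^bsub>B\<^esub> (b g \<otimes>\<^bsub>B\<^esub> \<eta> c) \<otimes>\<^bsub>B\<^esub> inv\<^bsub>B\<^esub> b g"
      by (simp add: inv_l)
    also have "\<dots> = inv\<^bsub>B\<^esub> b g \<otimes>\<^bsub>B\<^esub> (\<eta> c \<otimes>\<^bsub>B\<^esub> b g) \<otimes>\<^bsub>B\<^esub> inv\<^bsub>B\<^esub> b g"
      by (simp add: comm)
    also have "\<dots> = inv\<^bsub>B\<^esub> b g \<otimes>\<^bsub>B\<^esub> \<eta> c"
      using u[of g] by (simp add: B.m_assoc)
    finally show ?thesis .
  qed
  obtain f where f: "f \<in> ring_hom F B" "\<And>c. f (scalar c) = \<eta> c" "\<And>g. f (var g) = b' g"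
  proof -
    have "b' g \<in> carrier B" "\<eta> c \<otimes>\<^bsub>B\<^esub> b' g = b' g \<otimes>\<^bsub>B\<^esub> \<eta> c" for g c
      by (simp_all add: b'_def comm comm_inv split: letter.split)
    then show thesis using scalars.free_alg_lift[OF scalars.intro[OF B scalars_axioms.intro[OF eta]], of UNIV b'] that by auto
  qed
  have pn: "f (var (Pos g)) = b g" "f (var (Neg g)) = inv\<^bsub>B\<^esub> b g" for g
    by (simp_all add: f b'_def)
  have fm: "f (p * q) = f p \<otimes>\<^bsub>B\<^esub> f q" for p q using ring_hom_mult[OF f(1), of p q] by simp
  have f1: "f 1 = \<one>\<^bsub>B\<^esub>" using ring_hom_one[OF f(1)] by simp
  have "\<exists>k \<in> ring_hom (F Quot I) B. \<forall>p \<in> carrier F. k (I +>\<^bsub>F\<^esub> p) = f p"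
  proof (rule pres_lift[OF B _ f(1)])
    fix l r :: "'g letter word \<Rightarrow>\<^sub>0 'c" assume "(l, r) \<in> inv_rels \<union> rels"
    then show "f l = f r"
      using rel[of l r f] f(1,2) pn u by (auto simp: inv_rels_def fm f1)
  qed auto
  then obtain k where k: "k \<in> ring_hom A B" "\<And>p. k (pres_cls p) = f p"
    by (auto simp: inv_pres_def pres_cls_def)
  show ?thesis
    by (rule bexI[OF _ k(1)]) (simp add: inv_pres_smult_one inv_pres_gen_eq k f b'_def)
qed

end

section \<open>Amalgamated products\<close>

lemma (in ring) scalar_map_int: "scalar_map R (\<lambda>n::int. [n] \<cdot>\<^bsub>R\<^esub> \<one>)"
proof -
  have "[(m * n)] \<cdot>\<^bsub>R\<^esub> \<one> = ([m] \<cdot>\<^bsub>R\<^esub> \<one>) \<otimes> ([n] \<cdot>\<^bsub>R\<^esub> \<one>)" for m n :: int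
    by (simp add: add_pow_ldistr_int add.int_pow_pow mult.commute)
  moreover have "[(m + n)] \<cdot>\<^bsub>R\<^esub> \<one> = ([m] \<cdot>\<^bsub>R\<^esub> \<one>) \<oplus> ([n] \<cdot>\<^bsub>R\<^esub> \<one>)" for m n :: int
    by (simp add: add.int_pow_mult)
  ultimately show ?thesis by (simp add: scalar_map_def)
qed

text \<open>
  The relations \<^const>\<open>hom_rels\<close> say precisely that the symbol map \<open>e\<close>, followed by
  passage to the quotient, is a ring homomorphism.
\<close>

lemma hom_rels_coset_hom:
  fixes S :: "'g set" and rels :: "(('g word \<Rightarrow>\<^sub>0 'c::comm_ring_1) \<times> ('g word \<Rightarrow>\<^sub>0 'c)) set"
  assumes rels: "\<And>l r. (l, r) \<in> rels \<Longrightarrow> l \<in> carrier (free_alg S) \<and> r \<in> carrier (free_alg S)"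
    and sub: "hom_rels A e \<subseteq> rels"
    and e: "\<And>a. a \<in> carrier A \<Longrightarrow> e a \<in> carrier (free_alg S)"
  shows "(\<lambda>a. pres_ideal S rels +>\<^bsub>(free_alg S :: ('c, _) module)\<^esub> e a) \<in>
    ring_hom A ((free_alg S :: ('c, _) module) Quot pres_ideal S rels)"
proof -
  let ?F = "free_alg S :: ('c, 'g word \<Rightarrow>\<^sub>0 'c) module" and ?J = "pres_ideal S rels"
  have J: "ideal ?J ?F" by (rule pres_ideal_ideal[OF rels])
  note hom = ideal.rcos_ring_hom[OF J]
  have rel: "?J +>\<^bsub>?F\<^esub> l = ?J +>\<^bsub>?F\<^esub> r" if "(l, r) \<in> hom_rels A e" for l r
    using pres_ideal_coset_eq[OF rels] that sub by blast
  show ?thesis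
  proof (rule ring_hom_memI)
    fix a assume a: "a \<in> carrier A"
    show "?J +>\<^bsub>?F\<^esub> e a \<in> carrier (?F Quot ?J)" by (rule ring_hom_closed[OF hom e[OF a]])
    fix b assume b: "b \<in> carrier A"
    have "(e (a \<otimes>\<^bsub>A\<^esub> b), e a * e b) \<in> hom_rels A e" "(e (a \<oplus>\<^bsub>A\<^esub> b), e a + e b) \<in> hom_rels A e"
      unfolding hom_rels_def using a b by blast+
    from this[THEN rel]
    show "?J +>\<^bsub>?F\<^esub> e (a \<otimes>\<^bsub>A\<^esub> b) = (?J +>\<^bsub>?F\<^esub> e a) \<otimes>\<^bsub>?F Quot ?J\<^esub> (?J +>\<^bsub>?F\<^esub> e b)"
      "?J +>\<^bsub>?F\<^esub> e (a \<oplus>\<^bsub>A\<^esub> b) = (?J +>\<^bsub>?F\<^esub> e a) \<oplus>\<^bsub>?F Quot ?J\<^esub> (?J +>\<^bsub>?F\<^esub> e b)"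
      using ring_hom_mult[OF hom e[OF a] e[OF b]] ring_hom_add[OF hom e[OF a] e[OF b]] by simp_all
  next
    have "(e \<one>\<^bsub>A\<^esub>, 1) \<in> hom_rels A e" unfolding hom_rels_def by blast
    from rel[OF this] show "?J +>\<^bsub>?F\<^esub> e \<one>\<^bsub>A\<^esub> = \<one>\<^bsub>?F Quot ?J\<^esub>"
      using ring_hom_one[OF hom] by simp
  qed
qed

locale amalgam = R: ring R + A: ring A + B: ring B
  for R (structure) and A :: "('a, 'm) ring_scheme" and B :: "('b, 'l) ring_scheme" +
  fixes f g
  assumes f: "f \<in> ring_hom R A" and g: "g \<in> ring_hom R B"
begin

abbreviation "P \<equiv> amalg R A B f g"
abbreviation "inl \<equiv> amalg_inl R A B f g"
abbreviation "inr \<equiv> amalg_inr R A B f g"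
abbreviation "S \<equiv> carrier A <+> carrier B"
abbreviation "F \<equiv> free_alg S :: (int, ('a + 'b) word \<Rightarrow>\<^sub>0 int) module"
abbreviation "J \<equiv> amalg_ideal R A B f g"
abbreviation rels :: "((('a + 'b) word \<Rightarrow>\<^sub>0 int) \<times> (('a + 'b) word \<Rightarrow>\<^sub>0 int)) set" where
  "rels \<equiv> hom_rels A (\<lambda>a. var (Inl a)) \<union> hom_rels B (\<lambda>b. var (Inr b)) \<union>
        {(var (Inl (f r)), var (Inr (g r))) | r. r \<in> carrier R}"

lemma var_closed: "a \<in> carrier A \<Longrightarrow> var (Inl a) \<in> carrier F" "b \<in> carrier B \<Longrightarrow> var (Inr b) \<in> carrier F"
  by (auto intro: free_alg_var)

lemma rels_closed:
  assumes "(l, r) \<in> rels" shows "l \<in> carrier F \<and> r \<in> carrier F"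
proof -
  have "1 \<in> carrier F" using ring.ring_simprules(6)[OF ring_free_alg, of S] by simp
  with assms show ?thesis
    using ring_hom_closed[OF f] ring_hom_closed[OF g]
    by (auto simp: hom_rels_def intro!: var_closed free_alg_add free_alg_mult)
qed

lemma ideal_J: "ideal J F"
  unfolding amalg_ideal_def by (rule pres_ideal_ideal) (rule rels_closed)

lemma ring_P: "ring P"
  unfolding amalg_def by (rule ideal.quotient_is_ring[OF ideal_J])

lemma coset_hom: "(+>\<^bsub>F\<^esub>) J \<in> ring_hom F P"
  unfolding amalg_def by (rule ideal.rcos_ring_hom[OF ideal_J])

lemma coset_rel: "(l, r) \<in> rels \<Longrightarrow> J +>\<^bsub>F\<^esub> l = J +>\<^bsub>F\<^esub> r"
  unfolding amalg_ideal_def by (rule pres_ideal_coset_eq) (rule rels_closed)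

lemma inl_hom: "inl \<in> ring_hom A P"
  unfolding amalg_inl_def[abs_def] amalg_def amalg_ideal_def
  by (rule hom_rels_coset_hom[where e = "\<lambda>a. var (Inl a)"]) (use rels_closed var_closed in blast)+

lemma inr_hom: "inr \<in> ring_hom B P"
  unfolding amalg_inr_def[abs_def] amalg_def amalg_ideal_def
  by (rule hom_rels_coset_hom[where e = "\<lambda>b. var (Inr b)"]) (use rels_closed var_closed in blast)+

lemma inl_inr: "r \<in> carrier R \<Longrightarrow> inl (f r) = inr (g r)"
  unfolding amalg_inl_def amalg_inr_def by (rule coset_rel) blast

text \<open>
  The integral scalars of the free ring are images of elements of \<open>A\<close>: modulo the relations
  \<open>1\<close> is the symbol of \<open>\<one>\<^bsub>A\<^esub>\<close>, and \<open>-1\<close> that of \<open>\<zero>\<^bsub>A\<^esub> \<ominus>\<^bsub>A\<^esub> \<one>\<^bsub>A\<^esub>\<close>.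
\<close>

lemma amalg_induct:
  assumes "p \<in> carrier P"
    and inl: "\<And>a. a \<in> carrier A \<Longrightarrow> X (inl a)" and inr: "\<And>b. b \<in> carrier B \<Longrightarrow> X (inr b)"
    and add: "\<And>a b. a \<in> carrier P \<Longrightarrow> b \<in> carrier P \<Longrightarrow> X a \<Longrightarrow> X b \<Longrightarrow> X (a \<oplus>\<^bsub>P\<^esub> b)"
    and mult: "\<And>a b. a \<in> carrier P \<Longrightarrow> b \<in> carrier P \<Longrightarrow> X a \<Longrightarrow> X b \<Longrightarrow> X (a \<otimes>\<^bsub>P\<^esub> b)"
  shows "X p"
proof -
  interpret P: ring P by (rule ring_P)
  note hom = ring_hom_add[OF coset_hom] ring_hom_mult[OF coset_hom]
  have cl: "J +>\<^bsub>F\<^esub> q \<in> carrier P" if "q \<in> carrier F" for q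
    using ring_hom_closed[OF coset_hom that] .
  have one: "J +>\<^bsub>F\<^esub> scalar 1 = inl \<one>\<^bsub>A\<^esub>"
    using ring_hom_one[OF coset_hom] ring_hom_one[OF inl_hom] by simp
  have zero: "J +>\<^bsub>F\<^esub> scalar 0 = inl \<zero>\<^bsub>A\<^esub>"
    using ring_hom_zero[OF coset_hom ring_free_alg ring_P] ring_hom_zero[OF inl_hom A.ring_axioms ring_P]
    by (simp add: scalar_def)
  have neg: "J +>\<^bsub>F\<^esub> scalar (- 1) = inl (\<zero>\<^bsub>A\<^esub> \<ominus>\<^bsub>A\<^esub> \<one>\<^bsub>A\<^esub>)"
  proof -
    have "J +>\<^bsub>F\<^esub> (scalar 0 \<ominus>\<^bsub>F\<^esub> scalar 1) = (J +>\<^bsub>F\<^esub> scalar 0) \<ominus>\<^bsub>P\<^esub> (J +>\<^bsub>F\<^esub> scalar 1)"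
      by (rule ring_hom_diff[OF ring_free_alg ring_P coset_hom]) (rule free_alg_scalar)+
    moreover have "scalar 0 \<ominus>\<^bsub>F\<^esub> scalar 1 = scalar (- 1)"
      by (subst free_alg_minus[OF free_alg_scalar free_alg_scalar])
        (simp add: scalar_def single_uminus flip: single_one)
    ultimately show ?thesis
      using one zero ring_hom_diff[OF A.ring_axioms ring_P inl_hom, of "\<zero>\<^bsub>A\<^esub>" "\<one>\<^bsub>A\<^esub>"] by simp
  qed
  have sc: "X (J +>\<^bsub>F\<^esub> scalar n)" for n
  proof (induction n rule: int_induct[of _ 0])
    case base
    then show ?case using inl by (simp add: zero)
  next
    case (step1 i)
    have "J +>\<^bsub>F\<^esub> scalar (i + 1) = (J +>\<^bsub>F\<^esub> scalar i) \<oplus>\<^bsub>P\<^esub> (J +>\<^bsub>F\<^esub> scalar 1)"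
      using hom(1)[of "scalar i" "scalar 1"] by (simp add: scalar_add del: scalar_one)
    moreover have "X (J +>\<^bsub>F\<^esub> scalar 1)" unfolding one by (rule inl) simp
    ultimately show ?case using add[OF cl cl step1(2), of "scalar 1"] by (simp del: scalar_one)
  next
    case (step2 i)
    have "J +>\<^bsub>F\<^esub> scalar (i + - 1) = (J +>\<^bsub>F\<^esub> scalar i) \<oplus>\<^bsub>P\<^esub> (J +>\<^bsub>F\<^esub> scalar (- 1))"
      using hom(1)[of "scalar i" "scalar (-1)"] by (simp only: scalar_add free_alg_simps free_alg_scalar)
    moreover have "X (J +>\<^bsub>F\<^esub> scalar (- 1))" unfolding neg by (rule inl) simp
    ultimately show ?case using add[OF cl cl step2(2), of "scalar (- 1)"] by simp
  qed
  have "X (J +>\<^bsub>F\<^esub> q)" if "q \<in> carrier F" for q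
    using that
  proof (induction q rule: free_alg_induct)
    case (var x)
    then show ?case using inl inr by (auto simp: amalg_inl_def amalg_inr_def)
  next
    case (add a b)
    then show ?case using hom(1)[of a b] assms(4) cl by simp
  next
    case (mult a b)
    then show ?case using hom(2)[of a b] assms(5) cl by simp
  qed (rule sc)
  then show ?thesis using assms(1) by (auto simp: amalg_def carrier_quot)
qed

text \<open>
  The pushout property. The integers act on \<open>C\<close> by multiples of the unit, which are
  central, so the free ring on the symbols can be evaluated in \<open>C\<close>.
\<close>

lemma amalg_lift:
  assumes C: "ring C" and hA: "hA \<in> ring_hom A C" and hB: "hB \<in> ring_hom B C"
    and eq: "\<And>r. r \<in> carrier R \<Longrightarrow> hA (f r) = hB (g r)"
  shows "\<exists>h \<in> ring_hom P C. (\<forall>a \<in> carrier A. h (inl a) = hA a) \<and> (\<forall>b \<in> carrier B. h (inr b) = hB b)"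
proof -
  interpret C: ring C by fact
  define v where "v x = (case x of Inl a \<Rightarrow> hA a | Inr b \<Rightarrow> hB b)" for x
  have v: "v x \<in> carrier C" if "x \<in> S" for x
    using that ring_hom_closed[OF hA] ring_hom_closed[OF hB] by (auto simp: v_def)
  have "\<exists>h \<in> ring_hom F C. (\<forall>c. h (scalar c) = [c] \<cdot>\<^bsub>C\<^esub> \<one>\<^bsub>C\<^esub>) \<and> (\<forall>g\<in>S. h (var g) = v g)"
    by (rule scalars.free_alg_lift[OF scalars.intro[OF C scalars_axioms.intro[OF C.scalar_map_int]] v])
      (use v in \<open>simp_all add: C.add_pow_ldistr_int C.add_pow_rdistr_int\<close>)
  then obtain h where h: "h \<in> ring_hom F C" "\<And>x. x \<in> S \<Longrightarrow> h (var x) = v x" by blast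
  have hv: "a \<in> carrier A \<Longrightarrow> h (var (Inl a)) = hA a" "b \<in> carrier B \<Longrightarrow> h (var (Inr b)) = hB b" for a b
    by (simp_all add: h(2) InlI InrI v_def)
  have hm: "h (p * q) = h p \<otimes>\<^bsub>C\<^esub> h q" "h (p + q) = h p \<oplus>\<^bsub>C\<^esub> h q"
    if "p \<in> carrier F" "q \<in> carrier F" for p q
    using ring_hom_mult[OF h(1) that] ring_hom_add[OF h(1) that] by simp_all
  have h1: "h 1 = \<one>\<^bsub>C\<^esub>" using ring_hom_one[OF h(1)] by simp
  have "\<exists>k \<in> ring_hom (F Quot pres_ideal S rels) C.
      \<forall>p \<in> carrier F. k (pres_ideal S rels +>\<^bsub>F\<^esub> p) = h p"
  proof (rule pres_lift[OF C rels_closed h(1)])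
    fix l r assume lr: "(l, r) \<in> rels"
    then consider (A) "(l, r) \<in> hom_rels A (\<lambda>a. var (Inl a))" | (B) "(l, r) \<in> hom_rels B (\<lambda>b. var (Inr b))"
      | (R) x where "x \<in> carrier R" "l = var (Inl (f x))" "r = var (Inr (g x))" by blast
    then show "h l = h r"
    proof cases
      case A
      then show ?thesis
        by (auto simp: hom_rels_def hm hv h1 var_closed ring_hom_add[OF hA] ring_hom_mult[OF hA]
            ring_hom_one[OF hA])
    next
      case B
      then show ?thesis
        by (auto simp: hom_rels_def hm hv h1 var_closed ring_hom_add[OF hB] ring_hom_mult[OF hB]
            ring_hom_one[OF hB])
    next
      case R
      then show ?thesis using eq ring_hom_closed[OF f] ring_hom_closed[OF g] by (simp add: hv)
    qed
  qed
  then obtain k where k: "k \<in> ring_hom P C" "\<And>p. p \<in> carrier F \<Longrightarrow> k (J +>\<^bsub>F\<^esub> p) = h p"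
    by (auto simp: amalg_def amalg_ideal_def)
  show ?thesis
    by (rule bexI[OF _ k(1)]) (simp add: amalg_inl_def amalg_inr_def k var_closed hv)
qed

end

section \<open>Ore extensions\<close>

definition ore_monom :: "('a, 'm) ring_scheme \<Rightarrow> 'a \<Rightarrow> nat \<Rightarrow> nat \<Rightarrow> 'a" where
  "ore_monom R a i = (\<lambda>n. if n = i then a else \<zero>\<^bsub>R\<^esub>)"

lemma up_iff: "p \<in> up R \<longleftrightarrow> (\<forall>n. p n \<in> carrier R) \<and> (\<exists>m. \<forall>n\<ge>m. p n = \<zero>\<^bsub>R\<^esub>)"
proof
  assume p: "p \<in> up R"
  then obtain m where m: "bound \<zero>\<^bsub>R\<^esub> m p" by (auto simp: up_def)
  have "\<forall>n\<ge>Suc m. p n = \<zero>\<^bsub>R\<^esub>" using bound.bound[OF m] by auto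
  then show "(\<forall>n. p n \<in> carrier R) \<and> (\<exists>m. \<forall>n\<ge>m. p n = \<zero>\<^bsub>R\<^esub>)" using p by (auto simp: up_def)
next
  assume a: "(\<forall>n. p n \<in> carrier R) \<and> (\<exists>m. \<forall>n\<ge>m. p n = \<zero>\<^bsub>R\<^esub>)"
  then obtain m where "\<forall>n\<ge>m. p n = \<zero>\<^bsub>R\<^esub>" by blast
  then have "bound \<zero>\<^bsub>R\<^esub> m p" by unfold_locales auto
  then show "p \<in> up R" using a by (auto simp: up_def)
qed

text \<open>
  The carrier of an Ore extension is that of the commutative polynomial ring. It is
  spanned by monomials, and all identities below are reduced to monomials by additivity.
\<close>

context ring
begin

lemma up_closed: "p \<in> up R \<Longrightarrow> p n \<in> carrier R"
  by (simp add: up_iff)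

lemma up_finite: "p \<in> up R \<Longrightarrow> finite {i. p i \<noteq> \<zero>}"
proof -
  assume "p \<in> up R"
  then obtain m where "\<forall>n\<ge>m. p n = \<zero>" by (auto simp: up_iff)
  then have "{i. p i \<noteq> \<zero>} \<subseteq> {..<m}" by (auto simp: not_le[symmetric])
  then show ?thesis using finite_subset by blast
qed

lemma up_add: "p \<in> up R \<Longrightarrow> q \<in> up R \<Longrightarrow> (\<lambda>n. p n \<oplus> q n) \<in> up R"
  by (rule up_add_closed)

lemma up_monom: "a \<in> carrier R \<Longrightarrow> ore_monom R a i \<in> up R"
  unfolding up_iff ore_monom_def by (intro conjI exI[of _ "Suc i"]) auto

lemma up_smult: "a \<in> carrier R \<Longrightarrow> p \<in> up R \<Longrightarrow> (\<lambda>n. a \<otimes> p n) \<in> up R"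
  by (rule up_smult_closed)

lemma up_induct [consumes 1, case_names monom add]:
  assumes "p \<in> up R"
    and monom: "\<And>a i. a \<in> carrier R \<Longrightarrow> X (ore_monom R a i)"
    and add: "\<And>p q. p \<in> up R \<Longrightarrow> q \<in> up R \<Longrightarrow> X p \<Longrightarrow> X q \<Longrightarrow> X (\<lambda>n. p n \<oplus> q n)"
  shows "X p"
proof -
  have *: "X p" if "\<And>n. p n \<in> carrier R" "\<And>n. n \<ge> m \<Longrightarrow> p n = \<zero>" for m p
    using that
  proof (induction m arbitrary: p)
    case 0
    then have "p = ore_monom R \<zero> 0" by (auto simp: ore_monom_def)
    then show ?case using monom by simp
  next
    case (Suc m)
    let ?q = "\<lambda>n. if n < m then p n else \<zero>"
    have q: "?q \<in> up R" using Suc.prems by (auto simp: up_iff intro!: exI[of _ m])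
    have "X ?q" by (rule Suc.IH) (use Suc.prems in auto)
    moreover have "p = (\<lambda>n. ?q n \<oplus> ore_monom R (p m) m n)"
      using Suc.prems by (auto simp: ore_monom_def fun_eq_iff)
    ultimately show ?case
      using add[OF q up_monom[OF Suc.prems(1)[of m]] _ monom[OF Suc.prems(1)[of m]], of m] by simp
  qed
  from assms(1) obtain m where "\<forall>n\<ge>m. p n = \<zero>" by (auto simp: up_iff)
  then show ?thesis using *[of p m] up_closed[OF assms(1)] by blast
qed

end

text \<open>
  For a family \<open>u\<close> of additive maps the sum of the \<open>u i (p i)\<close> over the support of \<open>p\<close> is
  additive in \<open>p\<close>. Both the coefficients of a product in the Ore extension, as functions of the
  left factor, and the evaluation of Ore polynomials have this form.
\<close>

locale coeff_sum = R: ring R + B: ring B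
  for R (structure) and B :: "('b, 'l) ring_scheme" +
  fixes u :: "nat \<Rightarrow> 'a \<Rightarrow> 'b"
  assumes u_closed [simp]: "a \<in> carrier R \<Longrightarrow> u i a \<in> carrier B"
    and u_add: "a \<in> carrier R \<Longrightarrow> a' \<in> carrier R \<Longrightarrow> u i (a \<oplus> a') = u i a \<oplus>\<^bsub>B\<^esub> u i a'"
begin

lemma u_zero [simp]: "u i \<zero> = \<zero>\<^bsub>B\<^esub>"
  using u_add[of \<zero> \<zero> i] by (metis B.add.l_cancel_one R.l_zero R.zero_closed u_closed)

definition csum :: "(nat \<Rightarrow> 'a) \<Rightarrow> 'b" where
  "csum p = (\<Oplus>\<^bsub>B\<^esub>i\<in>{i. p i \<noteq> \<zero>}. u i (p i))"

lemma csum_superset: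
  assumes "p \<in> up R" "finite W" "{i. p i \<noteq> \<zero>} \<subseteq> W"
  shows "csum p = (\<Oplus>\<^bsub>B\<^esub>i\<in>W. u i (p i))"
  unfolding csum_def
  by (rule B.add.finprod_mono_neutral_cong_left)
    (use assms R.up_closed[OF assms(1)] in auto)

lemma csum_closed: "p \<in> up R \<Longrightarrow> csum p \<in> carrier B"
  unfolding csum_def by (rule B.finsum_closed) (auto simp: R.up_closed)

lemma csum_add:
  assumes p: "p \<in> up R" and q: "q \<in> up R"
  shows "csum (\<lambda>n. p n \<oplus> q n) = csum p \<oplus>\<^bsub>B\<^esub> csum q"
proof -
  let ?W = "{i. p i \<noteq> \<zero>} \<union> {i. q i \<noteq> \<zero>}"
  have W: "finite ?W" using R.up_finite p q by simp
  have "csum (\<lambda>n. p n \<oplus> q n) = (\<Oplus>\<^bsub>B\<^esub>i\<in>?W. u i (p i \<oplus> q i))"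
    by (rule csum_superset[OF R.up_add[OF p q] W]) auto
  also have "\<dots> = (\<Oplus>\<^bsub>B\<^esub>i\<in>?W. u i (p i) \<oplus>\<^bsub>B\<^esub> u i (q i))"
    using p q by (simp add: u_add R.up_closed)
  also have "\<dots> = (\<Oplus>\<^bsub>B\<^esub>i\<in>?W. u i (p i)) \<oplus>\<^bsub>B\<^esub> (\<Oplus>\<^bsub>B\<^esub>i\<in>?W. u i (q i))"
    by (rule B.add.finprod_multf) (auto simp: R.up_closed p q)
  also have "\<dots> = csum p \<oplus>\<^bsub>B\<^esub> csum q"
    by (simp add: csum_superset[OF p W] csum_superset[OF q W])
  finally show ?thesis .
qed

lemma csum_monom:
  assumes "a \<in> carrier R"
  shows "csum (ore_monom R a i) = u i a"
proof -
  have "csum (ore_monom R a i) = (\<Oplus>\<^bsub>B\<^esub>j\<in>{i}. u j (ore_monom R a i j))"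
    by (rule csum_superset[OF R.up_monom[OF assms]]) (auto simp: ore_monom_def)
  also have "\<dots> = u i a"
    by (subst B.add.finprod_insert) (auto simp: ore_monom_def assms)
  finally show ?thesis .
qed

end

lemma ore_ext_simps:
  "carrier (ore_ext R \<tau> \<delta>) = up R"
  "p \<oplus>\<^bsub>ore_ext R \<tau> \<delta>\<^esub> q = (\<lambda>n. p n \<oplus>\<^bsub>R\<^esub> q n)"
  "one (ore_ext R \<tau> \<delta>) = ore_const R \<one>\<^bsub>R\<^esub>"
  "zero (ore_ext R \<tau> \<delta>) = (\<lambda>n. \<zero>\<^bsub>R\<^esub>)"
  "c \<odot>\<^bsub>ore_ext R \<tau> \<delta>\<^esub> p = (\<lambda>n. c \<odot>\<^bsub>R\<^esub> p n)"
  by (auto simp: ore_ext_def ore_const_def)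

lemma ore_const_monom: "ore_const R a = ore_monom R a 0"
  by (auto simp: ore_const_def ore_monom_def)

lemma ore_var_monom: "ore_var R = ore_monom R \<one>\<^bsub>R\<^esub> (Suc 0)"
  by (auto simp: ore_var_def ore_monom_def)

locale ore = ring R for R :: "('k, 'a) module" (structure) +
  fixes \<tau> \<delta> :: "'a \<Rightarrow> 'a"
  assumes tau_hom: "\<tau> \<in> ring_hom R R"
    and delta_closed [simp]: "r \<in> carrier R \<Longrightarrow> \<delta> r \<in> carrier R"
    and delta_add: "r \<in> carrier R \<Longrightarrow> s \<in> carrier R \<Longrightarrow> \<delta> (r \<oplus> s) = \<delta> r \<oplus> \<delta> s"
    and delta_mult: "r \<in> carrier R \<Longrightarrow> s \<in> carrier R \<Longrightarrow> \<delta> (r \<otimes> s) = \<tau> r \<otimes> \<delta> s \<oplus> \<delta> r \<otimes> s"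
begin

lemma tau_closed [simp]: "r \<in> carrier R \<Longrightarrow> \<tau> r \<in> carrier R"
  by (rule ring_hom_closed[OF tau_hom])

lemma tau_zero [simp]: "\<tau> \<zero> = \<zero>"
  by (rule ring_hom_zero[OF tau_hom ring_axioms ring_axioms])

lemma tau_one [simp]: "\<tau> \<one> = \<one>"
  by (rule ring_hom_one[OF tau_hom])

lemma delta_zero [simp]: "\<delta> \<zero> = \<zero>"
  using delta_add[of \<zero> \<zero>] by (metis add.l_cancel_one delta_closed l_zero zero_closed)

lemma delta_one [simp]: "\<delta> \<one> = \<zero>"
  using delta_mult[of \<one> \<one>] by (metis add.l_cancel_one delta_closed l_one one_closed r_one tau_one)

abbreviation "E \<equiv> ore_ext R \<tau> \<delta>"
abbreviation "sh \<equiv> ore_shift R \<tau> \<delta>"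

lemma shift_closed:
  assumes p: "p \<in> up R" shows "sh p \<in> up R"
proof -
  obtain m where m: "\<forall>n\<ge>m. p n = \<zero>" using p by (auto simp: up_iff)
  have "sh p n \<in> carrier R" for n
    using p by (auto simp: ore_shift_def up_closed split: nat.split)
  moreover have "\<forall>n\<ge>Suc m. sh p n = \<zero>"
    using m by (auto simp: ore_shift_def split: nat.split)
  ultimately show ?thesis unfolding up_iff by blast
qed

lemma shift_add:
  assumes "p \<in> up R" "q \<in> up R"
  shows "sh (\<lambda>n. p n \<oplus> q n) = (\<lambda>n. sh p n \<oplus> sh q n)"
  using assms
  by (auto simp: ore_shift_def fun_eq_iff up_closed delta_add ring_hom_add[OF tau_hom] a_ac
      split: nat.split)

text \<open>
  The commutation rule \<open>x a = \<tau>(a) x + \<delta>(a)\<close>, applied to a polynomial; it rests on the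
  derivation property of \<open>\<delta>\<close>.
\<close>

lemma shift_smult:
  assumes "a \<in> carrier R" "p \<in> up R"
  shows "sh (\<lambda>n. a \<otimes> p n) = (\<lambda>n. \<tau> a \<otimes> sh p n \<oplus> \<delta> a \<otimes> p n)"
  using assms
  by (auto simp: ore_shift_def fun_eq_iff up_closed delta_mult ring_hom_mult[OF tau_hom] a_ac r_distr
      split: nat.split)

lemma shift_monom:
  assumes "a \<in> carrier R"
  shows "sh (ore_monom R a i) = (\<lambda>n. ore_monom R (\<tau> a) (Suc i) n \<oplus> ore_monom R (\<delta> a) i n)"
  using assms by (auto simp: ore_shift_def ore_monom_def fun_eq_iff split: nat.split)

lemma shift_pow_closed: "p \<in> up R \<Longrightarrow> (sh ^^ i) p \<in> up R"
  by (induction i) (auto simp: shift_closed)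

lemma shift_pow_add:
  "p \<in> up R \<Longrightarrow> q \<in> up R \<Longrightarrow> (sh ^^ i) (\<lambda>n. p n \<oplus> q n) = (\<lambda>n. (sh ^^ i) p n \<oplus> (sh ^^ i) q n)"
  by (induction i) (auto simp: shift_add shift_pow_closed)

lemma shift_pow_one: "(sh ^^ i) (ore_monom R \<one> j) = ore_monom R \<one> (i + j)"
proof (induction i)
  case (Suc i)
  then show ?case by (simp add: shift_monom) (auto simp: ore_monom_def)
qed simp

lemma coeff_sum_mult:
  assumes "r \<in> up R"
  shows "coeff_sum R R (\<lambda>i a. a \<otimes> (sh ^^ i) r n)"
  by unfold_locales (auto simp: up_closed[OF shift_pow_closed[OF assms]] l_distr)

lemma ore_mult_eq:
  assumes "r \<in> up R"
  shows "(p \<otimes>\<^bsub>E\<^esub> r) n = coeff_sum.csum R R (\<lambda>i a. a \<otimes> (sh ^^ i) r n) p"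
  by (simp add: ore_ext_def coeff_sum.csum_def[OF coeff_sum_mult[OF assms]])

lemma ore_mult_monom:
  assumes "a \<in> carrier R" "r \<in> up R"
  shows "ore_monom R a i \<otimes>\<^bsub>E\<^esub> r = (\<lambda>n. a \<otimes> (sh ^^ i) r n)"
  using assms by (auto simp: fun_eq_iff ore_mult_eq coeff_sum.csum_monom[OF coeff_sum_mult])

lemma ore_mult_add_left:
  assumes "p \<in> up R" "q \<in> up R" "r \<in> up R"
  shows "(\<lambda>n. p n \<oplus> q n) \<otimes>\<^bsub>E\<^esub> r = (\<lambda>n. (p \<otimes>\<^bsub>E\<^esub> r) n \<oplus> (q \<otimes>\<^bsub>E\<^esub> r) n)"
  using assms by (auto simp: fun_eq_iff ore_mult_eq coeff_sum.csum_add[OF coeff_sum_mult])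

lemma ore_mult_closed:
  assumes "p \<in> up R" "r \<in> up R"
  shows "p \<otimes>\<^bsub>E\<^esub> r \<in> up R"
  using assms(1)
proof (induction p rule: up_induct)
  case (monom a i)
  then show ?case using assms(2) by (simp add: ore_mult_monom up_smult shift_pow_closed)
next
  case (add p q)
  then show ?case using assms(2) by (simp add: ore_mult_add_left up_add)
qed

lemma ore_mult_add_right:
  assumes "p \<in> up R" "q \<in> up R" "r \<in> up R"
  shows "p \<otimes>\<^bsub>E\<^esub> (\<lambda>n. q n \<oplus> r n) = (\<lambda>n. (p \<otimes>\<^bsub>E\<^esub> q) n \<oplus> (p \<otimes>\<^bsub>E\<^esub> r) n)"
  using assms(1)
proof (induction p rule: up_induct)
  case (monom a i)
  then show ?case
    using assms(2,3) by (auto simp: fun_eq_iff ore_mult_monom up_add shift_pow_add r_distr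
        up_closed[OF shift_pow_closed])
next
  case (add p p')
  then show ?case
    using assms(2,3)
    by (auto simp: fun_eq_iff ore_mult_add_left up_add up_closed[OF ore_mult_closed] a_ac)
qed

lemma ore_mult_smult_left:
  assumes "a \<in> carrier R" "p \<in> up R" "r \<in> up R"
  shows "(\<lambda>n. a \<otimes> p n) \<otimes>\<^bsub>E\<^esub> r = (\<lambda>n. a \<otimes> (p \<otimes>\<^bsub>E\<^esub> r) n)"
  using assms(2)
proof (induction p rule: up_induct)
  case (monom b i)
  have "(\<lambda>n. a \<otimes> ore_monom R b i n) = ore_monom R (a \<otimes> b) i"
    using assms by (auto simp: ore_monom_def)
  then show ?case
    using monom assms by (simp add: ore_mult_monom m_assoc up_closed[OF shift_pow_closed])
next
  case (add p q)
  then show ?case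
    using assms ore_mult_add_left[OF up_smult[OF assms(1) add(1)] up_smult[OF assms(1) add(2)] assms(3)]
    by (simp add: ore_mult_add_left r_distr up_closed up_closed[OF ore_mult_closed])
qed

text \<open>
  The associativity law for left multiplication by the variable. On a monomial \<open>a x\<^sup>i\<close>
  both sides expand by the commutation rule for \<open>x a\<close>.
\<close>

lemma ore_mult_shift:
  assumes "p \<in> up R" "r \<in> up R"
  shows "sh p \<otimes>\<^bsub>E\<^esub> r = sh (p \<otimes>\<^bsub>E\<^esub> r)"
  using assms(1)
proof (induction p rule: up_induct)
  case (monom a i)
  then show ?case
    using assms(2)
    by (simp add: shift_monom ore_mult_add_left up_monom ore_mult_monom shift_smult shift_pow_closed)
next
  case (add p q)
  then show ?case
    using assms(2) by (simp add: shift_add ore_mult_add_left shift_closed ore_mult_closed)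
qed

lemma ore_mult_shift_pow:
  assumes "p \<in> up R" "r \<in> up R"
  shows "(sh ^^ i) p \<otimes>\<^bsub>E\<^esub> r = (sh ^^ i) (p \<otimes>\<^bsub>E\<^esub> r)"
  by (induction i) (simp_all add: assms ore_mult_shift shift_pow_closed)

text \<open>
  Left multiplication by \<open>a x\<^sup>i\<close> is an iterated shift followed by multiplication with \<open>a\<close>,
  and both commute with right multiplication by \<open>r\<close>.
\<close>

lemma ore_mult_assoc:
  assumes "p \<in> up R" "q \<in> up R" "r \<in> up R"
  shows "(p \<otimes>\<^bsub>E\<^esub> q) \<otimes>\<^bsub>E\<^esub> r = p \<otimes>\<^bsub>E\<^esub> (q \<otimes>\<^bsub>E\<^esub> r)"
  using assms(1)
proof (induction p rule: up_induct)
  case (monom a i)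
  then show ?case
    using assms(2,3)
    by (simp add: ore_mult_monom ore_mult_smult_left shift_pow_closed ore_mult_shift_pow ore_mult_closed)
next
  case (add p p')
  then show ?case using assms(2,3) by (simp add: ore_mult_add_left ore_mult_closed)
qed

lemma ring_ore: "ring E"
proof (rule ringI)
  have c: "ore_monom R \<one> 0 \<in> up R" by (simp add: up_monom)
  show "abelian_group E"
  proof (rule abelian_groupI)
    show "\<zero>\<^bsub>E\<^esub> \<in> carrier E" by (simp add: ore_ext_simps up_iff)
    fix x assume x: "x \<in> carrier E"
    have "(\<lambda>n. \<ominus> x n) \<in> up R" using x by (auto simp: ore_ext_simps up_iff)
    then show "\<exists>y\<in>carrier E. y \<oplus>\<^bsub>E\<^esub> x = \<zero>\<^bsub>E\<^esub>"
      using x by (intro bexI[of _ "\<lambda>n. \<ominus> x n"]) (auto simp: ore_ext_simps up_closed l_neg)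
  qed (auto simp: ore_ext_simps up_add up_closed a_ac)
  show "Group.monoid E"
  proof (rule monoidI)
    fix x assume "x \<in> carrier E"
    then have x: "x \<in> up R" by (simp add: ore_ext_simps)
    then show "\<one>\<^bsub>E\<^esub> \<otimes>\<^bsub>E\<^esub> x = x"
      by (simp add: ore_ext_simps ore_const_monom ore_mult_monom up_closed)
    show "x \<otimes>\<^bsub>E\<^esub> \<one>\<^bsub>E\<^esub> = x"
      unfolding ore_ext_simps ore_const_monom using x
    proof (induction x rule: up_induct)
      case (monom a i)
      then show ?case by (auto simp: ore_mult_monom c shift_pow_one) (auto simp: ore_monom_def)
    next
      case (add p q)
      then show ?case by (simp add: ore_mult_add_left c)
    qed
  qed (auto simp: ore_ext_simps ore_mult_closed ore_mult_assoc ore_const_monom c)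
qed (auto simp: ore_ext_simps ore_mult_add_left ore_mult_add_right)

lemma ore_const_hom: "ore_const R \<in> ring_hom R E"
  by (rule ring_hom_memI)
    (simp_all add: ore_ext_simps ore_const_monom up_monom ore_mult_monom, auto simp: ore_monom_def)

lemma ore_var_closed: "ore_var R \<in> carrier E"
  by (simp add: ore_ext_simps ore_var_monom up_monom)

lemma ore_var_const:
  assumes "r \<in> carrier R"
  shows "ore_var R \<otimes>\<^bsub>E\<^esub> ore_const R r =
    ore_const R (\<tau> r) \<otimes>\<^bsub>E\<^esub> ore_var R \<oplus>\<^bsub>E\<^esub> ore_const R (\<delta> r)"
  using assms
  by (auto simp: ore_ext_simps ore_const_monom ore_var_monom ore_mult_monom up_monom shift_monom)
    (auto simp: ore_monom_def)

lemma ore_induct: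
  assumes "p \<in> carrier E"
    and const: "\<And>r. r \<in> carrier R \<Longrightarrow> X (ore_const R r)" and var: "X (ore_var R)"
    and add: "\<And>p q. p \<in> carrier E \<Longrightarrow> q \<in> carrier E \<Longrightarrow> X p \<Longrightarrow> X q \<Longrightarrow> X (p \<oplus>\<^bsub>E\<^esub> q)"
    and mult: "\<And>p q. p \<in> carrier E \<Longrightarrow> q \<in> carrier E \<Longrightarrow> X p \<Longrightarrow> X q \<Longrightarrow> X (p \<otimes>\<^bsub>E\<^esub> q)"
  shows "X p"
  using assms(1) unfolding ore_ext_simps
proof (induction p rule: up_induct)
  case (monom a i)
  then show ?case
  proof (induction i)
    case 0
    then show ?case using const by (simp add: ore_const_monom)
  next
    case (Suc i)
    have "ore_monom R a (Suc i) = ore_monom R a i \<otimes>\<^bsub>E\<^esub> ore_var R"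
      using Suc.prems by (auto simp: ore_var_monom ore_mult_monom up_monom shift_pow_one)
        (auto simp: ore_monom_def)
    then show ?case
      using mult[OF _ ore_var_closed Suc.IH var] Suc.prems up_monom by (simp add: ore_ext_simps)
  qed
next
  case (add p q)
  then show ?case using assms(4) by (simp add: ore_ext_simps)
qed

text \<open>
  Universal property of the Ore extension: the evaluation \<open>\<Sum>\<^sub>i p\<^sub>i x\<^sup>i \<mapsto> \<Sum>\<^sub>i f(p\<^sub>i) b\<^sup>i\<close>. By
  \<open>rel\<close> it turns a shift into left multiplication by \<open>b\<close>, from which multiplicativity follows
  on monomials.
\<close>

lemma ore_lift:
  assumes B: "ring B" and f: "f \<in> ring_hom R B" and b: "b \<in> carrier B"
    and rel: "\<And>r. r \<in> carrier R \<Longrightarrow> b \<otimes>\<^bsub>B\<^esub> f r = f (\<tau> r) \<otimes>\<^bsub>B\<^esub> b \<oplus>\<^bsub>B\<^esub> f (\<delta> r)"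
  shows "\<exists>h \<in> ring_hom E B. (\<forall>r \<in> carrier R. h (ore_const R r) = f r) \<and> h (ore_var R) = b"
proof -
  interpret B: ring B by fact
  note [simp] = ring_hom_closed[OF f] b
  interpret h: coeff_sum R B "\<lambda>i a. f a \<otimes>\<^bsub>B\<^esub> b [^]\<^bsub>B\<^esub> i"
    by unfold_locales (auto simp: ring_hom_add[OF f] B.l_distr)
  have smult: "h.csum (\<lambda>n. a \<otimes> p n) = f a \<otimes>\<^bsub>B\<^esub> h.csum p" if a: "a \<in> carrier R" and p: "p \<in> up R" for a p
    using p
  proof (induction p rule: up_induct)
    case (monom c i)
    have "(\<lambda>n. a \<otimes> ore_monom R c i n) = ore_monom R (a \<otimes> c) i"
      using a by (auto simp: ore_monom_def)
    then show ?case using a monom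
      by (simp add: h.csum_monom ring_hom_mult[OF f] B.m_assoc)
  next
    case (add p q)
    then show ?case using a h.csum_add[OF up_smult[OF a add(1)] up_smult[OF a add(2)]]
      by (simp add: h.csum_add h.csum_closed B.r_distr r_distr up_closed)
  qed
  have shift: "h.csum (sh p) = b \<otimes>\<^bsub>B\<^esub> h.csum p" if "p \<in> up R" for p
    using that
  proof (induction p rule: up_induct)
    case (monom a i)
    have "f (\<tau> a) \<otimes>\<^bsub>B\<^esub> b [^]\<^bsub>B\<^esub> Suc i \<oplus>\<^bsub>B\<^esub> f (\<delta> a) \<otimes>\<^bsub>B\<^esub> b [^]\<^bsub>B\<^esub> i =
        (f (\<tau> a) \<otimes>\<^bsub>B\<^esub> b \<oplus>\<^bsub>B\<^esub> f (\<delta> a)) \<otimes>\<^bsub>B\<^esub> b [^]\<^bsub>B\<^esub> i"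
      using monom by (simp only: B.nat_pow_Suc2[OF b]) (simp add: B.l_distr B.m_assoc)
    also have "\<dots> = b \<otimes>\<^bsub>B\<^esub> (f a \<otimes>\<^bsub>B\<^esub> b [^]\<^bsub>B\<^esub> i)"
      using monom by (simp add: rel[symmetric] B.m_assoc)
    finally show ?case using monom
      by (simp add: shift_monom h.csum_add up_monom h.csum_monom)
  next
    case (add p q)
    then show ?case by (simp add: shift_add h.csum_add shift_closed h.csum_closed B.r_distr)
  qed
  have shift_pow: "h.csum ((sh ^^ i) p) = b [^]\<^bsub>B\<^esub> i \<otimes>\<^bsub>B\<^esub> h.csum p" if "p \<in> up R" for p i
  proof (induction i)
    case (Suc i)
    then show ?case using that
      by (simp only: B.nat_pow_Suc2[OF b]) (simp add: shift shift_pow_closed B.m_assoc h.csum_closed)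
  qed (simp add: that h.csum_closed)
  have mult: "h.csum (p \<otimes>\<^bsub>E\<^esub> q) = h.csum p \<otimes>\<^bsub>B\<^esub> h.csum q" if p: "p \<in> up R" and q: "q \<in> up R" for p q
    using p
  proof (induction p rule: up_induct)
    case (monom a i)
    then show ?case using q
      by (simp add: ore_mult_monom smult shift_pow shift_pow_closed h.csum_monom B.m_assoc h.csum_closed)
  next
    case (add p p')
    then show ?case using q
      by (simp add: ore_mult_add_left h.csum_add ore_mult_closed B.l_distr h.csum_closed)
  qed
  show ?thesis
  proof (intro bexI conjI ballI)
    show "h.csum \<in> ring_hom E B"
      by (rule ring_hom_memI)
        (simp_all add: ore_ext_simps h.csum_closed mult h.csum_add ore_const_monom h.csum_monom
          ring_hom_one[OF f])
    show "h.csum (ore_const R r) = f r" if "r \<in> carrier R" for r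
      using that by (simp add: ore_const_monom h.csum_monom)
    show "h.csum (ore_var R) = b"
      by (simp add: ore_var_monom h.csum_monom ring_hom_one[OF f])
  qed
qed

end

section \<open>Algebras over a field\<close>

text \<open>
  Associative algebras over a field whose elements form a type. Every product of scalar
  multiples can be normalized by moving all scalars to the front (\<open>smult_norm\<close>).
\<close>

locale kalg = ring A for A :: "('k::field, 'a) module" (structure) +
  assumes smult_closed [simp]: "a \<in> carrier A \<Longrightarrow> c \<odot> a \<in> carrier A"
    and smult_mult_left: "a \<in> carrier A \<Longrightarrow> b \<in> carrier A \<Longrightarrow> (c \<odot> a) \<otimes> b = c \<odot> (a \<otimes> b)"
    and smult_mult_right: "a \<in> carrier A \<Longrightarrow> b \<in> carrier A \<Longrightarrow> a \<otimes> (c \<odot> b) = c \<odot> (a \<otimes> b)"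
    and smult_smult: "a \<in> carrier A \<Longrightarrow> c \<odot> (d \<odot> a) = (c * d) \<odot> a"
    and one_smult [simp]: "a \<in> carrier A \<Longrightarrow> 1 \<odot> a = a"
    and smult_add_left: "a \<in> carrier A \<Longrightarrow> (c + d) \<odot> a = c \<odot> a \<oplus> d \<odot> a"
begin

lemma smult_one_mult: "a \<in> carrier A \<Longrightarrow> (c \<odot> \<one>) \<otimes> a = c \<odot> a"
  by (simp add: smult_mult_left)

lemma smult_mult_one: "a \<in> carrier A \<Longrightarrow> a \<otimes> (c \<odot> \<one>) = c \<odot> a"
  by (simp add: smult_mult_right)

lemma zero_smult [simp]: "a \<in> carrier A \<Longrightarrow> 0 \<odot> a = \<zero>"
  using smult_add_left[of a 0 0] by (metis add.l_cancel_one add_0 smult_closed)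

lemma smult_zero [simp]: "c \<odot> \<zero> = \<zero>"
  using smult_mult_right[of \<one> \<zero> c] smult_mult_left[of \<one> \<zero> c] by simp

lemma smult_add_right: "a \<in> carrier A \<Longrightarrow> b \<in> carrier A \<Longrightarrow> c \<odot> (a \<oplus> b) = c \<odot> a \<oplus> c \<odot> b"
  using r_distr[of a b "c \<odot> \<one>"] by (simp add: smult_one_mult)

lemma uminus_smult: "a \<in> carrier A \<Longrightarrow> (- c) \<odot> a = \<ominus> (c \<odot> a)"
  using smult_add_left[of a "-c" c] by (simp add: minus_equality)

lemma smult_uminus: "a \<in> carrier A \<Longrightarrow> c \<odot> (\<ominus> a) = \<ominus> (c \<odot> a)"
  using r_minus[of "c \<odot> \<one>" a] by (simp add: smult_one_mult)

lemma scalar_map_smult: "scalar_map A (\<lambda>c. c \<odot> \<one>)"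
  by (simp add: scalar_map_def smult_add_left smult_mult_left smult_smult)

lemmas smult_norm = smult_mult_left smult_mult_right smult_smult m_assoc

end

lemma kalgI:
  fixes A (structure)
  assumes A: "ring A" and e: "scalar_map A e"
    and central: "\<And>c a. a \<in> carrier A \<Longrightarrow> e c \<otimes> a = a \<otimes> e c"
    and smult: "\<And>c a. a \<in> carrier A \<Longrightarrow> c \<odot> a = e c \<otimes> a"
  shows "kalg A"
proof -
  interpret scalars A e using A e by (simp add: scalars_def scalars_axioms_def)
  show ?thesis
  proof
    fix a b c assume "a \<in> carrier A" "b \<in> carrier A"
    then show "a \<otimes> (c \<odot> b) = c \<odot> (a \<otimes> b)"
      using central[of a c] by (simp add: smult m_assoc[symmetric])
  qed (simp_all add: smult eta_mult eta_add l_distr m_assoc)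
qed

lemma kalg_inv_pres: "kalg (inv_pres rels)"
proof (rule kalgI[OF ring_inv_pres, of rels "\<lambda>c. pres_cls rels (scalar c)"])
  show "scalar_map (inv_pres rels) (\<lambda>c. pres_cls rels (scalar c))"
    by (simp add: scalar_map_def scalar_add scalar_mult pres_cls_add pres_cls_mult pres_cls_one)
qed (auto simp: inv_pres_carrier pres_cls_smult scalar_comm simp flip: pres_cls_mult)

context monoid
begin

lemma Units_inv_cancel_left: "u \<in> Units G \<Longrightarrow> x \<in> carrier G \<Longrightarrow> inv u \<otimes> (u \<otimes> x) = x"
  by (simp flip: m_assoc add: Units_closed)

lemma Units_cancel_inv_left: "u \<in> Units G \<Longrightarrow> x \<in> carrier G \<Longrightarrow> u \<otimes> (inv u \<otimes> x) = x"
  by (simp flip: m_assoc add: Units_closed)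

text \<open>Integral powers of a unit of a monoid that need not be a group.\<close>

definition unit_pow :: "'a \<Rightarrow> int \<Rightarrow> 'a" where
  "unit_pow u n = (if n \<ge> 0 then u [^] nat n else inv u [^] nat (- n))"

lemma unit_pow_closed [simp]: "u \<in> Units G \<Longrightarrow> unit_pow u n \<in> carrier G"
  by (simp add: unit_pow_def Units_closed del: pow_nat)

lemma unit_pow_zero [simp]: "unit_pow u 0 = \<one>"
  by (simp add: unit_pow_def)

lemma unit_pow_add_one:
  assumes "u \<in> Units G"
  shows "unit_pow u (n + 1) = u \<otimes> unit_pow u n"
proof (cases "n \<ge> 0")
  case True
  then have "nat (n + 1) = Suc (nat n)" by simp
  then show ?thesis
    using True assms nat_pow_Suc2[OF Units_closed[OF assms], of "nat n"]
    by (simp add: unit_pow_def Units_closed del: pow_nat)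
next
  case False
  then have "nat (- n) = Suc (nat (- (n + 1)))" by simp
  then have "u \<otimes> unit_pow u n = inv u [^] nat (- (n + 1))"
    using False assms nat_pow_Suc2[OF Units_inv_closed[OF assms], of "nat (- (n + 1))"]
    by (simp add: unit_pow_def Units_closed Units_cancel_inv_left del: pow_nat)
  then show ?thesis using False by (auto simp: unit_pow_def simp del: pow_nat)
qed

end

text \<open>
  If \<open>w u = c u w\<close>, then also \<open>w u\<^sup>n = c\<^sup>n u\<^sup>n w\<close> for negative \<open>n\<close>: the step downwards
  cancels one factor \<open>c\<close> and one factor \<open>u\<close>.
\<close>

lemma (in kalg) unit_pow_commute:
  assumes u: "u \<in> Units A" and w: "w \<in> carrier A" and c: "c \<noteq> 0"
    and rel: "w \<otimes> u = c \<odot> (u \<otimes> w)"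
  shows "w \<otimes> unit_pow u n = (c powi n) \<odot> (unit_pow u n \<otimes> w)"
proof (induction n rule: int_induct[of _ 0])
  case base
  then show ?case using w by simp
next
  case (step1 n)
  have [simp]: "u \<in> carrier A" using u by (rule Units_closed)
  have "w \<otimes> unit_pow u (n + 1) = (w \<otimes> u) \<otimes> unit_pow u n"
    using u w by (simp add: unit_pow_add_one m_assoc)
  also have "\<dots> = c \<odot> (u \<otimes> (w \<otimes> unit_pow u n))"
    using u w by (simp add: rel smult_norm)
  also have "\<dots> = (c powi (n + 1)) \<odot> (unit_pow u (n + 1) \<otimes> w)"
    using u w c by (simp add: step1 smult_norm unit_pow_add_one power_int_add mult.commute)
  finally show ?case .
next
  case (step2 n)
  have [simp]: "u \<in> carrier A" using u by (rule Units_closed)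
  define y where "y = unit_pow u (n - 1)"
  have y [simp]: "y \<in> carrier A" using u by (simp add: y_def)
  have un: "unit_pow u n = u \<otimes> y"
    using unit_pow_add_one[OF u, of "n - 1"] by (simp add: y_def)
  have "c \<odot> (u \<otimes> (w \<otimes> y)) = (w \<otimes> u) \<otimes> y"
    using u w by (simp add: rel smult_norm)
  also have "\<dots> = (c powi n) \<odot> (u \<otimes> (y \<otimes> w))"
    using step2(2) u w by (simp add: un smult_norm)
  finally have "(inverse c) \<odot> (c \<odot> (u \<otimes> (w \<otimes> y))) = (inverse c) \<odot> ((c powi n) \<odot> (u \<otimes> (y \<otimes> w)))"
    by simp
  then have "u \<otimes> (w \<otimes> y) = (c powi (n - 1)) \<odot> (u \<otimes> (y \<otimes> w))"
    using u w c by (simp add: smult_smult power_int_diff field_simps)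
  then have "inv u \<otimes> (u \<otimes> (w \<otimes> y)) = inv u \<otimes> ((c powi (n - 1)) \<odot> (u \<otimes> (y \<otimes> w)))" by simp
  then show ?case
    using u w by (simp add: y_def[symmetric] Units_inv_cancel_left smult_mult_right)
qed


section \<open>The quantum torus\<close>

text \<open>
  The operators of the regular representation below. A shift is given by the map \<open>\<sigma>\<close> on
  indices at which the old coefficient is read off, so \<open>\<sigma>\<close> is the inverse of the motion of basis vectors.
\<close>

definition weighted_shift :: "('i \<Rightarrow> 'i) \<Rightarrow> ('i \<Rightarrow> 'k::field) \<Rightarrow> ('i \<Rightarrow>\<^sub>0 'k) \<Rightarrow> ('i \<Rightarrow>\<^sub>0 'k)" where
  "weighted_shift \<sigma> w v = Poly_Mapping.mapp (\<lambda>k x. w k * x) (Poly_Mapping.map_key \<sigma> v)"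

lemma lookup_weighted_shift:
  "inj \<sigma> \<Longrightarrow> Poly_Mapping.lookup (weighted_shift \<sigma> w v) k = w k * Poly_Mapping.lookup v (\<sigma> k)"
  by (simp add: weighted_shift_def lookup_mapp when_def in_keys_iff map_key.rep_eq)

text \<open>The target of the regular representation: all additive self-maps of an abelian group.\<close>

definition additive_end :: "('v::ab_group_add \<Rightarrow> 'v) ring" where
  "additive_end = \<lparr>carrier = {f. \<forall>v w. f (v + w) = f v + f w}, mult = (\<circ>), one = id,
     zero = (\<lambda>_. 0), add = (\<lambda>f g v. f v + g v)\<rparr>"

lemma ring_additive_end: "ring (additive_end :: ('v::ab_group_add \<Rightarrow> 'v) ring)"
proof (rule ringI)
  show "abelian_group (additive_end :: ('v \<Rightarrow> 'v) ring)"
  proof (rule abelian_groupI)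
    fix x assume "x \<in> carrier (additive_end :: ('v \<Rightarrow> 'v) ring)"
    then show "\<exists>y\<in>carrier additive_end. y \<oplus>\<^bsub>additive_end\<^esub> x = \<zero>\<^bsub>(additive_end :: ('v \<Rightarrow> 'v) ring)\<^esub>"
      by (intro bexI[of _ "\<lambda>v. - x v"]) (auto simp: additive_end_def)
  qed (auto simp: additive_end_def algebra_simps)
  show "Group.monoid (additive_end :: ('v \<Rightarrow> 'v) ring)"
    by (rule monoidI) (auto simp: additive_end_def)
qed (auto simp: additive_end_def)

locale torus =
  fixes q :: "'k::field"
  assumes q_nz: "q \<noteq> 0"
begin

abbreviation R where "R \<equiv> qtorus q"
abbreviation z1 where "z1 \<equiv> zgen q Z1"
abbreviation z2 where "z2 \<equiv> zgen q Z2"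
abbreviation z3 where "z3 \<equiv> zgen q Z3"

abbreviation sc where "sc c \<equiv> c \<odot>\<^bsub>R\<^esub> \<one>\<^bsub>R\<^esub>"

sublocale kalg R
  unfolding qtorus_def by (rule kalg_inv_pres)

lemma z_Units [simp]: "zgen q g \<in> Units R"
  unfolding zgen_def qtorus_def by (rule inv_pres_gen_Units)

lemma z_closed [simp]: "zgen q g \<in> carrier R"
  using z_Units by (rule Units_closed)

lemma z_inv_closed [simp]: "inv\<^bsub>R\<^esub> zgen q g \<in> carrier R"
  using z_Units by (rule Units_inv_closed)

lemma z_rel12: "z2 \<otimes>\<^bsub>R\<^esub> z1 = z1 \<otimes>\<^bsub>R\<^esub> z2"
  and z_rel13: "z3 \<otimes>\<^bsub>R\<^esub> z1 = q \<odot>\<^bsub>R\<^esub> (z1 \<otimes>\<^bsub>R\<^esub> z3)"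
  and z_rel23: "z3 \<otimes>\<^bsub>R\<^esub> z2 = q \<odot>\<^bsub>R\<^esub> (z2 \<otimes>\<^bsub>R\<^esub> z3)"
proof -
  define cls where "cls = pres_cls (torus_rels q)"
  have m: "cls (x * y) = cls x \<otimes>\<^bsub>R\<^esub> cls y" for x y by (simp add: cls_def qtorus_def pres_cls_mult)
  have z: "cls (var (Pos g)) = zgen q g" for g by (simp add: cls_def zgen_def inv_pres_gen_eq)
  have c: "cls (scalar c) = sc c" for c by (simp add: cls_def qtorus_def inv_pres_smult_one)
  have "\<forall>(l, r) \<in> torus_rels q. cls l = cls r" unfolding cls_def using pres_cls_rel by blast
  then show "z2 \<otimes>\<^bsub>R\<^esub> z1 = z1 \<otimes>\<^bsub>R\<^esub> z2" "z3 \<otimes>\<^bsub>R\<^esub> z1 = q \<odot>\<^bsub>R\<^esub> (z1 \<otimes>\<^bsub>R\<^esub> z3)"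
    "z3 \<otimes>\<^bsub>R\<^esub> z2 = q \<odot>\<^bsub>R\<^esub> (z2 \<otimes>\<^bsub>R\<^esub> z3)"
    using q_nz by (simp_all add: torus_rels_def m z c smult_norm)
qed

lemma torus_induct:
  assumes "r \<in> carrier R"
    and "\<And>c. X (sc c)" "X z1" "X z2" "X z3"
    and "\<And>u. u \<in> Units R \<Longrightarrow> X u \<Longrightarrow> X (inv\<^bsub>R\<^esub> u)"
    and "\<And>a b. a \<in> carrier R \<Longrightarrow> b \<in> carrier R \<Longrightarrow> X a \<Longrightarrow> X b \<Longrightarrow> X (a \<oplus>\<^bsub>R\<^esub> b)"
    and "\<And>a b. a \<in> carrier R \<Longrightarrow> b \<in> carrier R \<Longrightarrow> X a \<Longrightarrow> X b \<Longrightarrow> X (a \<otimes>\<^bsub>R\<^esub> b)"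
  shows "X r"
proof -
  have g: "X (zgen q g)" for g by (cases g) (use assms(3-5) in auto)
  show ?thesis
    by (rule inv_pres_induct[of r "torus_rels q" X, folded qtorus_def zgen_def, OF assms(1,2)])
      (use g assms(6)[OF z_Units] assms(7,8) in \<open>simp_all add: zgen_def[symmetric]\<close>)
qed

lemma torus_hom_unique:
  assumes B: "ring B" and f: "f \<in> ring_hom R B" and g: "g \<in> ring_hom R B"
    and "\<And>c. f (sc c) = g (sc c)"
    and "f z1 = g z1" "f z2 = g z2" "f z3 = g z3"
    and "a \<in> carrier R"
  shows "f a = g a"
proof -
  have "f (zgen q x) = g (zgen q x)" for x by (cases x) (use assms(5-7) in auto)
  then show ?thesis
    using inv_pres_hom_unique[OF B, of f "torus_rels q" g a] assms(2-4,8)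
    by (simp add: qtorus_def zgen_def)
qed

lemma torus_lift:
  assumes B: "ring B" and eta: "scalar_map B \<eta>"
    and u: "u1 \<in> Units B" "u2 \<in> Units B" "u3 \<in> Units B"
    and comm: "\<And>c. \<eta> c \<otimes>\<^bsub>B\<^esub> u1 = u1 \<otimes>\<^bsub>B\<^esub> \<eta> c" "\<And>c. \<eta> c \<otimes>\<^bsub>B\<^esub> u2 = u2 \<otimes>\<^bsub>B\<^esub> \<eta> c"
      "\<And>c. \<eta> c \<otimes>\<^bsub>B\<^esub> u3 = u3 \<otimes>\<^bsub>B\<^esub> \<eta> c"
    and rel: "u1 \<otimes>\<^bsub>B\<^esub> u2 = u2 \<otimes>\<^bsub>B\<^esub> u1"
      "u1 \<otimes>\<^bsub>B\<^esub> u3 = \<eta> (inverse q) \<otimes>\<^bsub>B\<^esub> (u3 \<otimes>\<^bsub>B\<^esub> u1)"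
      "u2 \<otimes>\<^bsub>B\<^esub> u3 = \<eta> (inverse q) \<otimes>\<^bsub>B\<^esub> (u3 \<otimes>\<^bsub>B\<^esub> u2)"
  shows "\<exists>h \<in> ring_hom R B. (\<forall>c. h (sc c) = \<eta> c) \<and> h z1 = u1 \<and> h z2 = u2 \<and> h z3 = u3"
proof -
  interpret B: ring B by fact
  have [simp]: "\<eta> c \<in> carrier B" for c using eta by (simp add: scalar_map_def)
  note uc = u[THEN B.Units_closed]
  define b where "b g = (case g of Z1 \<Rightarrow> u1 | Z2 \<Rightarrow> u2 | Z3 \<Rightarrow> u3)" for g
  have "\<exists>h \<in> ring_hom (inv_pres (torus_rels q)) B.
      (\<forall>c. h (c \<odot>\<^bsub>inv_pres (torus_rels q)\<^esub> \<one>\<^bsub>inv_pres (torus_rels q)\<^esub>) = \<eta> c) \<and>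
      (\<forall>g. h (inv_pres_gen (torus_rels q) g) = b g)"
  proof (rule inv_pres_lift[OF B eta])
    show "b g \<in> Units B" for g using u by (simp add: b_def split: torus_gen.split)
    show "\<eta> c \<otimes>\<^bsub>B\<^esub> b g = b g \<otimes>\<^bsub>B\<^esub> \<eta> c" for c g using comm by (simp add: b_def split: torus_gen.split)
    fix f l r
    assume lr: "(l, r) \<in> torus_rels q" and f: "f \<in> ring_hom (free_alg UNIV) B"
      and s: "\<And>c. f (scalar c) = \<eta> c" and p: "\<And>g. f (var (Pos g)) = b g"
    have m: "f (x * y) = f x \<otimes>\<^bsub>B\<^esub> f y" for x y using ring_hom_mult[OF f, of x y] by simp
    show "f l = f r"
      using lr rel by (auto simp: torus_rels_def m s p b_def B.m_assoc uc)
  qed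
  then obtain h where h: "h \<in> ring_hom R B" "\<And>c. h (sc c) = \<eta> c" "\<And>g. h (zgen q g) = b g"
    by (auto simp: qtorus_def zgen_def)
  show ?thesis by (rule bexI[OF _ h(1)]) (simp add: h(2,3) b_def)
qed

text \<open>
  Let \<open>(a, b, c)\<close> stand for the monomial \<open>z\<^sub>1\<^sup>a z\<^sub>2\<^sup>b z\<^sub>3\<^sup>c\<close>. In this basis left multiplication by
  \<open>z\<^sub>1\<close> and \<open>z\<^sub>2\<close> is a plain shift, while \<open>z\<^sub>3\<close> also contributes the factor \<open>q\<^sup>a\<^sup>+\<^sup>b\<close> that arises from
  moving it past \<open>z\<^sub>1\<^sup>a z\<^sub>2\<^sup>b\<close>.
\<close>

definition sh1 :: "int \<times> int \<times> int \<Rightarrow> int \<times> int \<times> int" where "sh1 = (\<lambda>(a, b, c). (a - 1, b, c))"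
definition sh2 :: "int \<times> int \<times> int \<Rightarrow> int \<times> int \<times> int" where "sh2 = (\<lambda>(a, b, c). (a, b - 1, c))"
definition sh3 :: "int \<times> int \<times> int \<Rightarrow> int \<times> int \<times> int" where "sh3 = (\<lambda>(a, b, c). (a, b, c - 1))"
definition wt3 :: "int \<times> int \<times> int \<Rightarrow> 'k" where "wt3 = (\<lambda>(a, b, c). q powi (a + b))"

lemma inj_sh [simp]: "inj sh1" "inj sh2" "inj sh3" "inj id"
  by (auto simp: sh1_def sh2_def sh3_def inj_def)

abbreviation "op1 \<equiv> weighted_shift sh1 (\<lambda>_. 1::'k)"
abbreviation "op2 \<equiv> weighted_shift sh2 (\<lambda>_. 1::'k)"
abbreviation "op3 \<equiv> weighted_shift sh3 wt3"
abbreviation "ops \<equiv> \<lambda>c::'k. weighted_shift (id :: int \<times> int \<times> int \<Rightarrow> _) (\<lambda>_. c)"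

lemma weighted_shift_Units:
  assumes "inj \<sigma>" "inj \<sigma>'" "\<And>k. \<sigma> (\<sigma>' k) = k" "\<And>k. \<sigma>' (\<sigma> k) = k" "\<And>k. w k \<noteq> (0::'k)"
  shows "weighted_shift \<sigma> w \<in> Units additive_end"
proof -
  have "weighted_shift \<sigma> w \<circ> weighted_shift \<sigma>' (\<lambda>k. inverse (w (\<sigma>' k))) = id"
    using assms by (auto simp: fun_eq_iff poly_mapping_eq_iff lookup_weighted_shift)
  moreover have "weighted_shift \<sigma>' (\<lambda>k. inverse (w (\<sigma>' k))) \<circ> weighted_shift \<sigma> w = id"
    using assms by (auto simp: fun_eq_iff poly_mapping_eq_iff lookup_weighted_shift)
  ultimately show ?thesis
    using assms unfolding Units_def
    by (auto simp: additive_end_def poly_mapping_eq_iff fun_eq_iff lookup_weighted_shift lookup_add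
        algebra_simps intro!: exI[of _ "weighted_shift \<sigma>' (\<lambda>k. inverse (w (\<sigma>' k)))"])
qed

text \<open>
  The weighted shifts satisfy the defining relations, so the torus acts on finitely supported
  functions on \<open>\<int>\<^sup>3\<close>.
\<close>

lemma torus_rep:
  "\<exists>\<rho> \<in> ring_hom R additive_end. (\<forall>c. \<rho> (sc c) = ops c) \<and>
     \<rho> z1 = op1 \<and> \<rho> z2 = op2 \<and> \<rho> z3 = op3"
proof (rule torus_lift[OF ring_additive_end])
  show "scalar_map additive_end ops"
    by (auto simp: scalar_map_def additive_end_def poly_mapping_eq_iff fun_eq_iff
        lookup_weighted_shift lookup_add algebra_simps)
  show "op1 \<in> Units additive_end"
    by (rule weighted_shift_Units[of _ "\<lambda>(a, b, c). (a + 1, b, c)"]) (auto simp: sh1_def inj_def)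
  show "op2 \<in> Units additive_end"
    by (rule weighted_shift_Units[of _ "\<lambda>(a, b, c). (a, b + 1, c)"]) (auto simp: sh2_def inj_def)
  show "op3 \<in> Units additive_end"
    by (rule weighted_shift_Units[of _ "\<lambda>(a, b, c). (a, b, c + 1)"])
      (use q_nz in \<open>auto simp: sh3_def wt3_def inj_def\<close>)
  show "op1 \<otimes>\<^bsub>additive_end\<^esub> op3 = ops (inverse q) \<otimes>\<^bsub>additive_end\<^esub> (op3 \<otimes>\<^bsub>additive_end\<^esub> op1)"
    using q_nz by (auto simp: additive_end_def poly_mapping_eq_iff fun_eq_iff lookup_weighted_shift)
      (auto simp: sh1_def sh3_def wt3_def field_simps power_int_diff power_int_add)
  show "op2 \<otimes>\<^bsub>additive_end\<^esub> op3 = ops (inverse q) \<otimes>\<^bsub>additive_end\<^esub> (op3 \<otimes>\<^bsub>additive_end\<^esub> op2)"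
    using q_nz by (auto simp: additive_end_def poly_mapping_eq_iff fun_eq_iff lookup_weighted_shift)
      (auto simp: sh2_def sh3_def wt3_def field_simps power_int_diff power_int_add)
qed (auto simp: additive_end_def poly_mapping_eq_iff fun_eq_iff lookup_weighted_shift,
    auto simp: sh1_def sh2_def)

sublocale scalars R "\<lambda>c. sc c"
  by unfold_locales (rule scalar_map_smult)

text \<open>
  Reading an index as a monomial gives a linear map \<open>zlin\<close> from the representation space
  back to the torus.
\<close>

definition zmon :: "int \<times> int \<times> int \<Rightarrow> 'k qt" where
  "zmon = (\<lambda>(a, b, c). unit_pow z1 a \<otimes>\<^bsub>R\<^esub> (unit_pow z2 b \<otimes>\<^bsub>R\<^esub> unit_pow z3 c))"

lemma zmon_closed [simp]: "zmon k \<in> carrier R"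
  by (auto simp: zmon_def split: prod.split)

abbreviation "zlin \<equiv> lin_ext zmon"

lemma zlin_closed [simp]: "zlin v \<in> carrier R"
  by (rule lin_ext_closed) simp

lemma zlin_add: "zlin (v + w) = zlin v \<oplus>\<^bsub>R\<^esub> zlin w"
  by (rule lin_ext_add) simp

lemma zlin_single: "zlin (Poly_Mapping.single k x) = x \<odot>\<^bsub>R\<^esub> zmon k"
  using lin_ext_single[of zmon k x] by (simp add: smult_one_mult)

lemma zmon_shift:
  "zmon (a + 1, b, c) = z1 \<otimes>\<^bsub>R\<^esub> zmon (a, b, c)"
  "zmon (a, b + 1, c) = z2 \<otimes>\<^bsub>R\<^esub> zmon (a, b, c)"
  "(q powi (a + b)) \<odot>\<^bsub>R\<^esub> zmon (a, b, c + 1) = z3 \<otimes>\<^bsub>R\<^esub> zmon (a, b, c)"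
proof -
  let ?p1 = "unit_pow z1 a" and ?p2 = "unit_pow z2 b" and ?p3 = "unit_pow z3 c"
  show "zmon (a + 1, b, c) = z1 \<otimes>\<^bsub>R\<^esub> zmon (a, b, c)"
    by (simp add: zmon_def unit_pow_add_one m_assoc)
  have c21: "z2 \<otimes>\<^bsub>R\<^esub> ?p1 = ?p1 \<otimes>\<^bsub>R\<^esub> z2"
    using unit_pow_commute[of z1 z2 1 a] by (simp add: z_rel12)
  have "z2 \<otimes>\<^bsub>R\<^esub> zmon (a, b, c) = (z2 \<otimes>\<^bsub>R\<^esub> ?p1) \<otimes>\<^bsub>R\<^esub> (?p2 \<otimes>\<^bsub>R\<^esub> ?p3)"
    by (simp add: zmon_def m_assoc)
  then show "zmon (a, b + 1, c) = z2 \<otimes>\<^bsub>R\<^esub> zmon (a, b, c)"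
    by (simp add: c21 zmon_def unit_pow_add_one m_assoc)
  have c31: "z3 \<otimes>\<^bsub>R\<^esub> ?p1 = (q powi a) \<odot>\<^bsub>R\<^esub> (?p1 \<otimes>\<^bsub>R\<^esub> z3)"
    by (rule unit_pow_commute) (simp_all add: q_nz z_rel13)
  have c32: "z3 \<otimes>\<^bsub>R\<^esub> ?p2 = (q powi b) \<odot>\<^bsub>R\<^esub> (?p2 \<otimes>\<^bsub>R\<^esub> z3)"
    by (rule unit_pow_commute) (simp_all add: q_nz z_rel23)
  have "z3 \<otimes>\<^bsub>R\<^esub> zmon (a, b, c) = (z3 \<otimes>\<^bsub>R\<^esub> ?p1) \<otimes>\<^bsub>R\<^esub> (?p2 \<otimes>\<^bsub>R\<^esub> ?p3)"
    by (simp add: zmon_def m_assoc)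
  also have "\<dots> = (q powi a) \<odot>\<^bsub>R\<^esub> (?p1 \<otimes>\<^bsub>R\<^esub> ((z3 \<otimes>\<^bsub>R\<^esub> ?p2) \<otimes>\<^bsub>R\<^esub> ?p3))"
    by (simp add: c31 smult_norm)
  also have "\<dots> = (q powi (a + b)) \<odot>\<^bsub>R\<^esub> zmon (a, b, c + 1)"
    using q_nz by (simp add: c32 smult_norm zmon_def unit_pow_add_one power_int_add)
  finally show "(q powi (a + b)) \<odot>\<^bsub>R\<^esub> zmon (a, b, c + 1) = z3 \<otimes>\<^bsub>R\<^esub> zmon (a, b, c)" by simp
qed

lemma zlin_intertwines_gen:
  assumes "inj \<sigma>" "\<And>k. \<sigma> (\<sigma>' k) = k" "\<And>k. \<sigma>' (\<sigma> k) = k" "u \<in> carrier R"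
    and "\<And>k. w (\<sigma>' k) \<odot>\<^bsub>R\<^esub> zmon (\<sigma>' k) = u \<otimes>\<^bsub>R\<^esub> zmon k"
  shows "zlin (weighted_shift \<sigma> w v) = u \<otimes>\<^bsub>R\<^esub> zlin v"
proof (rule poly_mapping_keys_induct[of v UNIV])
  have z: "weighted_shift \<sigma> w 0 = 0"
    using assms(1) by (auto simp: poly_mapping_eq_iff fun_eq_iff lookup_weighted_shift)
  then show "zlin (weighted_shift \<sigma> w 0) = u \<otimes>\<^bsub>R\<^esub> zlin 0"
    using assms(4) lin_ext_zero by simp
  fix k x
  have "weighted_shift \<sigma> w (Poly_Mapping.single k x) = Poly_Mapping.single (\<sigma>' k) (w (\<sigma>' k) * x)"
  proof (rule poly_mapping_eqI)
    fix l
    have "k = \<sigma> l \<longleftrightarrow> \<sigma>' k = l" using assms(2,3) by metis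
    then show "Poly_Mapping.lookup (weighted_shift \<sigma> w (Poly_Mapping.single k x)) l =
        Poly_Mapping.lookup (Poly_Mapping.single (\<sigma>' k) (w (\<sigma>' k) * x)) l"
      using assms(1) by (simp add: lookup_weighted_shift lookup_single when_def)
  qed
  moreover have "(w (\<sigma>' k) * x) \<odot>\<^bsub>R\<^esub> zmon (\<sigma>' k) = x \<odot>\<^bsub>R\<^esub> (u \<otimes>\<^bsub>R\<^esub> zmon k)"
    using assms(5)[of k, symmetric] by (simp add: smult_smult mult.commute)
  ultimately show "zlin (weighted_shift \<sigma> w (Poly_Mapping.single k x)) = u \<otimes>\<^bsub>R\<^esub> zlin (Poly_Mapping.single k x)"
    using assms(4) by (simp add: zlin_single smult_mult_right)
next
  fix v v'
  assume IH: "zlin (weighted_shift \<sigma> w v) = u \<otimes>\<^bsub>R\<^esub> zlin v" "zlin (weighted_shift \<sigma> w v') = u \<otimes>\<^bsub>R\<^esub> zlin v'"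
  have "weighted_shift \<sigma> w (v + v') = weighted_shift \<sigma> w v + weighted_shift \<sigma> w v'"
    using assms(1) by (auto simp: poly_mapping_eq_iff fun_eq_iff lookup_weighted_shift lookup_add algebra_simps)
  then show "zlin (weighted_shift \<sigma> w (v + v')) = u \<otimes>\<^bsub>R\<^esub> zlin (v + v')"
    using IH assms(4) by (simp add: zlin_add r_distr)
qed simp

text \<open>
  The map \<open>zlin\<close> is a homomorphism of left modules over the torus: it suffices to compare
  the generators on basis vectors, and the property passes to inverses of units. Evaluated at the basis
  vector of \<open>1\<close>, it recovers \<open>r\<close> from its action, so the action is faithful.
\<close>

lemma zlin_intertwines:
  assumes rho: "\<rho> \<in> ring_hom R additive_end" "\<And>c. \<rho> (sc c) = ops c"
     "\<rho> z1 = op1" "\<rho> z2 = op2" "\<rho> z3 = op3" and r: "r \<in> carrier R"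
  shows "zlin (\<rho> r v) = r \<otimes>\<^bsub>R\<^esub> zlin v"
proof -
  have "\<forall>v. zlin (\<rho> r v) = r \<otimes>\<^bsub>R\<^esub> zlin v"
    using r
  proof (rule torus_induct; intro allI)
  fix c v
  show "zlin (\<rho> (sc c) v) = (sc c) \<otimes>\<^bsub>R\<^esub> zlin v"
    unfolding rho(2) by (rule zlin_intertwines_gen[of _ id]) (simp_all add: smult_one_mult)
next
  fix v
  show "zlin (\<rho> z1 v) = z1 \<otimes>\<^bsub>R\<^esub> zlin v"
    unfolding rho(3) by (rule zlin_intertwines_gen[OF inj_sh(1), of "\<lambda>(a, b, c). (a + 1, b, c)"])
      (auto simp: sh1_def zmon_shift(1))
  show "zlin (\<rho> z2 v) = z2 \<otimes>\<^bsub>R\<^esub> zlin v"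
    unfolding rho(4) by (rule zlin_intertwines_gen[OF inj_sh(2), of "\<lambda>(a, b, c). (a, b + 1, c)"])
      (auto simp: sh2_def zmon_shift(2))
  show "zlin (\<rho> z3 v) = z3 \<otimes>\<^bsub>R\<^esub> zlin v"
    unfolding rho(5) by (rule zlin_intertwines_gen[OF inj_sh(3), of "\<lambda>(a, b, c). (a, b, c + 1)"])
      (auto simp: sh3_def wt3_def zmon_shift(3))
next
  fix u v assume u: "u \<in> Units R" and IH: "\<forall>v. zlin (\<rho> u v) = u \<otimes>\<^bsub>R\<^esub> zlin v"
  have uc: "u \<in> carrier R" "inv\<^bsub>R\<^esub> u \<in> carrier R" using u by auto
  have "\<rho> (u \<otimes>\<^bsub>R\<^esub> inv\<^bsub>R\<^esub> u) = \<rho> \<one>\<^bsub>R\<^esub>" using u by simp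
  then have "\<rho> u (\<rho> (inv\<^bsub>R\<^esub> u) v) = v"
    using ring_hom_mult[OF rho(1) uc] ring_hom_one[OF rho(1)]
    by (metis (no_types, lifting) additive_end_def comp_apply eq_id_iff monoid.select_convs(1) monoid.select_convs(2))
  then have "zlin v = u \<otimes>\<^bsub>R\<^esub> zlin (\<rho> (inv\<^bsub>R\<^esub> u) v)" using IH by metis
  then show "zlin (\<rho> (inv\<^bsub>R\<^esub> u) v) = inv\<^bsub>R\<^esub> u \<otimes>\<^bsub>R\<^esub> zlin v"
    using u by (simp add: Units_inv_cancel_left)
next
  fix a b v assume "a \<in> carrier R" "b \<in> carrier R"
    and "\<forall>v. zlin (\<rho> a v) = a \<otimes>\<^bsub>R\<^esub> zlin v" "\<forall>v. zlin (\<rho> b v) = b \<otimes>\<^bsub>R\<^esub> zlin v"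
  then show "zlin (\<rho> (a \<oplus>\<^bsub>R\<^esub> b) v) = (a \<oplus>\<^bsub>R\<^esub> b) \<otimes>\<^bsub>R\<^esub> zlin v"
    "zlin (\<rho> (a \<otimes>\<^bsub>R\<^esub> b) v) = (a \<otimes>\<^bsub>R\<^esub> b) \<otimes>\<^bsub>R\<^esub> zlin v"
    by (simp_all add: ring_hom_add[OF rho(1)] ring_hom_mult[OF rho(1)] zlin_add l_distr m_assoc)
      (simp_all add: additive_end_def zlin_add)
qed
  then show ?thesis by blast
qed

text \<open>
  The hypothesis makes \<open>v\<close> constant along the lines in direction \<open>(1, -1, 0)\<close>, which is
  incompatible with a finite nonempty support.
\<close>

lemma finite_support_antidiagonal:
  assumes "op1 v = op2 v"
  shows "v = 0"
proof (rule ccontr)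
  assume "v \<noteq> 0"
  then obtain a b c where k: "Poly_Mapping.lookup v (a, b, c) \<noteq> 0"
    by (metis lookup_zero poly_mapping_eqI prod_cases3)
  have step: "Poly_Mapping.lookup v (a + 1, b - 1, c) = Poly_Mapping.lookup v (a, b, c)" for a b c
  proof -
    have "Poly_Mapping.lookup (op1 v) (a + 1, b, c) = Poly_Mapping.lookup (op2 v) (a + 1, b, c)"
      by (simp add: assms)
    then have "Poly_Mapping.lookup v (sh1 (a + 1, b, c)) = Poly_Mapping.lookup v (sh2 (a + 1, b, c))"
      by (simp add: lookup_weighted_shift)
    then show ?thesis by (simp add: sh1_def sh2_def)
  qed
  have all: "Poly_Mapping.lookup v (a + int n, b - int n, c) \<noteq> 0" for n
  proof (induction n)
    case (Suc n)
    then show ?case using step[of "a + int n" "b - int n" c] by (simp add: algebra_simps)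
  qed (use k in simp)
  have "range (\<lambda>n. (a + int n, b - int n, c)) \<subseteq> Poly_Mapping.keys v"
    using all by (auto simp: in_keys_iff)
  then have "finite (range (\<lambda>n. (a + int n, b - int n, c)))"
    using finite_keys finite_subset by blast
  then show False using finite_imageD[of "\<lambda>n. (a + int n, b - int n, c)" UNIV] by (auto simp: inj_def)
qed

text \<open>
  This cancellation makes the fraction in the definition of \<open>\<delta>\<^sub>1\<close> meaningful. It is the
  only place where the size of the torus matters: by faithfulness of the action the question is about
  the difference of two shifts on finitely supported functions.
\<close>

lemma z1_minus_z2_regular:
  assumes d: "d \<in> carrier R" and eq: "(z1 \<ominus>\<^bsub>R\<^esub> z2) \<otimes>\<^bsub>R\<^esub> d = \<zero>\<^bsub>R\<^esub>"
  shows "d = \<zero>\<^bsub>R\<^esub>"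
proof -
  obtain \<rho> where rho: "\<rho> \<in> ring_hom R additive_end" "\<And>c. \<rho> (sc c) = ops c"
     "\<rho> z1 = op1" "\<rho> z2 = op2" "\<rho> z3 = op3" using torus_rep by blast
  define e :: "int \<times> int \<times> int \<Rightarrow>\<^sub>0 'k" where "e = Poly_Mapping.single (0, 0, 0) 1"
  have "z1 \<otimes>\<^bsub>R\<^esub> d = z2 \<otimes>\<^bsub>R\<^esub> d"
    using eq d by (simp add: minus_eq l_distr l_minus minus_zero_iff[unfolded minus_eq])
  then have "\<rho> (z1 \<otimes>\<^bsub>R\<^esub> d) e = \<rho> (z2 \<otimes>\<^bsub>R\<^esub> d) e" by simp
  then have "op1 (\<rho> d e) = op2 (\<rho> d e)"
    using d by (simp add: ring_hom_mult[OF rho(1)] rho) (simp add: additive_end_def)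
  then have "\<rho> d e = 0" by (rule finite_support_antidiagonal)
  moreover have "zlin e = \<one>\<^bsub>R\<^esub>" by (simp add: e_def zlin_single) (simp add: zmon_def)
  ultimately show ?thesis
    using zlin_intertwines[OF rho d, of e] d lin_ext_zero by simp
qed

end

section \<open>Quadratic quotients of Ore extensions\<close>

context ore
begin

text \<open>
  The condition at \<open>r\<close> for \<open>b\<close> to be a possible image of the Ore variable. It propagates
  through sums, products and inverses, so over the torus it is checked on scalars and generators.
\<close>

definition skew_rel :: "('b, 'l) ring_scheme \<Rightarrow> ('a \<Rightarrow> 'b) \<Rightarrow> 'b \<Rightarrow> 'a \<Rightarrow> bool" where
  "skew_rel B f b r \<longleftrightarrow> b \<otimes>\<^bsub>B\<^esub> f r = f (\<tau> r) \<otimes>\<^bsub>B\<^esub> b \<oplus>\<^bsub>B\<^esub> f (\<delta> r)"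

context
  fixes B :: "('b, 'l) ring_scheme" and f b
  assumes B: "ring B" and f: "f \<in> ring_hom R B" and b: "b \<in> carrier B"
begin

interpretation B: ring B by (rule B)

lemmas [simp] = ring_hom_closed[OF f] b

lemma skew_rel_add:
  assumes "r \<in> carrier R" "r' \<in> carrier R" "skew_rel B f b r" "skew_rel B f b r'"
  shows "skew_rel B f b (r \<oplus> r')"
  using assms
  by (simp add: skew_rel_def ring_hom_add[OF f] ring_hom_add[OF tau_hom] delta_add B.r_distr
      B.l_distr B.a_ac)

lemma skew_rel_mult:
  assumes "r \<in> carrier R" "r' \<in> carrier R" "skew_rel B f b r" "skew_rel B f b r'"
  shows "skew_rel B f b (r \<otimes> r')"
proof -
  have "b \<otimes>\<^bsub>B\<^esub> f (r \<otimes> r') = (b \<otimes>\<^bsub>B\<^esub> f r) \<otimes>\<^bsub>B\<^esub> f r'"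
    using assms(1,2) by (simp add: ring_hom_mult[OF f] B.m_assoc)
  also have "\<dots> = f (\<tau> r) \<otimes>\<^bsub>B\<^esub> (b \<otimes>\<^bsub>B\<^esub> f r') \<oplus>\<^bsub>B\<^esub> f (\<delta> r) \<otimes>\<^bsub>B\<^esub> f r'"
    using assms by (simp add: skew_rel_def[of B f b r] B.l_distr B.m_assoc)
  also have "\<dots> = f (\<tau> (r \<otimes> r')) \<otimes>\<^bsub>B\<^esub> b \<oplus>\<^bsub>B\<^esub> f (\<delta> (r \<otimes> r'))"
    using assms
    by (simp add: skew_rel_def[of B f b r'] ring_hom_mult[OF tau_hom] delta_mult ring_hom_mult[OF f]
        ring_hom_add[OF f] B.r_distr B.m_assoc B.a_assoc)
  finally show ?thesis by (simp add: skew_rel_def)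
qed

text \<open>Apply the derivation rule to \<open>u\<^sup>-\<^sup>1 u = 1\<close>.\<close>

lemma delta_inv:
  assumes u: "u \<in> Units R"
  shows "\<delta> (inv u) = \<ominus> (\<tau> (inv u) \<otimes> \<delta> u \<otimes> inv u)"
proof -
  have uc [simp]: "u \<in> carrier R" "inv u \<in> carrier R" using u by auto
  have "\<tau> (inv u) \<otimes> \<delta> u \<oplus> \<delta> (inv u) \<otimes> u = \<zero>"
    using delta_mult[of "inv u" u] u by simp
  then have "(\<tau> (inv u) \<otimes> \<delta> u \<oplus> \<delta> (inv u) \<otimes> u) \<otimes> inv u = \<zero>" by simp
  then have "\<tau> (inv u) \<otimes> \<delta> u \<otimes> inv u \<oplus> \<delta> (inv u) = \<zero>"
    using u by (simp add: l_distr m_assoc)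
  then show ?thesis
    using minus_equality[of "\<delta> (inv u)" "\<tau> (inv u) \<otimes> \<delta> u \<otimes> inv u"] by (simp add: a_comm)
qed

text \<open>
  Multiply the relation for \<open>u\<close> by \<open>f(\<tau>(u\<^sup>-\<^sup>1))\<close> on the left and by \<open>f(u\<^sup>-\<^sup>1)\<close> on the right.
\<close>

lemma skew_rel_inv:
  assumes u: "u \<in> Units R" and rel: "skew_rel B f b u"
  shows "skew_rel B f b (inv u)"
proof -
  have uc [simp]: "u \<in> carrier R" "inv u \<in> carrier R" using u by auto
  have fu: "f u \<otimes>\<^bsub>B\<^esub> f (inv u) = \<one>\<^bsub>B\<^esub>"
    using ring_hom_mult[OF f, of u "inv u"] ring_hom_one[OF f] u by simp
  have "\<tau> (inv u) \<otimes> \<tau> u = \<one>"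
    using ring_hom_mult[OF tau_hom, of "inv u" u] u by simp
  then have tu: "f (\<tau> (inv u)) \<otimes>\<^bsub>B\<^esub> f (\<tau> u) = \<one>\<^bsub>B\<^esub>"
    using ring_hom_mult[OF f, of "\<tau> (inv u)" "\<tau> u"] ring_hom_one[OF f] by simp
  define t where "t = f (\<tau> (inv u)) \<otimes>\<^bsub>B\<^esub> f (\<delta> u) \<otimes>\<^bsub>B\<^esub> f (inv u)"
  have t [simp]: "t \<in> carrier B" by (simp add: t_def)
  have d: "f (\<delta> (inv u)) = \<ominus>\<^bsub>B\<^esub> t"
    using ring_hom_diff[OF ring_axioms B f zero_closed, of "\<tau> (inv u) \<otimes> \<delta> u \<otimes> inv u"]
      ring_hom_zero[OF f ring_axioms B]
    by (simp add: delta_inv[OF u] minus_eq B.minus_eq t_def ring_hom_mult[OF f])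
  have "f (\<tau> (inv u)) \<otimes>\<^bsub>B\<^esub> b = f (\<tau> (inv u)) \<otimes>\<^bsub>B\<^esub> (b \<otimes>\<^bsub>B\<^esub> (f u \<otimes>\<^bsub>B\<^esub> f (inv u)))"
    by (simp add: fu)
  also have "\<dots> = f (\<tau> (inv u)) \<otimes>\<^bsub>B\<^esub> ((b \<otimes>\<^bsub>B\<^esub> f u) \<otimes>\<^bsub>B\<^esub> f (inv u))"
    by (simp add: B.m_assoc)
  also have "\<dots> = f (\<tau> (inv u)) \<otimes>\<^bsub>B\<^esub> f (\<tau> u) \<otimes>\<^bsub>B\<^esub> (b \<otimes>\<^bsub>B\<^esub> f (inv u)) \<oplus>\<^bsub>B\<^esub> t"
    using rel by (simp add: skew_rel_def t_def B.l_distr B.r_distr B.m_assoc)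
  also have "\<dots> = b \<otimes>\<^bsub>B\<^esub> f (inv u) \<oplus>\<^bsub>B\<^esub> t"
    by (simp add: tu)
  finally show ?thesis
    by (simp add: skew_rel_def d B.a_assoc B.r_neg)
qed

end

end

text \<open>
  The quotient of an Ore extension by \<open>x\<^sup>2 - w\<close> with \<open>w\<close> in the coefficient ring; \<open>Q\<^sub>1\<close> and
  \<open>Q\<^sub>2\<close> are of this kind. Generators, relations and the universal property are what determines
  the pushout.
\<close>

locale ore_quad = ore R \<tau> \<delta> for R :: "('k, 'a) module" (structure) and \<tau> \<delta> +
  fixes w
  assumes w [simp]: "w \<in> carrier R"
begin

definition quad :: "nat \<Rightarrow> 'a" where
  "quad = ore_var R [^]\<^bsub>E\<^esub> (2::nat) \<ominus>\<^bsub>E\<^esub> ore_const R w"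

abbreviation "J \<equiv> Idl\<^bsub>E\<^esub> {quad}"
abbreviation "QQ \<equiv> alg_quot E J"
abbreviation "qincl r \<equiv> J +>\<^bsub>E\<^esub> ore_const R r"
abbreviation "qx \<equiv> J +>\<^bsub>E\<^esub> ore_var R"

sublocale E: ring E by (rule ring_ore)

lemma ore_const_closed [simp]: "r \<in> carrier R \<Longrightarrow> ore_const R r \<in> carrier E"
  by (rule ring_hom_closed[OF ore_const_hom])

lemma ore_var_sq: "ore_var R [^]\<^bsub>E\<^esub> (2::nat) = ore_var R \<otimes>\<^bsub>E\<^esub> ore_var R"
  using ore_var_closed by (simp add: numeral_2_eq_2)

lemma quad_closed: "quad \<in> carrier E"
  using ore_var_closed by (simp add: quad_def)

lemma ideal_J: "ideal J E"
  by (rule E.genideal_ideal) (simp add: quad_closed)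

lemma ring_QQ: "ring QQ"
  by (rule ring_alg_quot[OF ideal_J])

lemma coset_hom: "(+>\<^bsub>E\<^esub>) J \<in> ring_hom E QQ"
  using ideal.rcos_ring_hom[OF ideal_J] by simp

lemma qincl_hom: "qincl \<in> ring_hom R QQ"
  using ring_hom_trans[OF ore_const_hom coset_hom] by (simp add: comp_def)

lemma qx_closed: "qx \<in> carrier QQ"
  by (rule ring_hom_closed[OF coset_hom ore_var_closed])

lemma qx_rel:
  assumes "r \<in> carrier R"
  shows "qx \<otimes>\<^bsub>QQ\<^esub> qincl r = qincl (\<tau> r) \<otimes>\<^bsub>QQ\<^esub> qx \<oplus>\<^bsub>QQ\<^esub> qincl (\<delta> r)"
  using assms ore_var_closed
  by (simp flip: ring_hom_mult[OF coset_hom] ring_hom_add[OF coset_hom] add: ore_var_const)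

lemma qx_sq: "qx \<otimes>\<^bsub>QQ\<^esub> qx = qincl w"
proof -
  have "quad \<in> J" using E.genideal_self'[OF quad_closed] .
  then have "J +>\<^bsub>E\<^esub> (ore_var R \<otimes>\<^bsub>E\<^esub> ore_var R) = J +>\<^bsub>E\<^esub> ore_const R w"
    using ore_var_closed
    by (intro coset_eqI[OF ring_ore ideal_J]) (simp_all add: quad_def ore_var_sq)
  then show ?thesis by (simp add: ring_hom_mult[OF coset_hom ore_var_closed ore_var_closed])
qed

lemma QQ_induct:
  assumes "p \<in> carrier QQ"
    and "\<And>r. r \<in> carrier R \<Longrightarrow> X (qincl r)" "X qx"
    and "\<And>p q. p \<in> carrier QQ \<Longrightarrow> q \<in> carrier QQ \<Longrightarrow> X p \<Longrightarrow> X q \<Longrightarrow> X (p \<oplus>\<^bsub>QQ\<^esub> q)"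
    and "\<And>p q. p \<in> carrier QQ \<Longrightarrow> q \<in> carrier QQ \<Longrightarrow> X p \<Longrightarrow> X q \<Longrightarrow> X (p \<otimes>\<^bsub>QQ\<^esub> q)"
  shows "X p"
proof -
  have "X (J +>\<^bsub>E\<^esub> p)" if "p \<in> carrier E" for p
    using that
    by (rule ore_induct)
      (use assms(2-5) in \<open>simp_all add: ring_hom_mult[OF coset_hom] ring_hom_add[OF coset_hom]
        ring_hom_closed[OF coset_hom]\<close>)
  then show ?thesis using assms(1) by (auto simp: carrier_alg_quot)
qed

lemma QQ_lift:
  assumes B: "ring B" and f: "f \<in> ring_hom R B" and b: "b \<in> carrier B"
    and rel: "\<And>r. r \<in> carrier R \<Longrightarrow> skew_rel B f b r" and sq: "b \<otimes>\<^bsub>B\<^esub> b = f w"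
  shows "\<exists>h \<in> ring_hom QQ B. (\<forall>r \<in> carrier R. h (qincl r) = f r) \<and> h qx = b"
proof -
  interpret B: ring B by fact
  obtain h where h: "h \<in> ring_hom E B" "\<And>r. r \<in> carrier R \<Longrightarrow> h (ore_const R r) = f r" "h (ore_var R) = b"
    using ore_lift[OF B f b] rel by (auto simp: skew_rel_def)
  have "h quad = \<zero>\<^bsub>B\<^esub>"
    using ore_var_closed ring_hom_diff[OF ring_ore B h(1), of "ore_var R \<otimes>\<^bsub>E\<^esub> ore_var R" "ore_const R w"]
      ring_hom_closed[OF f] b sq
    by (simp add: quad_def ore_var_sq h ring_hom_mult[OF h(1)] B.minus_zero_iff)
  then have van: "h i = \<zero>\<^bsub>B\<^esub>" if "i \<in> J" for i
    using genideal_vanishing[OF ring_ore B h(1) _ _ that] quad_closed by auto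
  obtain k where "k \<in> ring_hom QQ B" "\<And>a. a \<in> carrier E \<Longrightarrow> k (J +>\<^bsub>E\<^esub> a) = h a"
    using quot_lift[OF ring_ore B ideal_J h(1) van] by auto
  then show ?thesis using h(2,3) ore_var_closed by (intro bexI[of _ k]) auto
qed

end


section \<open>The automorphisms and the divided difference of the quantum torus\<close>

lemma (in kalg) smult_Units:
  assumes "u \<in> Units A" "c \<noteq> 0" shows "c \<odot> u \<in> Units A"
proof -
  have "(c \<odot> u) \<otimes> (inverse c \<odot> inv u) = \<one>" "(inverse c \<odot> inv u) \<otimes> (c \<odot> u) = \<one>"
    using assms by (simp_all add: Units_closed smult_norm)
  moreover have "c \<odot> u \<in> carrier A" "inverse c \<odot> inv u \<in> carrier A"
    using assms(1) by (simp_all add: Units_closed)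
  ultimately show ?thesis unfolding Units_def by blast
qed

text \<open>
  An abstract setting for operators \<open>\<delta>(r) = D\<^sup>-\<^sup>1 p (r - \<tau>(r))\<close>. The relation \<open>quot r d\<close>, to be read
  as \<open>d = \<delta>(r)\<close>, is compatible with sums, products and inverses in the way a \<open>\<tau>\<close>-derivation is;
  for this \<open>D\<close> and \<open>p\<close> must induce the same skew commutation.
\<close>

locale divided_difference = ring R for R (structure) +
  fixes \<tau> \<sigma> :: "'a \<Rightarrow> 'a" and D p
  assumes tau_hom: "\<tau> \<in> ring_hom R R"
    and sigma_closed [simp]: "r \<in> carrier R \<Longrightarrow> \<sigma> r \<in> carrier R"
    and D_closed [simp]: "D \<in> carrier R" and p_closed [simp]: "p \<in> carrier R"
    and D_skew: "r \<in> carrier R \<Longrightarrow> D \<otimes> r = \<sigma> r \<otimes> D"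
    and p_skew: "r \<in> carrier R \<Longrightarrow> p \<otimes> r = \<sigma> r \<otimes> p"
begin

definition quot :: "'a \<Rightarrow> 'a \<Rightarrow> bool" where
  "quot r d \<longleftrightarrow> d \<in> carrier R \<and> D \<otimes> d = p \<otimes> (r \<ominus> \<tau> r)"

lemma tau_closed [simp]: "r \<in> carrier R \<Longrightarrow> \<tau> r \<in> carrier R"
  by (rule ring_hom_closed[OF tau_hom])

lemma quot_add:
  assumes a: "a \<in> carrier R" "quot a d" and b: "b \<in> carrier R" "quot b e"
  shows "quot (a \<oplus> b) (d \<oplus> e)"
proof -
  have "(a \<ominus> \<tau> a) \<oplus> (b \<ominus> \<tau> b) = (a \<oplus> b) \<ominus> \<tau> (a \<oplus> b)"
    using a(1) b(1) by (simp add: ring_hom_add[OF tau_hom] minus_eq minus_add a_ac)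
  moreover have "D \<otimes> (d \<oplus> e) = p \<otimes> ((a \<ominus> \<tau> a) \<oplus> (b \<ominus> \<tau> b))"
    using a b by (simp add: quot_def r_distr)
  ultimately show ?thesis using a b by (simp add: quot_def)
qed

text \<open>
  Both \<open>D\<close> and \<open>p\<close> pick up the same \<open>\<sigma>(r)\<close>, so \<open>r\<close> can be moved from one side of
  the equation to the other.
\<close>

lemma skew_move:
  assumes "r \<in> carrier R" "d \<in> carrier R" "v \<in> carrier R" "D \<otimes> d = p \<otimes> v"
  shows "D \<otimes> (r \<otimes> d) = p \<otimes> (r \<otimes> v)"
proof -
  have "D \<otimes> (r \<otimes> d) = \<sigma> r \<otimes> (D \<otimes> d)"
    using assms(1,2) D_skew[OF assms(1)] by (simp flip: m_assoc)
  also have "\<dots> = p \<otimes> (r \<otimes> v)"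
    using assms(1,3) p_skew[OF assms(1)] by (simp add: assms(4) m_assoc[symmetric])
  finally show ?thesis .
qed

text \<open>
  Here \<open>a b - \<tau>(a) \<tau>(b) = \<tau>(a) (b - \<tau>(b)) + (a - \<tau>(a)) b\<close>.
\<close>

lemma quot_mult:
  assumes a: "a \<in> carrier R" "quot a d" and b: "b \<in> carrier R" "quot b e"
  shows "quot (a \<otimes> b) (\<tau> a \<otimes> e \<oplus> d \<otimes> b)"
proof -
  have d: "d \<in> carrier R" "D \<otimes> d = p \<otimes> (a \<ominus> \<tau> a)" and e: "e \<in> carrier R" "D \<otimes> e = p \<otimes> (b \<ominus> \<tau> b)"
    using a b by (auto simp: quot_def)
  note [simp] = a(1) b(1) d(1) e(1)
  have "D \<otimes> (d \<otimes> b) = p \<otimes> ((a \<ominus> \<tau> a) \<otimes> b)"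
    using d(2) by (simp flip: m_assoc)
  moreover have "D \<otimes> (\<tau> a \<otimes> e) = p \<otimes> (\<tau> a \<otimes> (b \<ominus> \<tau> b))"
    by (rule skew_move) (simp_all add: e(2))
  moreover have "\<tau> a \<otimes> (b \<ominus> \<tau> b) \<oplus> (a \<ominus> \<tau> a) \<otimes> b = a \<otimes> b \<ominus> \<tau> (a \<otimes> b)"
    by (simp add: ring_hom_mult[OF tau_hom] minus_eq r_distr l_distr r_minus l_minus a_ac r_neg r_neg1 r_neg2)
  ultimately show ?thesis
    by (simp add: quot_def r_distr flip: r_distr[of _ _ p])
qed

text \<open>
  The formula for the derivation of an inverse, with
  \<open>u\<^sup>-\<^sup>1 - \<tau>(u\<^sup>-\<^sup>1) = - \<tau>(u\<^sup>-\<^sup>1) (u - \<tau>(u)) u\<^sup>-\<^sup>1\<close>.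
\<close>

lemma quot_inv:
  assumes u: "u \<in> Units R" "quot u d"
  shows "quot (inv u) (\<ominus> (\<tau> (inv u) \<otimes> (d \<otimes> inv u)))"
proof -
  have d: "d \<in> carrier R" "D \<otimes> d = p \<otimes> (u \<ominus> \<tau> u)" using u by (auto simp: quot_def)
  define v where "v = inv u"
  have c [simp]: "u \<in> carrier R" "v \<in> carrier R" "d \<in> carrier R"
    using u d by (auto simp: v_def)
  have uv: "u \<otimes> v = \<one>" "\<tau> v \<otimes> \<tau> u = \<one>"
    using u ring_hom_mult[OF tau_hom c(2) c(1)] ring_hom_one[OF tau_hom] by (simp_all add: v_def)
  have "D \<otimes> (d \<otimes> v) = p \<otimes> ((u \<ominus> \<tau> u) \<otimes> v)"
    using d(2) by (simp flip: m_assoc)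
  then have "D \<otimes> (\<tau> v \<otimes> (d \<otimes> v)) = p \<otimes> (\<tau> v \<otimes> ((u \<ominus> \<tau> u) \<otimes> v))"
    by (intro skew_move) simp_all
  also have "\<tau> v \<otimes> ((u \<ominus> \<tau> u) \<otimes> v) = \<tau> v \<otimes> (u \<otimes> v) \<ominus> (\<tau> v \<otimes> \<tau> u) \<otimes> v"
    by (simp add: minus_eq r_distr l_distr r_minus l_minus m_assoc)
  also have "\<dots> = \<tau> v \<ominus> v" by (simp add: uv)
  finally have "D \<otimes> (\<ominus> (\<tau> v \<otimes> (d \<otimes> v))) = p \<otimes> (\<ominus> (\<tau> v \<ominus> v))"
    by (simp add: r_minus)
  moreover have "\<ominus> (\<tau> v \<ominus> v) = v \<ominus> \<tau> v" by (simp add: minus_eq minus_add a_comm)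
  ultimately show ?thesis by (simp add: quot_def v_def[symmetric])
qed

end

context torus
begin

lemma torus_end:
  assumes u: "u1 \<in> Units R" "u2 \<in> Units R" "u3 \<in> Units R"
    and rel: "u2 \<otimes>\<^bsub>R\<^esub> u1 = u1 \<otimes>\<^bsub>R\<^esub> u2"
      "u3 \<otimes>\<^bsub>R\<^esub> u1 = q \<odot>\<^bsub>R\<^esub> (u1 \<otimes>\<^bsub>R\<^esub> u3)" "u3 \<otimes>\<^bsub>R\<^esub> u2 = q \<odot>\<^bsub>R\<^esub> (u2 \<otimes>\<^bsub>R\<^esub> u3)"
  shows "\<exists>h \<in> ring_hom R R. (\<forall>c. h (sc c) = sc c) \<and> h z1 = u1 \<and> h z2 = u2 \<and> h z3 = u3"
  by (rule torus_lift[OF ring_axioms scalar_map_smult u])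
    (use u q_nz in \<open>simp_all add: Units_closed smult_norm rel\<close>)

lemma torus_hom_smult:
  assumes "h \<in> ring_hom R R" "\<And>c. h (sc c) = sc c" "a \<in> carrier R"
  shows "h (c \<odot>\<^bsub>R\<^esub> a) = c \<odot>\<^bsub>R\<^esub> h a"
  using ring_hom_mult[OF assms(1), of "sc c" a] ring_hom_closed[OF assms(1,3)] assms(2,3)
  by (simp add: smult_one_mult)

text \<open>
  Homomorphisms out of the torus agree once they agree on scalars and generators. This gives
  both that \<open>h\<close> is bijective, with inverse \<open>h'\<close>, and that \<open>h\<close> restricted to the carrier is the only
  candidate for the description defining \<^const>\<open>torus_aut\<close>.
\<close>

lemma torus_aut_eq:
  assumes h: "h \<in> ring_hom R R" "\<And>c. h (sc c) = sc c"
    and h': "h' \<in> ring_hom R R" "\<And>c. h' (sc c) = sc c"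
    and inv: "\<And>g. h' (h (zgen q g)) = zgen q g" "\<And>g. h (h' (zgen q g)) = zgen q g"
    and a: "a \<in> carrier R"
  shows "torus_aut q (h z1) (h z2) (h z3) a = h a"
proof -
  have id1: "h' (h a) = a" if "a \<in> carrier R" for a
    using torus_hom_unique[OF ring_axioms ring_hom_trans[OF h(1) h'(1)] id_ring_hom _ _ _ _ that]
    by (simp add: h h' inv)
  have id2: "h (h' a) = a" if "a \<in> carrier R" for a
    using torus_hom_unique[OF ring_axioms ring_hom_trans[OF h'(1) h(1)] id_ring_hom _ _ _ _ that]
    by (simp add: h h' inv)
  have bij: "bij_betw h (carrier R) (carrier R)"
    by (rule bij_betw_byWitness[of _ h']) (auto simp: id1 id2 ring_hom_closed[OF h(1)] ring_hom_closed[OF h'(1)])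
  let ?r = "restrict h (carrier R)"
  have r: "?r \<in> ring_hom R R" by (rule ring_hom_restrict[OF h(1)]) simp
  have iso: "?r \<in> alg_iso R R"
    using r bij torus_hom_smult[OF h]
    by (simp add: alg_iso_def ring_iso_def bij_betw_cong[of "carrier R" ?r h])
  have "torus_aut q (h z1) (h z2) (h z3) = ?r"
    unfolding torus_aut_def
  proof (rule the_equality)
    fix k assume k: "k \<in> alg_iso R R \<and> k \<in> extensional (carrier R) \<and> k z1 = h z1 \<and> k z2 = h z2 \<and> k z3 = h z3"
    then have kh: "k \<in> ring_hom R R" and ks: "k (sc c) = sc c" for c
      using ring_hom_one[of k R R] by (auto simp: alg_iso_def ring_iso_def)
    have "k a = h a" if "a \<in> carrier R" for a
      using torus_hom_unique[OF ring_axioms kh h(1) _ _ _ _ that] k ks h(2) by simp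
    then show "k = ?r" using k by (intro extensionalityI[of _ "carrier R"]) auto
  qed (use iso in auto)
  then show ?thesis using a by simp
qed

lemma tau1_props:
  "tau1 q \<in> ring_hom R R" "tau1 q (sc c) = sc c"
  "tau1 q z1 = z2" "tau1 q z2 = z1" "tau1 q z3 = z3"
proof -
  obtain h where h: "h \<in> ring_hom R R" "\<And>c. h (sc c) = sc c"
    "h z1 = z2" "h z2 = z1" "h z3 = z3"
    using torus_end[of z2 z1 z3] by (auto simp: z_rel12 z_rel13 z_rel23)
  have inv: "h (h (zgen q g)) = zgen q g" for g by (cases g) (simp_all add: h)
  have eq: "tau1 q a = h a" if "a \<in> carrier R" for a
    using torus_aut_eq[OF h(1,2) h(1,2) inv inv that] by (simp add: tau1_def h)
  show "tau1 q \<in> ring_hom R R" by (rule ring_hom_restrict[OF h(1)]) (simp add: eq)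
  show "tau1 q (sc c) = sc c" "tau1 q z1 = z2" "tau1 q z2 = z1" "tau1 q z3 = z3"
    by (simp_all add: eq h)
qed

lemma tau2_props:
  "tau2 q \<in> ring_hom R R" "tau2 q (sc c) = sc c"
  "tau2 q z1 = z2" "tau2 q z2 = inverse q \<odot>\<^bsub>R\<^esub> z1" "tau2 q z3 = z3"
proof -
  obtain h where h: "h \<in> ring_hom R R" "\<And>c. h (sc c) = sc c"
    "h z1 = z2" "h z2 = inverse q \<odot>\<^bsub>R\<^esub> z1" "h z3 = z3"
    using torus_end[of z2 "inverse q \<odot>\<^bsub>R\<^esub> z1" z3] q_nz
    by (auto simp: z_rel12 z_rel13 z_rel23 smult_Units smult_norm)
  obtain h' where h': "h' \<in> ring_hom R R" "\<And>c. h' (sc c) = sc c"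
    "h' z1 = q \<odot>\<^bsub>R\<^esub> z2" "h' z2 = z1" "h' z3 = z3"
    using torus_end[of "q \<odot>\<^bsub>R\<^esub> z2" z1 z3] q_nz
    by (auto simp: z_rel12 z_rel13 z_rel23 smult_Units smult_norm)
  have inv: "h' (h (zgen q g)) = zgen q g" "h (h' (zgen q g)) = zgen q g" for g
    using q_nz by (cases g; simp add: h h' torus_hom_smult[OF h(1,2)] torus_hom_smult[OF h'(1,2)] smult_smult)+
  have eq: "tau2 q a = h a" if "a \<in> carrier R" for a
    using torus_aut_eq[OF h(1,2) h'(1,2) inv that] by (simp add: tau2_def h)
  show "tau2 q \<in> ring_hom R R" by (rule ring_hom_restrict[OF h(1)]) (simp add: eq)
  show "tau2 q (sc c) = sc c" "tau2 q z1 = z2" "tau2 q z2 = inverse q \<odot>\<^bsub>R\<^esub> z1" "tau2 q z3 = z3"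
    by (simp_all add: eq h)
qed

lemma torus_skew_rel:
  assumes ore: "ore R \<tau> \<delta>" and B: "ring B" and f: "f \<in> ring_hom R B" and b: "b \<in> carrier B"
    and "\<And>c. ore.skew_rel \<tau> \<delta> B f b (sc c)"
      "ore.skew_rel \<tau> \<delta> B f b z1" "ore.skew_rel \<tau> \<delta> B f b z2" "ore.skew_rel \<tau> \<delta> B f b z3"
    and "r \<in> carrier R"
  shows "ore.skew_rel \<tau> \<delta> B f b r"
  using assms(9)
  by (rule torus_induct)
    (use assms(5-8) ore.skew_rel_add[OF ore B f b] ore.skew_rel_mult[OF ore B f b]
      ore.skew_rel_inv[OF ore B f b] in blast)+

lemma ore_zero: "\<tau> \<in> ring_hom R R \<Longrightarrow> ore R \<tau> (\<lambda>_. \<zero>\<^bsub>R\<^esub>)"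
  by unfold_locales (auto simp: ring_hom_closed)

abbreviation "zdiff \<equiv> z1 \<ominus>\<^bsub>R\<^esub> z2"
abbreviation "zsum \<equiv> z1 \<oplus>\<^bsub>R\<^esub> z2"

lemma zdiff_cancel:
  assumes "a \<in> carrier R" "b \<in> carrier R" "zdiff \<otimes>\<^bsub>R\<^esub> a = zdiff \<otimes>\<^bsub>R\<^esub> b"
  shows "a = b"
proof -
  have "zdiff \<otimes>\<^bsub>R\<^esub> (a \<ominus>\<^bsub>R\<^esub> b) = \<zero>\<^bsub>R\<^esub>"
    using assms by (simp add: minus_eq[of a b] r_distr r_minus r_neg)
  from z1_minus_z2_regular[OF _ this] have "a \<ominus>\<^bsub>R\<^esub> b = \<zero>\<^bsub>R\<^esub>" using assms(1,2) by simp
  then show ?thesis using assms(1,2) by (simp add: minus_zero_iff)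
qed

text \<open>
  Conjugation by \<open>z\<^sub>1\<close> fixes \<open>z\<^sub>1\<close> and \<open>z\<^sub>2\<close> and rescales \<open>z\<^sub>3\<close>, so \<open>z\<^sub>1 - z\<^sub>2\<close> and all scalar
  multiples of \<open>z\<^sub>1 + z\<^sub>2\<close>, although not central, move past ring elements at the cost of one and the same
  automorphism \<open>\<sigma>\<close>.
\<close>

lemma skew_commuting:
  obtains \<sigma> where "\<sigma> \<in> ring_hom R R" "\<And>r. r \<in> carrier R \<Longrightarrow> zdiff \<otimes>\<^bsub>R\<^esub> r = \<sigma> r \<otimes>\<^bsub>R\<^esub> zdiff"
    "\<And>c r. r \<in> carrier R \<Longrightarrow> (c \<odot>\<^bsub>R\<^esub> zsum) \<otimes>\<^bsub>R\<^esub> r = \<sigma> r \<otimes>\<^bsub>R\<^esub> (c \<odot>\<^bsub>R\<^esub> zsum)"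
proof -
  obtain h where h: "h \<in> ring_hom R R" "\<And>c. h (sc c) = sc c"
    "h z1 = z1" "h z2 = z2" "h z3 = inverse q \<odot>\<^bsub>R\<^esub> z3"
    using torus_end[of z1 z2 "inverse q \<odot>\<^bsub>R\<^esub> z3"] q_nz
    by (auto simp: z_rel12 z_rel13 z_rel23 smult_Units smult_norm)
  note o = ore_zero[OF h(1)]
  have *: "b \<otimes>\<^bsub>R\<^esub> r = h r \<otimes>\<^bsub>R\<^esub> b"
    if b: "b \<in> carrier R" "b \<otimes>\<^bsub>R\<^esub> z1 = z1 \<otimes>\<^bsub>R\<^esub> b" "b \<otimes>\<^bsub>R\<^esub> z2 = z2 \<otimes>\<^bsub>R\<^esub> b"
      "z3 \<otimes>\<^bsub>R\<^esub> b = q \<odot>\<^bsub>R\<^esub> (b \<otimes>\<^bsub>R\<^esub> z3)" and r: "r \<in> carrier R" for b r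
  proof -
    have "ore.skew_rel h (\<lambda>_. \<zero>\<^bsub>R\<^esub>) R id b r"
      by (rule torus_skew_rel[OF o ring_axioms id_ring_hom b(1) _ _ _ _ r])
        (use b q_nz in \<open>simp_all add: ore.skew_rel_def[OF o] h smult_norm\<close>)
    then show ?thesis
      using b r ring_hom_closed[OF h(1) r] by (simp add: ore.skew_rel_def[OF o])
  qed
  show thesis
  proof (rule that[OF h(1)])
    show "zdiff \<otimes>\<^bsub>R\<^esub> r = h r \<otimes>\<^bsub>R\<^esub> zdiff" if "r \<in> carrier R" for r
      by (rule *[OF _ _ _ _ that])
        (simp_all add: minus_eq l_distr r_distr l_minus r_minus z_rel12 z_rel13 z_rel23
          smult_add_right smult_uminus)
    show "(c \<odot>\<^bsub>R\<^esub> zsum) \<otimes>\<^bsub>R\<^esub> r = h r \<otimes>\<^bsub>R\<^esub> (c \<odot>\<^bsub>R\<^esub> zsum)" if "r \<in> carrier R" for c r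
      by (rule *[OF _ _ _ _ that])
        (simp_all add: l_distr r_distr smult_norm z_rel12 z_rel13 z_rel23 smult_add_right mult.commute)
  qed
qed

definition scaled_sum :: "'k \<Rightarrow> 'k qt" where
  "scaled_sum s = (- alpha s) \<odot>\<^bsub>R\<^esub> zsum"

lemma scaled_sum_closed [simp]: "scaled_sum s \<in> carrier R"
  by (simp add: scaled_sum_def)

lemma scaled_sum_commute: "scaled_sum s \<otimes>\<^bsub>R\<^esub> zdiff = zdiff \<otimes>\<^bsub>R\<^esub> scaled_sum s"
proof -
  have "zsum \<otimes>\<^bsub>R\<^esub> zdiff = zdiff \<otimes>\<^bsub>R\<^esub> zsum"
    by (simp add: minus_eq r_distr l_distr r_minus l_minus z_rel12 minus_add a_ac)
  then show ?thesis by (simp add: scaled_sum_def smult_mult_left smult_mult_right)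
qed

lemma obtain_divided_difference:
  obtains \<sigma> where "divided_difference R (tau1 q) \<sigma> zdiff (scaled_sum s)"
proof -
  obtain \<sigma> where sg: "\<sigma> \<in> ring_hom R R" "\<And>r. r \<in> carrier R \<Longrightarrow> zdiff \<otimes>\<^bsub>R\<^esub> r = \<sigma> r \<otimes>\<^bsub>R\<^esub> zdiff"
    "\<And>r. r \<in> carrier R \<Longrightarrow> scaled_sum s \<otimes>\<^bsub>R\<^esub> r = \<sigma> r \<otimes>\<^bsub>R\<^esub> scaled_sum s"
    unfolding scaled_sum_def using skew_commuting by metis
  have "divided_difference_axioms R (tau1 q) \<sigma> zdiff (scaled_sum s)"
    by (rule divided_difference_axioms.intro[OF tau1_props(1) ring_hom_closed[OF sg(1)] _ _ sg(2,3)]) simp_all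
  then show thesis by (rule that[OF divided_difference.intro[OF ring_axioms]])
qed

abbreviation quot1 where
  "quot1 s \<equiv> divided_difference.quot R (tau1 q) zdiff (scaled_sum s)"

lemma quot1_def:
  "quot1 s r d \<longleftrightarrow> d \<in> carrier R \<and> zdiff \<otimes>\<^bsub>R\<^esub> d = scaled_sum s \<otimes>\<^bsub>R\<^esub> (r \<ominus>\<^bsub>R\<^esub> tau1 q r)"
proof -
  obtain \<sigma> where dd: "divided_difference R (tau1 q) \<sigma> zdiff (scaled_sum s)"
    by (rule obtain_divided_difference)
  show ?thesis by (rule divided_difference.quot_def[OF dd])
qed

text \<open>
  Uniqueness of the fraction is left cancellation of \<open>z\<^sub>1 - z\<^sub>2\<close>.
\<close>

lemma delta1_eqI:
  assumes r: "r \<in> carrier R" and d: "quot1 s r d"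
  shows "delta1 q s r = d"
  unfolding delta1_def Let_def
proof (rule the_equality)
  have c: "r \<ominus>\<^bsub>R\<^esub> tau1 q r \<in> carrier R" using r ring_hom_closed[OF tau1_props(1)] by simp
  then have e: "(- alpha s) \<odot>\<^bsub>R\<^esub> (zsum \<otimes>\<^bsub>R\<^esub> (r \<ominus>\<^bsub>R\<^esub> tau1 q r)) = scaled_sum s \<otimes>\<^bsub>R\<^esub> (r \<ominus>\<^bsub>R\<^esub> tau1 q r)"
    by (simp add: scaled_sum_def smult_mult_left)
  show "d \<in> carrier R \<and> zdiff \<otimes>\<^bsub>R\<^esub> d = (- alpha s) \<odot>\<^bsub>R\<^esub> (zsum \<otimes>\<^bsub>R\<^esub> (r \<ominus>\<^bsub>R\<^esub> tau1 q r))"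
    using d unfolding quot1_def e .
  fix d' assume "d' \<in> carrier R \<and> zdiff \<otimes>\<^bsub>R\<^esub> d' = (- alpha s) \<odot>\<^bsub>R\<^esub> (zsum \<otimes>\<^bsub>R\<^esub> (r \<ominus>\<^bsub>R\<^esub> tau1 q r))"
  then show "d' = d" using d zdiff_cancel unfolding quot1_def e by metis
qed

lemma quot1_scalar: "quot1 s (sc c) \<zero>\<^bsub>R\<^esub>"
  and quot1_z1: "quot1 s z1 (scaled_sum s)"
  and quot1_z2: "quot1 s z2 (\<ominus>\<^bsub>R\<^esub> scaled_sum s)"
  and quot1_z3: "quot1 s z3 \<zero>\<^bsub>R\<^esub>"
proof -
  note t = tau1_props
  show "quot1 s (sc c) \<zero>\<^bsub>R\<^esub>" "quot1 s z3 \<zero>\<^bsub>R\<^esub>"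
    unfolding quot1_def by (simp_all add: t minus_eq r_neg)
  show "quot1 s z1 (scaled_sum s)"
    unfolding quot1_def by (simp add: t scaled_sum_commute)
  have "z2 \<ominus>\<^bsub>R\<^esub> z1 = \<ominus>\<^bsub>R\<^esub> zdiff" by (simp add: minus_eq minus_add a_comm)
  then show "quot1 s z2 (\<ominus>\<^bsub>R\<^esub> scaled_sum s)"
    unfolding quot1_def by (simp add: t scaled_sum_commute r_minus)
qed

text \<open>
  Existence of the fraction: it is explicit on generators, and the elements that have one are
  closed under the ring operations and inverses.
\<close>

lemma quot1_delta1:
  assumes "r \<in> carrier R" shows "quot1 s r (delta1 q s r)"
proof -
  obtain \<sigma> where dd: "divided_difference R (tau1 q) \<sigma> zdiff (scaled_sum s)"
    by (rule obtain_divided_difference)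
  have "\<exists>d. quot1 s r d"
    using assms
    by (rule torus_induct)
      (use quot1_scalar quot1_z1 quot1_z2 quot1_z3 divided_difference.quot_inv[OF dd]
        divided_difference.quot_add[OF dd] divided_difference.quot_mult[OF dd] in blast)+
  then show ?thesis using delta1_eqI[OF assms] by auto
qed

text \<open>
  The derivation rules hold for the relation \<open>quot\<close>, hence by uniqueness for the function.
\<close>

lemma ore1: "ore R (tau1 q) (delta1 q s)"
proof
  obtain \<sigma> where dd: "divided_difference R (tau1 q) \<sigma> zdiff (scaled_sum s)"
    by (rule obtain_divided_difference)
  show "tau1 q \<in> ring_hom R R" by (rule tau1_props)
  fix a assume a: "a \<in> carrier R"
  show "delta1 q s a \<in> carrier R" using quot1_delta1[OF a] unfolding quot1_def by blast
  fix b assume b: "b \<in> carrier R"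
  show "delta1 q s (a \<oplus>\<^bsub>R\<^esub> b) = delta1 q s a \<oplus>\<^bsub>R\<^esub> delta1 q s b"
    using a b by (intro delta1_eqI divided_difference.quot_add[OF dd] quot1_delta1) auto
  show "delta1 q s (a \<otimes>\<^bsub>R\<^esub> b) = tau1 q a \<otimes>\<^bsub>R\<^esub> delta1 q s b \<oplus>\<^bsub>R\<^esub> delta1 q s a \<otimes>\<^bsub>R\<^esub> b"
    using a b by (intro delta1_eqI divided_difference.quot_mult[OF dd] quot1_delta1) auto
qed

lemma delta1_gens:
  "delta1 q s (sc c) = \<zero>\<^bsub>R\<^esub>"
  "delta1 q s z1 = (- alpha s) \<odot>\<^bsub>R\<^esub> zsum"
  "delta1 q s z2 = alpha s \<odot>\<^bsub>R\<^esub> zsum"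
  "delta1 q s z3 = \<zero>\<^bsub>R\<^esub>"
proof -
  show "delta1 q s (sc c) = \<zero>\<^bsub>R\<^esub>" "delta1 q s z3 = \<zero>\<^bsub>R\<^esub>"
    by (simp_all add: delta1_eqI quot1_scalar quot1_z3)
  show "delta1 q s z1 = (- alpha s) \<odot>\<^bsub>R\<^esub> zsum"
    by (simp add: delta1_eqI[OF _ quot1_z1] scaled_sum_def)
  show "delta1 q s z2 = alpha s \<odot>\<^bsub>R\<^esub> zsum"
    by (simp add: delta1_eqI[OF _ quot1_z2] scaled_sum_def uminus_smult)
qed

end

section \<open>Translating the relations\<close>

lemma (in monoid) Units_cancel_both:
  assumes "u \<in> Units G" "x \<in> carrier G"
  shows "x \<otimes> u \<otimes> inv u = x" "x \<otimes> inv u \<otimes> u = x"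
  using assms by (simp_all add: m_assoc Units_closed)

lemma (in monoid) Units_mult_right_cancel:
  assumes "u \<in> Units G" "x \<in> carrier G" "y \<in> carrier G" "x \<otimes> u = y \<otimes> u"
  shows "x = y"
  using assms by (metis Units_cancel_both(1))

lemma (in monoid) inv_mult_Units:
  assumes "u \<in> Units G" "v \<in> Units G"
  shows "inv (u \<otimes> v) = inv v \<otimes> inv u"
proof (rule inv_char)
  note [simp] = assms[THEN Units_closed]
  show "u \<otimes> v \<otimes> (inv v \<otimes> inv u) = \<one>"
    using assms by (simp add: m_assoc Units_cancel_inv_left)
  show "inv v \<otimes> inv u \<otimes> (u \<otimes> v) = \<one>"
    using assms by (simp add: m_assoc Units_inv_cancel_left)
qed (use assms in auto)

lemma (in kalg) smult_cancel:
  "a \<in> carrier A \<Longrightarrow> c \<odot> a \<oplus> (- c) \<odot> a = \<zero>" "a \<in> carrier A \<Longrightarrow> (- c) \<odot> a \<oplus> c \<odot> a = \<zero>"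
  by (simp_all flip: smult_add_left)

text \<open>
  Shifting \<open>T\<close> by \<open>\<alpha>\<close> completes the square in \<open>T\<^sup>2 = 2\<alpha> T + 1\<close>; the constant that remains is
  \<open>1 + \<alpha>\<^sup>2\<close>.
\<close>

lemma hecke_discriminant:
  assumes s: "s \<noteq> 0" and two: "(2::'k::field) \<noteq> 0"
  shows "((s + inverse s) / 2)\<^sup>2 = 1 + alpha s * alpha (s::'k)"
proof -
  have "(4::'k) = 2 * 2" by simp
  then have "(4::'k) \<noteq> 0" using two by (metis mult_eq_0_iff)
  then show ?thesis using s two by (simp add: alpha_def power2_eq_square field_simps)
qed

lemma alpha_double:
  assumes two: "(2::'k::field) \<noteq> 0"
  shows "alpha s + alpha s = s - inverse (s::'k)"
  using two by (simp add: alpha_def flip: add_divide_distrib mult_2)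

text \<open>
  Elements of an algebra that satisfy the relations of the double affine Hecke algebra,
  apart from those that move \<open>X\<^sub>1 X\<^sub>2\<close> past \<open>Y\<^sub>1\<close> and \<open>Y\<^sub>2\<close>. From them \<open>x = T - \<alpha>\<close> and \<open>y = Y\<^sub>1\<^sup>-\<^sup>1 T\<close> are shown to satisfy the relations of \<open>Q\<^sub>1\<close> and \<open>Q\<^sub>2\<close>.
\<close>

locale daha_elements = kalg A for A :: "('k::field, 'a) module" (structure) +
  fixes q s :: 'k and t x1 x2 y1 y2
  assumes q: "q \<noteq> 0" and s: "s \<noteq> 0" and two: "(2::'k) \<noteq> 0"
    and units: "t \<in> Units A" "x1 \<in> Units A" "x2 \<in> Units A" "y1 \<in> Units A" "y2 \<in> Units A"
    and xx: "x1 \<otimes> x2 = x2 \<otimes> x1" and yy: "y1 \<otimes> y2 = y2 \<otimes> y1"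
    and hecke: "(t \<ominus> s \<odot> \<one>) \<otimes> (t \<oplus> inverse s \<odot> \<one>) = \<zero>"
    and cross: "inv y2 \<otimes> x1 \<otimes> y2 \<otimes> inv x1 = t \<otimes> t"
    and ty: "inv t \<otimes> y1 \<otimes> inv t = y2" and tx: "t \<otimes> x1 \<otimes> t = x2"
    and y1y2: "y1 \<otimes> y2 \<otimes> x1 = q \<odot> (x1 \<otimes> y1 \<otimes> y2)" "y1 \<otimes> y2 \<otimes> x2 = q \<odot> (x2 \<otimes> y1 \<otimes> y2)"
begin

lemma closed [simp]: "t \<in> carrier A" "x1 \<in> carrier A" "x2 \<in> carrier A" "y1 \<in> carrier A" "y2 \<in> carrier A"
  "inv t \<in> carrier A" "inv x1 \<in> carrier A" "inv x2 \<in> carrier A" "inv y1 \<in> carrier A" "inv y2 \<in> carrier A"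
  using units by auto

definition "x = t \<oplus> (- alpha s) \<odot> \<one>"
definition "y = inv y1 \<otimes> t"

lemma x_closed [simp]: "x \<in> carrier A" by (simp add: x_def)

lemma y_Units: "y \<in> Units A"
  using units by (simp add: y_def)

lemma y_closed [simp]: "y \<in> carrier A" by (simp add: y_def)

lemma t_sq: "t \<otimes> t = (alpha s + alpha s) \<odot> t \<oplus> \<one>"
proof -
  define N where "N = (- (alpha s + alpha s)) \<odot> t \<oplus> (- 1) \<odot> \<one>"
  have N [simp]: "N \<in> carrier A" by (simp add: N_def)
  have "(t \<ominus> s \<odot> \<one>) = t \<oplus> (- s) \<odot> \<one>" by (simp add: minus_eq uminus_smult)
  then have "(t \<ominus> s \<odot> \<one>) \<otimes> (t \<oplus> inverse s \<odot> \<one>) =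
      t \<otimes> t \<oplus> ((inverse s \<odot> t \<oplus> (- s) \<odot> t) \<oplus> (- (s * inverse s)) \<odot> \<one>)"
    by (simp add: l_distr r_distr smult_norm smult_add_right a_ac mult.commute)
  also have "inverse s \<odot> t \<oplus> (- s) \<odot> t = (- (alpha s + alpha s)) \<odot> t"
    by (simp add: alpha_double[OF two] flip: smult_add_left)
  finally have z: "t \<otimes> t \<oplus> N = \<zero>"
    using hecke s by (simp add: N_def)
  have "(alpha s + alpha s) \<odot> t \<oplus> \<one> \<oplus> N =
      ((alpha s + alpha s) \<odot> t \<oplus> (- (alpha s + alpha s)) \<odot> t) \<oplus> (1 \<odot> \<one> \<oplus> (- 1) \<odot> \<one>)"
    by (simp add: N_def a_ac)
  also have "\<dots> = \<zero>" by (simp only: smult_cancel closed one_closed l_zero zero_closed)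
  finally have "t \<otimes> t \<oplus> N = (alpha s + alpha s) \<odot> t \<oplus> \<one> \<oplus> N" using z by simp
  then show ?thesis by simp
qed

text \<open>
  Read off from \<open>t\<^sup>2 = 2\<alpha> t + 1\<close>. In this form \<open>inv t\<close> differs from \<open>t\<close> by a scalar, which
  linearizes the relation \<open>t x\<^sub>1 t = x\<^sub>2\<close>.
\<close>

lemma t_inv: "inv t = t \<oplus> (- (alpha s + alpha s)) \<odot> \<one>"
proof -
  have c: "(alpha s + alpha s) \<odot> t \<oplus> \<one> \<oplus> (- (alpha s + alpha s)) \<odot> t = \<one>"
  proof -
    have "(alpha s + alpha s) \<odot> t \<oplus> \<one> \<oplus> (- (alpha s + alpha s)) \<odot> t =
        \<one> \<oplus> ((alpha s + alpha s) \<odot> t \<oplus> (- (alpha s + alpha s)) \<odot> t)"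
      by (simp add: a_ac)
    then show ?thesis by (simp only: smult_cancel closed one_closed r_zero)
  qed
  have e: "t \<otimes> (t \<oplus> (- (alpha s + alpha s)) \<odot> \<one>) = \<one>"
    by (simp only: r_distr closed smult_closed one_closed smult_mult_one t_sq c)
  have e': "(t \<oplus> (- (alpha s + alpha s)) \<odot> \<one>) \<otimes> t = \<one>"
    by (simp only: l_distr closed smult_closed one_closed smult_one_mult t_sq c)
  show ?thesis using inv_char[OF _ _ e e'] by simp
qed

lemma x_sq: "x \<otimes> x = (((s + inverse s) / 2)\<^sup>2) \<odot> \<one>"
proof -
  note sc = hecke_discriminant[OF s two]
  have "x \<otimes> x = t \<otimes> t \<oplus> ((- alpha s) \<odot> t \<oplus> ((- alpha s) \<odot> t \<oplus> (alpha s * alpha s) \<odot> \<one>))"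
    by (simp add: x_def l_distr r_distr smult_norm smult_add_right a_assoc)
  also have "\<dots> = t \<otimes> t \<oplus> ((- alpha s + - alpha s) \<odot> t \<oplus> (alpha s * alpha s) \<odot> \<one>)"
    by (simp only: smult_add_left[OF closed(1)] a_assoc smult_closed closed one_closed)
  also have "\<dots> = ((alpha s + alpha s) \<odot> t \<oplus> (- alpha s + - alpha s) \<odot> t) \<oplus> (\<one> \<oplus> (alpha s * alpha s) \<odot> \<one>)"
    by (simp add: t_sq a_ac del: add_uminus_conv_diff)
  also have "(alpha s + alpha s) \<odot> t \<oplus> (- alpha s + - alpha s) \<odot> t = \<zero>"
    by (simp flip: smult_add_left)
  also have "\<one> \<oplus> (alpha s * alpha s) \<odot> \<one> = (1 + alpha s * alpha s) \<odot> \<one>"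
    by (simp add: smult_add_left)
  finally show ?thesis by (simp add: sc)
qed

lemma t_x1: "t \<otimes> x1 = x2 \<otimes> inv t"
proof -
  have "t \<otimes> x1 = (t \<otimes> x1 \<otimes> t) \<otimes> inv t" using units by (simp add: Units_cancel_both)
  then show ?thesis by (simp add: tx)
qed

lemma t_inv_x2: "inv t \<otimes> x2 = x1 \<otimes> t"
  using units by (simp add: tx[symmetric] m_assoc Units_inv_cancel_left)

text \<open>
  The relation \<open>t x\<^sub>1 = x\<^sub>2 t\<^sup>-\<^sup>1\<close>, with \<open>t\<close> and \<open>t\<^sup>-\<^sup>1\<close> written through \<open>x\<close>.
\<close>

lemma x_x1: "x \<otimes> x1 = x2 \<otimes> x \<oplus> (- alpha s) \<odot> (x1 \<oplus> x2)"
proof -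
  have "x \<otimes> x1 = x2 \<otimes> t \<oplus> (- alpha s + - alpha s) \<odot> x2 \<oplus> (- alpha s) \<odot> x1"
    by (simp add: x_def l_distr t_x1 t_inv r_distr smult_norm smult_add_right)
  also have "\<dots> = x2 \<otimes> x \<oplus> (- alpha s) \<odot> (x1 \<oplus> x2)"
    by (simp only: smult_add_left[OF closed(3)]) (simp add: x_def r_distr smult_norm smult_add_right a_ac)
  finally show ?thesis .
qed

lemma x_x2: "x \<otimes> x2 = x1 \<otimes> x \<oplus> alpha s \<odot> (x1 \<oplus> x2)"
proof -
  have t2: "t = inv t \<oplus> (alpha s + alpha s) \<odot> \<one>"
    by (simp add: t_inv a_assoc flip: smult_add_left)
  have "x \<otimes> x2 = t \<otimes> x2 \<oplus> (- alpha s) \<odot> x2"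
    by (simp add: x_def l_distr smult_norm smult_add_right)
  also have "t \<otimes> x2 = x1 \<otimes> t \<oplus> (alpha s + alpha s) \<odot> x2"
    by (subst t2) (simp add: l_distr t_inv_x2 smult_norm smult_add_right)
  also have "x1 \<otimes> t \<oplus> (alpha s + alpha s) \<odot> x2 \<oplus> (- alpha s) \<odot> x2 = x1 \<otimes> t \<oplus> alpha s \<odot> x2"
    by (simp add: a_assoc flip: smult_add_left)
  also have "\<dots> = x1 \<otimes> t \<oplus> (- alpha s + alpha s) \<odot> x1 \<oplus> alpha s \<odot> x2" by simp
  also have "\<dots> = x1 \<otimes> x \<oplus> alpha s \<odot> (x1 \<oplus> x2)"
    by (simp only: smult_add_left[OF closed(2)]) (simp add: x_def r_distr smult_norm smult_add_right a_ac)
  finally show ?thesis .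
qed

lemma y1_eq: "y1 = t \<otimes> y2 \<otimes> t"
  using units by (simp add: ty[symmetric] m_assoc Units_cancel_inv_left)

text \<open>
  With \<open>y\<^sub>1 = t y\<^sub>2 t\<close> and \<open>y\<^sub>1 y\<^sub>2 = y\<^sub>2 y\<^sub>1\<close> both sides equal \<open>t y\<^sub>2 t y\<^sub>2 t\<close>.
\<close>

lemma t_yy: "t \<otimes> (y1 \<otimes> y2) = (y1 \<otimes> y2) \<otimes> t"
proof -
  have "t \<otimes> (y1 \<otimes> y2) = t \<otimes> (y2 \<otimes> y1)" by (simp add: yy)
  also have "\<dots> = t \<otimes> y2 \<otimes> t \<otimes> y2 \<otimes> t" by (simp add: y1_eq m_assoc)
  also have "\<dots> = y1 \<otimes> y2 \<otimes> t" by (simp flip: y1_eq)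
  finally show ?thesis .
qed

lemma x_yy: "x \<otimes> (y1 \<otimes> y2) = (y1 \<otimes> y2) \<otimes> x"
  by (simp add: x_def l_distr r_distr smult_norm smult_add_right t_yy[unfolded m_assoc] flip: t_yy)

text \<open>
  The second expression for \<open>y\<close>. Having \<open>y\<^sub>1\<close> in one and \<open>y\<^sub>2\<close> in the other yields
  \<open>y\<^sup>2 = (y\<^sub>1 y\<^sub>2)\<^sup>-\<^sup>1\<close>, and this second one fits the cross relation.
\<close>

lemma y_eq: "y = inv t \<otimes> inv y2"
proof (rule Units_mult_right_cancel[OF units(5)])
  have "y \<otimes> y2 = inv y1 \<otimes> (t \<otimes> y2 \<otimes> t) \<otimes> inv t"
    using units by (simp add: y_def m_assoc)
  also have "\<dots> = inv t" using units by (simp flip: y1_eq)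
  finally show "y \<otimes> y2 = inv t \<otimes> inv y2 \<otimes> y2" using units by (simp add: m_assoc)
qed auto

lemma y_sq: "y \<otimes> y = inv (y1 \<otimes> y2)"
proof -
  have "y \<otimes> y = inv y1 \<otimes> t \<otimes> (inv t \<otimes> inv y2)"
    using y_eq by (simp add: y_def[symmetric])
  also have "\<dots> = inv y1 \<otimes> inv y2" using units by (simp add: m_assoc Units_cancel_inv_left)
  also have "\<dots> = inv (y2 \<otimes> y1)" using units by (simp add: inv_mult_Units)
  finally show ?thesis by (simp add: yy)
qed

lemma y_x1: "y \<otimes> x1 = x2 \<otimes> y"
proof -
  have "inv y2 \<otimes> x1 \<otimes> y2 \<otimes> inv x1 \<otimes> x1 = t \<otimes> t \<otimes> x1" by (simp add: cross)
  then have c: "inv y2 \<otimes> x1 \<otimes> y2 = t \<otimes> t \<otimes> x1" using units by (simp add: Units_cancel_both)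
  have "inv y2 \<otimes> x1 = inv y2 \<otimes> x1 \<otimes> y2 \<otimes> inv y2" using units by (simp add: Units_cancel_both)
  also have "\<dots> = t \<otimes> t \<otimes> x1 \<otimes> inv y2" by (simp add: c)
  finally have "inv t \<otimes> (inv y2 \<otimes> x1) = t \<otimes> x1 \<otimes> inv y2"
    using units by (simp add: m_assoc Units_inv_cancel_left)
  then show ?thesis by (simp add: y_eq m_assoc t_x1)
qed

lemma yy_inv_x1: "inv (y1 \<otimes> y2) \<otimes> x1 = inverse q \<odot> (x1 \<otimes> inv (y1 \<otimes> y2))"
proof -
  let ?w = "y1 \<otimes> y2"
  have w: "?w \<in> Units A" using units by simp
  have wc: "?w \<in> carrier A" "inv ?w \<in> carrier A" using w by auto
  have "x1 \<otimes> inv ?w = inv ?w \<otimes> (?w \<otimes> x1) \<otimes> inv ?w"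
    using w wc by (simp add: Units_inv_cancel_left del: m_assoc)
  also have "?w \<otimes> x1 = q \<odot> (x1 \<otimes> ?w)" using y1y2(1) by (simp add: m_assoc)
  also have "inv ?w \<otimes> (q \<odot> (x1 \<otimes> ?w)) \<otimes> inv ?w = q \<odot> (inv ?w \<otimes> x1 \<otimes> (?w \<otimes> inv ?w))"
    using wc by (simp add: smult_norm smult_add_right)
  finally have "x1 \<otimes> inv ?w = q \<odot> (inv ?w \<otimes> x1)" using w wc by simp
  then show ?thesis using q wc by (simp add: smult_smult)
qed

text \<open>
  Multiplication by \<open>y\<close> on the right turns the left side into \<open>y\<^sup>2 x\<^sub>1\<close>, where \<open>y\<^sup>2 = (y\<^sub>1 y\<^sub>2)\<^sup>-\<^sup>1\<close>
  commutes with \<open>x\<^sub>1\<close> up to the factor \<open>q\<^sup>-\<^sup>1\<close>.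
\<close>

lemma y_x2: "y \<otimes> x2 = inverse q \<odot> (x1 \<otimes> y)"
proof (rule Units_mult_right_cancel[OF y_Units])
  have "y \<otimes> x2 \<otimes> y = y \<otimes> y \<otimes> x1" by (simp add: m_assoc y_x1)
  also have "\<dots> = inverse q \<odot> (x1 \<otimes> (y \<otimes> y))" by (simp add: y_sq yy_inv_x1)
  finally show "y \<otimes> x2 \<otimes> y = inverse q \<odot> (x1 \<otimes> y) \<otimes> y" by (simp add: smult_norm smult_add_right)
qed auto

lemma y_yy: "y \<otimes> (y1 \<otimes> y2) = (y1 \<otimes> y2) \<otimes> y"
proof -
  have w: "y1 \<otimes> y2 \<in> Units A" using units by simp
  have "y1 \<otimes> y2 = inv (y \<otimes> y)" using w by (simp add: y_sq)
  also have "\<dots> = inv y \<otimes> inv y" using y_Units by (simp add: inv_mult_Units)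
  finally show ?thesis
    using y_Units by (simp add: Units_cancel_inv_left m_assoc)
qed

end

text \<open>
  The converse translation: elements that satisfy the relations of \<open>R\<close>, \<open>Q\<^sub>1\<close> and \<open>Q\<^sub>2\<close> yield
  elements that satisfy those of the double affine Hecke algebra, namely \<open>T = x + \<alpha>\<close>,
  \<open>Y\<^sub>1 = T y\<^sup>-\<^sup>1\<close> and \<open>Y\<^sub>2 = y\<^sup>-\<^sup>1 T\<^sup>-\<^sup>1\<close>.
\<close>

locale amalg_elements = kalg A for A :: "('k::field, 'a) module" (structure) +
  fixes q s :: 'k and x y z1 z2 z3
  assumes q: "q \<noteq> 0" and s: "s \<noteq> 0" and two: "(2::'k) \<noteq> 0"
    and units: "z1 \<in> Units A" "z2 \<in> Units A" "z3 \<in> Units A"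
    and xc [simp]: "x \<in> carrier A" and yc [simp]: "y \<in> carrier A"
    and z12: "z2 \<otimes> z1 = z1 \<otimes> z2" and z13: "z3 \<otimes> z1 = q \<odot> (z1 \<otimes> z3)" and z23: "z3 \<otimes> z2 = q \<odot> (z2 \<otimes> z3)"
    and xz1: "x \<otimes> z1 = z2 \<otimes> x \<oplus> (- alpha s) \<odot> (z1 \<oplus> z2)"
    and xz3: "x \<otimes> z3 = z3 \<otimes> x"
    and xsq: "x \<otimes> x = (((s + inverse s) / 2)\<^sup>2) \<odot> \<one>"
    and yz1: "y \<otimes> z1 = z2 \<otimes> y" and yz2: "y \<otimes> z2 = inverse q \<odot> (z1 \<otimes> y)" and yz3: "y \<otimes> z3 = z3 \<otimes> y"
    and ysq: "y \<otimes> y = inv z3"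
begin

lemma closed [simp]: "z1 \<in> carrier A" "z2 \<in> carrier A" "z3 \<in> carrier A"
  "inv z1 \<in> carrier A" "inv z2 \<in> carrier A" "inv z3 \<in> carrier A"
  using units by auto

text \<open>
  The element \<open>ti\<close> turns out to be the inverse of \<open>t\<close>, and \<open>yi\<close> the inverse of \<open>y\<close>.
\<close>

definition "t = x \<oplus> alpha s \<odot> \<one>"
definition "ti = x \<oplus> (- alpha s) \<odot> \<one>"
definition "yi = y \<otimes> z3"

lemma t_closed [simp]: "t \<in> carrier A" "ti \<in> carrier A" "yi \<in> carrier A"
  by (simp_all add: t_def ti_def yi_def)

lemma t_ti: "t \<otimes> ti = \<one>" "ti \<otimes> t = \<one>"
proof -
  have x2: "x \<otimes> x = \<one> \<oplus> (alpha s * alpha s) \<odot> \<one>"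
    by (simp add: xsq hecke_discriminant[OF s two] smult_add_left)
  have "t \<otimes> ti = x \<otimes> x \<oplus> ((- alpha s) \<odot> x \<oplus> alpha s \<odot> x) \<oplus> (- (alpha s * alpha s)) \<odot> \<one>"
    by (simp add: t_def ti_def l_distr r_distr smult_norm smult_add_right a_ac)
  then show "t \<otimes> ti = \<one>" by (simp add: smult_cancel x2 a_assoc flip: smult_add_left)
  have "ti \<otimes> t = x \<otimes> x \<oplus> ((- alpha s) \<odot> x \<oplus> alpha s \<odot> x) \<oplus> (- (alpha s * alpha s)) \<odot> \<one>"
    by (simp add: t_def ti_def l_distr r_distr smult_norm smult_add_right a_ac)
  then show "ti \<otimes> t = \<one>" by (simp add: smult_cancel x2 a_assoc flip: smult_add_left)
qed

lemma y_yi: "y \<otimes> yi = \<one>" "yi \<otimes> y = \<one>"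
proof -
  show "y \<otimes> yi = \<one>" using units by (simp add: yi_def ysq flip: m_assoc)
  have "yi \<otimes> y = z3 \<otimes> (y \<otimes> y)" by (simp add: yi_def yz3 m_assoc)
  then show "yi \<otimes> y = \<one>" using units by (simp add: ysq)
qed

lemma t_Units: "t \<in> Units A" "inv t = ti" "ti \<in> Units A" "inv ti = t"
  using t_ti inv_char[of t ti] inv_char[of ti t] unfolding Units_def by auto

lemma y_Units: "y \<in> Units A" "inv y = yi" "yi \<in> Units A" "inv yi = y"
  using y_yi inv_char[of y yi] inv_char[of yi y] unfolding Units_def by auto

lemma yi_yi: "yi \<otimes> yi = z3"
proof -
  have "yi \<otimes> yi = (z3 \<otimes> y) \<otimes> (y \<otimes> z3)" by (simp add: yi_def yz3)
  also have "\<dots> = z3 \<otimes> (y \<otimes> y) \<otimes> z3" by (simp add: m_assoc)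
  finally show ?thesis using units by (simp add: ysq)
qed

lemma hecke: "(t \<ominus> s \<odot> \<one>) \<otimes> (t \<oplus> inverse s \<odot> \<one>) = \<zero>"
proof -
  note al = alpha_double[OF two, of s]
  have tm: "t = ti \<oplus> (s - inverse s) \<odot> \<one>"
    by (simp add: t_def ti_def a_assoc flip: al smult_add_left)
  have "t \<ominus> s \<odot> \<one> = ti \<oplus> (- inverse s) \<odot> \<one>"
    by (subst tm) (simp add: minus_eq a_assoc flip: uminus_smult smult_add_left)
  then have "(t \<ominus> s \<odot> \<one>) \<otimes> (t \<oplus> inverse s \<odot> \<one>) =
      ti \<otimes> t \<oplus> (inverse s \<odot> ti \<oplus> ((- inverse s) \<odot> t \<oplus> (- (inverse s * inverse s)) \<odot> \<one>))"
    by (simp add: l_distr r_distr smult_norm smult_add_right a_ac)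
  also have "(- inverse s) \<odot> t = (- inverse s) \<odot> ti \<oplus> (- inverse s * (s - inverse s)) \<odot> \<one>"
    by (subst tm) (simp add: smult_add_right smult_smult)
  also have "- inverse s * (s - inverse s) = - 1 + inverse s * inverse s"
    using s by (simp add: field_simps)
  also have "ti \<otimes> t \<oplus> (inverse s \<odot> ti \<oplus> ((- inverse s) \<odot> ti \<oplus> (- 1 + inverse s * inverse s) \<odot> \<one> \<oplus>
      (- (inverse s * inverse s)) \<odot> \<one>)) =
      (inverse s \<odot> ti \<oplus> (- inverse s) \<odot> ti) \<oplus> (1 \<odot> \<one> \<oplus> ((- 1 + inverse s * inverse s) \<odot> \<one> \<oplus> (- (inverse s * inverse s)) \<odot> \<one>))"
    by (simp add: t_ti a_ac)
  also have "\<dots> = \<zero>"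
    by (simp only: smult_add_left[symmetric] t_closed one_closed) simp
  finally show ?thesis .
qed

text \<open>
  The symmetrizing terms of \<open>x z\<^sub>1\<close> are exactly absorbed by the shift from \<open>x\<close> to \<open>t\<close> and \<open>ti\<close>.
\<close>

lemma t_z1: "t \<otimes> z1 = z2 \<otimes> ti"
proof -
  have "t \<otimes> z1 = z2 \<otimes> x \<oplus> (- alpha s) \<odot> z2 \<oplus> (alpha s \<odot> z1 \<oplus> (- alpha s) \<odot> z1)"
    by (simp add: t_def l_distr xz1 smult_norm smult_add_right a_ac)
  also have "alpha s \<odot> z1 \<oplus> (- alpha s) \<odot> z1 = \<zero>" by (simp flip: smult_add_left)
  finally show ?thesis by (simp add: ti_def r_distr smult_norm smult_add_right)
qed

lemma tz1t: "t \<otimes> z1 \<otimes> t = z2"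
  by (simp add: t_z1 m_assoc t_ti)

lemma ti_z2: "ti \<otimes> z2 = z1 \<otimes> t"
proof -
  have "ti \<otimes> z2 = (ti \<otimes> t) \<otimes> (z1 \<otimes> t)" by (simp flip: tz1t add: m_assoc)
  then show ?thesis by (simp add: t_ti)
qed

lemma t_z12: "t \<otimes> (z1 \<otimes> z2) = (z1 \<otimes> z2) \<otimes> t"
proof -
  have "t \<otimes> (z1 \<otimes> z2) = z2 \<otimes> (ti \<otimes> z2)" by (simp add: t_z1 flip: m_assoc)
  also have "\<dots> = z1 \<otimes> z2 \<otimes> t" by (simp add: ti_z2 flip: m_assoc z12)
  finally show ?thesis .
qed

lemma ti_z12: "ti \<otimes> (z1 \<otimes> z2) = (z1 \<otimes> z2) \<otimes> ti"
proof -
  have "ti \<otimes> (z1 \<otimes> z2) = ti \<otimes> ((z1 \<otimes> z2) \<otimes> t) \<otimes> ti" by (simp add: m_assoc t_ti)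
  also have "\<dots> = (ti \<otimes> t) \<otimes> (z1 \<otimes> z2) \<otimes> ti" by (simp add: m_assoc flip: t_z12[unfolded m_assoc])
  finally show ?thesis by (simp add: t_ti)
qed

lemma t_z3: "t \<otimes> z3 = z3 \<otimes> t"
  by (simp add: t_def l_distr r_distr xz3 smult_norm smult_add_right)

lemma y_z12: "y \<otimes> (z1 \<otimes> z2) = inverse q \<odot> ((z1 \<otimes> z2) \<otimes> y)"
proof -
  have "y \<otimes> (z1 \<otimes> z2) = z2 \<otimes> (y \<otimes> z2)" by (simp add: yz1 flip: m_assoc)
  also have "\<dots> = inverse q \<odot> (z2 \<otimes> z1 \<otimes> y)" by (simp add: yz2 smult_norm smult_add_right)
  finally show ?thesis by (simp add: z12)
qed

lemma yi_z12: "(z1 \<otimes> z2) \<otimes> yi = inverse q \<odot> (yi \<otimes> (z1 \<otimes> z2))"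
proof -
  have "(z1 \<otimes> z2) \<otimes> yi = yi \<otimes> (y \<otimes> (z1 \<otimes> z2)) \<otimes> yi"
    by (simp add: y_yi flip: m_assoc)
  also have "\<dots> = inverse q \<odot> (yi \<otimes> (z1 \<otimes> z2) \<otimes> (y \<otimes> yi))"
    unfolding y_z12 by (simp add: smult_norm smult_add_right)
  finally show ?thesis by (simp add: y_yi)
qed

definition "y1 = t \<otimes> yi"
definition "y2 = yi \<otimes> ti"

lemma y12_Units: "y1 \<in> Units A" "y2 \<in> Units A"
  using t_Units y_Units by (simp_all add: y1_def y2_def)

lemma y12_closed [simp]: "y1 \<in> carrier A" "y2 \<in> carrier A"
  by (simp_all add: y1_def y2_def)

lemma y12_inv: "inv y1 = y \<otimes> ti" "inv y2 = t \<otimes> y"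
  using t_Units y_Units by (simp_all add: y1_def y2_def inv_mult_Units)

lemma y2y1: "y2 \<otimes> y1 = z3"
proof -
  have "y2 \<otimes> y1 = yi \<otimes> (ti \<otimes> t) \<otimes> yi" by (simp add: y1_def y2_def m_assoc)
  then show ?thesis by (simp add: t_ti yi_yi)
qed

text \<open>
  Unlike \<open>y\<^sub>2 y\<^sub>1\<close>, this product is \<open>t z\<^sub>3 t\<^sup>-\<^sup>1\<close>; it equals \<open>z\<^sub>3\<close> because \<open>\<delta>\<^sub>1(z\<^sub>3) = 0\<close> lets
  \<open>t\<close> commute with \<open>z\<^sub>3\<close>.
\<close>

lemma y1y2: "y1 \<otimes> y2 = z3"
proof -
  have "y1 \<otimes> y2 = t \<otimes> (yi \<otimes> yi) \<otimes> ti" by (simp add: y1_def y2_def m_assoc)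
  also have "\<dots> = z3 \<otimes> (t \<otimes> ti)" by (simp add: yi_yi t_z3 m_assoc)
  finally show ?thesis by (simp add: t_ti)
qed

lemma cross: "inv y2 \<otimes> z1 \<otimes> y2 \<otimes> inv z1 = t \<otimes> t"
proof -
  have "inv y2 \<otimes> z1 \<otimes> y2 \<otimes> inv z1 = t \<otimes> (y \<otimes> z1) \<otimes> yi \<otimes> ti \<otimes> inv z1"
    by (simp add: y12_inv m_assoc) (simp add: y2_def m_assoc)
  also have "\<dots> = t \<otimes> z2 \<otimes> (y \<otimes> yi) \<otimes> ti \<otimes> inv z1"
    by (simp add: yz1 m_assoc)
  also have "\<dots> = t \<otimes> (z2 \<otimes> ti) \<otimes> inv z1" by (simp add: y_yi m_assoc)
  also have "\<dots> = t \<otimes> t \<otimes> (z1 \<otimes> inv z1)" by (simp add: m_assoc flip: t_z1)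
  finally show ?thesis using units by simp
qed

lemma tyt: "inv t \<otimes> y1 \<otimes> inv t = y2"
proof -
  have "inv t \<otimes> y1 \<otimes> inv t = (ti \<otimes> t) \<otimes> yi \<otimes> ti" by (simp add: t_Units y1_def m_assoc)
  then show ?thesis by (simp add: t_ti y2_def)
qed

lemma z12_y1: "z1 \<otimes> z2 \<otimes> y1 = inverse q \<odot> (y1 \<otimes> z1 \<otimes> z2)"
proof -
  have "z1 \<otimes> z2 \<otimes> y1 = (z1 \<otimes> z2 \<otimes> t) \<otimes> yi" by (simp add: y1_def m_assoc)
  also have "\<dots> = t \<otimes> (z1 \<otimes> z2 \<otimes> yi)" by (simp add: m_assoc flip: t_z12)
  also have "\<dots> = inverse q \<odot> (t \<otimes> yi \<otimes> (z1 \<otimes> z2))" unfolding yi_z12 by (simp add: smult_norm smult_add_right)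
  finally show ?thesis by (simp add: y1_def m_assoc)
qed

lemma z12_y2: "z1 \<otimes> z2 \<otimes> y2 = inverse q \<odot> (y2 \<otimes> z1 \<otimes> z2)"
proof -
  have "z1 \<otimes> z2 \<otimes> y2 = (z1 \<otimes> z2 \<otimes> yi) \<otimes> ti" by (simp add: y2_def m_assoc)
  also have "\<dots> = inverse q \<odot> (yi \<otimes> ((z1 \<otimes> z2) \<otimes> ti))" unfolding yi_z12 by (simp add: smult_norm smult_add_right)
  also have "\<dots> = inverse q \<odot> (y2 \<otimes> z1 \<otimes> z2)" by (simp add: y2_def m_assoc flip: ti_z12)
  finally show ?thesis .
qed

end

section \<open>The universal property of \<open>Q\<close>\<close>

locale amalg_data = torus q for q :: "'k::field" +
  fixes s :: 'k
  assumes s_nz: "s \<noteq> 0" and two_nz: "(2::'k) \<noteq> 0"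
begin

abbreviation disc :: "'k qt" where
  "disc \<equiv> (((s + inverse s) / 2) ^ 2) \<odot>\<^bsub>R\<^esub> \<one>\<^bsub>R\<^esub>"

sublocale q1: ore_quad R "tau1 q" "delta1 q s" disc
proof -
  have "ore_quad_axioms R disc" by (rule ore_quad_axioms.intro) simp
  with ore1 show "ore_quad R (tau1 q) (delta1 q s) disc" by (rule ore_quad.intro)
qed

text \<open>
  A constant instead of an abstraction, because the closure rule of a derivation would
  otherwise become a rewrite rule whose premise has a variable that is absent from its conclusion.
\<close>

definition zero_der :: "'k qt \<Rightarrow> 'k qt" where
  "zero_der = (\<lambda>_. \<zero>\<^bsub>R\<^esub>)"

lemma zero_der_apply [simp]: "zero_der r = \<zero>\<^bsub>R\<^esub>"
  by (simp add: zero_der_def)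

lemma ore2: "ore R (tau2 q) zero_der"
  unfolding zero_der_def by (rule ore_zero[OF tau2_props(1)])

sublocale q2: ore_quad R "tau2 q" zero_der "inv\<^bsub>R\<^esub> z3"
proof -
  have "ore_quad_axioms R (inv\<^bsub>R\<^esub> z3)" by (rule ore_quad_axioms.intro) simp
  with ore2 show "ore_quad R (tau2 q) zero_der (inv\<^bsub>R\<^esub> z3)" by (rule ore_quad.intro)
qed

lemma Q1_eqs: "Q1 q s = q1.QQ" "Q1_incl q s = q1.qincl" "Q1_x q s = q1.qx"
proof -
  have c: "c \<odot>\<^bsub>q1.E\<^esub> \<one>\<^bsub>q1.E\<^esub> = ore_const R (sc c)" for c
    by (simp add: ore_ext_simps ore_const_def fun_eq_iff)
  have "I1 q s = q1.J"
    by (simp only: I1_def Ore1_def Let_def q1.quad_def c)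
  then show "Q1 q s = q1.QQ" "Q1_incl q s = q1.qincl" "Q1_x q s = q1.qx"
    by (simp_all only: Q1_def Q1_incl_def[abs_def] Q1_x_def Ore1_def)
qed

lemma Q2_eqs: "Q2 q = q2.QQ" "Q2_incl q = q2.qincl" "Q2_y q = q2.qx"
proof -
  have "I2 q = q2.J"
    by (simp only: I2_def Ore2_def Let_def q2.quad_def zero_der_def[symmetric])
  then show "Q2 q = q2.QQ" "Q2_incl q = q2.qincl" "Q2_y q = q2.qx"
    by (simp_all only: Q2_def Q2_incl_def[abs_def] Q2_y_def Ore2_def zero_der_def[symmetric])
qed

sublocale am: amalgam R "Q1 q s" "Q2 q" "Q1_incl q s" "Q2_incl q"
  unfolding Q1_eqs Q2_eqs
  by (intro amalgam.intro amalgam_axioms.intro ring_axioms q1.ring_QQ q2.ring_QQ q1.qincl_hom q2.qincl_hom)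

abbreviation "QA \<equiv> Q q s"
abbreviation "fR \<equiv> from_R q s"
abbreviation "qx \<equiv> from_Q1 q s (Q1_x q s)"
abbreviation "qy \<equiv> from_Q2 q s (Q2_y q)"

lemma Q_simps: "carrier QA = carrier am.P" "mult QA = mult am.P" "one QA = one am.P"
  "zero QA = zero am.P" "add QA = add am.P" "c \<odot>\<^bsub>QA\<^esub> u = fR (sc c) \<otimes>\<^bsub>QA\<^esub> u"
  by (simp_all add: Q_def Qring_def)

lemma ring_Q: "ring QA"
  by (rule ring_cong[OF am.ring_P]) (simp_all only: Q_simps)

lemma ring_hom_Q: "ring_hom B QA = ring_hom B am.P" "ring_hom QA B = ring_hom am.P B"
  by (simp_all add: ring_hom_def Q_simps)

lemma from_Q1_hom: "from_Q1 q s \<in> ring_hom (Q1 q s) QA"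
  using am.inl_hom by (simp add: ring_hom_Q from_Q1_def[abs_def])

lemma from_Q2_hom: "from_Q2 q s \<in> ring_hom (Q2 q) QA"
  using am.inr_hom by (simp add: ring_hom_Q from_Q2_def[abs_def])

lemma from_R_Q2: "r \<in> carrier R \<Longrightarrow> fR r = from_Q2 q s (Q2_incl q r)"
  using am.inl_inr by (simp add: from_R_def from_Q1_def from_Q2_def)

lemma from_R_hom: "fR \<in> ring_hom R QA"
  using ring_hom_trans[OF am.f from_Q1_hom] by (simp add: comp_def from_R_def[abs_def])

lemma fR_closed [simp]: "r \<in> carrier R \<Longrightarrow> fR r \<in> carrier QA"
  by (rule ring_hom_closed[OF from_R_hom])

lemma Q1_x_closed: "Q1_x q s \<in> carrier (Q1 q s)"
  unfolding Q1_eqs by (rule q1.qx_closed)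

lemma Q2_y_closed: "Q2_y q \<in> carrier (Q2 q)"
  unfolding Q2_eqs by (rule q2.qx_closed)

lemma qx_closed [simp]: "qx \<in> carrier QA"
  by (rule ring_hom_closed[OF from_Q1_hom Q1_x_closed])

lemma qy_closed [simp]: "qy \<in> carrier QA"
  by (rule ring_hom_closed[OF from_Q2_hom Q2_y_closed])

text \<open>
  Generators and relations of \<open>Q\<close> over \<open>R\<close> are those of \<open>Q\<^sub>1\<close> and \<open>Q\<^sub>2\<close> taken together.
\<close>

lemma qx_rel:
  assumes "r \<in> carrier R"
  shows "qx \<otimes>\<^bsub>QA\<^esub> fR r = fR (tau1 q r) \<otimes>\<^bsub>QA\<^esub> qx \<oplus>\<^bsub>QA\<^esub> fR (delta1 q s r)"
proof -
  have "Q1_x q s \<otimes>\<^bsub>Q1 q s\<^esub> Q1_incl q s r =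
      Q1_incl q s (tau1 q r) \<otimes>\<^bsub>Q1 q s\<^esub> Q1_x q s \<oplus>\<^bsub>Q1 q s\<^esub> Q1_incl q s (delta1 q s r)"
    unfolding Q1_eqs by (rule q1.qx_rel[OF assms])
  moreover have "Q1_incl q s a \<in> carrier (Q1 q s)" if "a \<in> carrier R" for a
    using that by (rule ring_hom_closed[OF am.f])
  ultimately show ?thesis
    using assms Q1_x_closed
    by (simp add: from_R_def flip: ring_hom_mult[OF from_Q1_hom] ring_hom_add[OF from_Q1_hom])
qed

lemma qy_rel:
  assumes "r \<in> carrier R"
  shows "qy \<otimes>\<^bsub>QA\<^esub> fR r = fR (tau2 q r) \<otimes>\<^bsub>QA\<^esub> qy"
proof -
  interpret QA: ring QA by (rule ring_Q)
  have "Q2_y q \<otimes>\<^bsub>Q2 q\<^esub> Q2_incl q r =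
      Q2_incl q (tau2 q r) \<otimes>\<^bsub>Q2 q\<^esub> Q2_y q \<oplus>\<^bsub>Q2 q\<^esub> Q2_incl q \<zero>\<^bsub>R\<^esub>"
    unfolding Q2_eqs using q2.qx_rel[OF assms] by (simp only: zero_der_def)
  moreover have "Q2_incl q \<zero>\<^bsub>R\<^esub> = \<zero>\<^bsub>Q2 q\<^esub>"
    by (rule ring_hom_zero[OF am.g ring_axioms am.B.ring_axioms])
  moreover have "Q2_incl q a \<in> carrier (Q2 q)" if "a \<in> carrier R" for a
    using that by (rule ring_hom_closed[OF am.g])
  ultimately show ?thesis
    using assms Q2_y_closed
    by (simp add: from_R_Q2 flip: ring_hom_mult[OF from_Q2_hom])
qed

lemma qx_sq: "qx \<otimes>\<^bsub>QA\<^esub> qx = fR disc"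
proof -
  have "Q1_x q s \<otimes>\<^bsub>Q1 q s\<^esub> Q1_x q s = Q1_incl q s disc"
    unfolding Q1_eqs by (rule q1.qx_sq)
  then show ?thesis
    using Q1_x_closed by (simp add: from_R_def flip: ring_hom_mult[OF from_Q1_hom])
qed

lemma qy_sq: "qy \<otimes>\<^bsub>QA\<^esub> qy = fR (inv\<^bsub>R\<^esub> z3)"
proof -
  have "Q2_y q \<otimes>\<^bsub>Q2 q\<^esub> Q2_y q = Q2_incl q (inv\<^bsub>R\<^esub> z3)"
    unfolding Q2_eqs by (rule q2.qx_sq)
  then show ?thesis
    using Q2_y_closed by (simp add: from_R_Q2 flip: ring_hom_mult[OF from_Q2_hom])
qed

lemma Q_induct:
  assumes "u \<in> carrier QA"
    and fR: "\<And>r. r \<in> carrier R \<Longrightarrow> X (fR r)" and qx: "X qx" and qy: "X qy"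
    and add: "\<And>a b. a \<in> carrier QA \<Longrightarrow> b \<in> carrier QA \<Longrightarrow> X a \<Longrightarrow> X b \<Longrightarrow> X (a \<oplus>\<^bsub>QA\<^esub> b)"
    and mult: "\<And>a b. a \<in> carrier QA \<Longrightarrow> b \<in> carrier QA \<Longrightarrow> X a \<Longrightarrow> X b \<Longrightarrow> X (a \<otimes>\<^bsub>QA\<^esub> b)"
  shows "X u"
  using assms(1) unfolding Q_simps(1)
proof (rule am.amalg_induct)
  fix a assume "a \<in> carrier (Q1 q s)"
  then have "X (from_Q1 q s a)"
    unfolding Q1_eqs
  proof (rule q1.QQ_induct)
    show "X (from_Q1 q s (q1.qincl r))" if "r \<in> carrier R" for r
      using fR[OF that] by (simp add: from_R_def Q1_eqs)
    show "X (from_Q1 q s q1.qx)" using qx by (simp add: Q1_eqs)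
  qed (use add mult in \<open>simp_all add: ring_hom_add[OF from_Q1_hom[unfolded Q1_eqs]]
      ring_hom_mult[OF from_Q1_hom[unfolded Q1_eqs]] ring_hom_closed[OF from_Q1_hom[unfolded Q1_eqs]]\<close>)
  then show "X (am.inl a)" by (simp add: from_Q1_def)
next
  fix a assume "a \<in> carrier (Q2 q)"
  then have "X (from_Q2 q s a)"
    unfolding Q2_eqs
  proof (rule q2.QQ_induct)
    show "X (from_Q2 q s (q2.qincl r))" if "r \<in> carrier R" for r
      using fR[OF that] that by (simp add: from_R_Q2 Q2_eqs)
    show "X (from_Q2 q s q2.qx)" using qy by (simp add: Q2_eqs)
  qed (use add mult in \<open>simp_all add: ring_hom_add[OF from_Q2_hom[unfolded Q2_eqs]]
      ring_hom_mult[OF from_Q2_hom[unfolded Q2_eqs]] ring_hom_closed[OF from_Q2_hom[unfolded Q2_eqs]]\<close>)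
  then show "X (am.inr a)" by (simp add: from_Q2_def)
qed (use add mult in \<open>simp_all add: Q_simps\<close>)

text \<open>
  A homomorphism out of \<open>Q\<close> is the same as a homomorphism \<open>f\<close> out of \<open>R\<close> together with
  images of \<open>x\<close> and \<open>y\<close> that satisfy the relations of \<open>Q\<^sub>1\<close> and of \<open>Q\<^sub>2\<close> over \<open>f\<close>.
\<close>

lemma Q_lift:
  assumes B: "ring B" and f: "f \<in> ring_hom R B" and b: "b \<in> carrier B" and c: "c \<in> carrier B"
    and relx: "\<And>r. r \<in> carrier R \<Longrightarrow> q1.skew_rel B f b r" and sqx: "b \<otimes>\<^bsub>B\<^esub> b = f disc"
    and rely: "\<And>r. r \<in> carrier R \<Longrightarrow> q2.skew_rel B f c r" and sqy: "c \<otimes>\<^bsub>B\<^esub> c = f (inv\<^bsub>R\<^esub> z3)"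
  shows "\<exists>h \<in> ring_hom QA B. (\<forall>r \<in> carrier R. h (fR r) = f r) \<and> h qx = b \<and> h qy = c"
proof -
  obtain h1 where h1: "h1 \<in> ring_hom (Q1 q s) B" "\<And>r. r \<in> carrier R \<Longrightarrow> h1 (Q1_incl q s r) = f r"
    "h1 (Q1_x q s) = b"
    unfolding Q1_eqs using q1.QQ_lift[OF B f b relx sqx] by auto
  obtain h2 where h2: "h2 \<in> ring_hom (Q2 q) B" "\<And>r. r \<in> carrier R \<Longrightarrow> h2 (Q2_incl q r) = f r"
    "h2 (Q2_y q) = c"
    unfolding Q2_eqs using q2.QQ_lift[OF B f c rely sqy] by auto
  have "h1 (Q1_incl q s r) = h2 (Q2_incl q r)" if "r \<in> carrier R" for r
    using that by (simp add: h1 h2)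
  then obtain h where h: "h \<in> ring_hom QA B" "\<And>a. a \<in> carrier (Q1 q s) \<Longrightarrow> h (from_Q1 q s a) = h1 a"
    "\<And>a. a \<in> carrier (Q2 q) \<Longrightarrow> h (from_Q2 q s a) = h2 a"
    using am.amalg_lift[OF B h1(1) h2(1)] by (auto simp: ring_hom_Q from_Q1_def from_Q2_def)
  show ?thesis
    using h(2)[OF ring_hom_closed[OF am.f]] h(2)[OF Q1_x_closed] h(3)[OF Q2_y_closed] h1 h2
    by (intro bexI[OF _ h(1)]) (simp add: from_R_def)
qed

text \<open>
  The pushout is formed from rings, so centrality of the image of \<open>k\<close> has to be proved. It
  holds because \<open>\<tau>\<^sub>1\<close> and \<open>\<tau>\<^sub>2\<close> fix scalars and \<open>\<delta>\<^sub>1\<close> kills them.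
\<close>

lemma Q_scalar_central:
  assumes "u \<in> carrier QA"
  shows "fR (sc c) \<otimes>\<^bsub>QA\<^esub> u = u \<otimes>\<^bsub>QA\<^esub> fR (sc c)"
proof -
  interpret QA: ring QA by (rule ring_Q)
  let ?e = "fR (sc c)"
  have e: "?e \<in> carrier QA" by simp
  have z: "fR \<zero>\<^bsub>R\<^esub> = \<zero>\<^bsub>QA\<^esub>" by (rule ring_hom_zero[OF from_R_hom ring_axioms ring_Q])
  show ?thesis
    using assms
  proof (rule Q_induct)
    show "?e \<otimes>\<^bsub>QA\<^esub> fR r = fR r \<otimes>\<^bsub>QA\<^esub> ?e" if "r \<in> carrier R" for r
      using that by (simp flip: ring_hom_mult[OF from_R_hom] add: smult_one_mult smult_mult_one)
    show "?e \<otimes>\<^bsub>QA\<^esub> qx = qx \<otimes>\<^bsub>QA\<^esub> ?e"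
      by (simp add: qx_rel tau1_props delta1_gens z)
    show "?e \<otimes>\<^bsub>QA\<^esub> qy = qy \<otimes>\<^bsub>QA\<^esub> ?e"
      by (simp add: qy_rel tau2_props)
    fix a b assume ab: "a \<in> carrier QA" "b \<in> carrier QA"
      and IH: "?e \<otimes>\<^bsub>QA\<^esub> a = a \<otimes>\<^bsub>QA\<^esub> ?e" "?e \<otimes>\<^bsub>QA\<^esub> b = b \<otimes>\<^bsub>QA\<^esub> ?e"
    show "?e \<otimes>\<^bsub>QA\<^esub> (a \<oplus>\<^bsub>QA\<^esub> b) = (a \<oplus>\<^bsub>QA\<^esub> b) \<otimes>\<^bsub>QA\<^esub> ?e"
      using ab e IH by (simp add: QA.r_distr QA.l_distr)
    have "?e \<otimes>\<^bsub>QA\<^esub> (a \<otimes>\<^bsub>QA\<^esub> b) = (?e \<otimes>\<^bsub>QA\<^esub> a) \<otimes>\<^bsub>QA\<^esub> b"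
      using ab e by (simp add: QA.m_assoc)
    also have "\<dots> = a \<otimes>\<^bsub>QA\<^esub> (?e \<otimes>\<^bsub>QA\<^esub> b)"
      using ab e IH(1) by (simp add: QA.m_assoc)
    also have "\<dots> = (a \<otimes>\<^bsub>QA\<^esub> b) \<otimes>\<^bsub>QA\<^esub> ?e"
      using ab e IH(2) by (simp add: QA.m_assoc)
    finally show "?e \<otimes>\<^bsub>QA\<^esub> (a \<otimes>\<^bsub>QA\<^esub> b) = (a \<otimes>\<^bsub>QA\<^esub> b) \<otimes>\<^bsub>QA\<^esub> ?e" .
  qed
qed

lemma kalg_Q: "kalg QA"
proof (rule kalgI[OF ring_Q _ Q_scalar_central Q_simps(6)])
  show "scalar_map QA (\<lambda>c. fR (sc c))"
    using scalar_map_smult ring_hom_one[OF from_R_hom]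
    by (simp add: scalar_map_def flip: ring_hom_mult[OF from_R_hom] ring_hom_add[OF from_R_hom])
qed

lemma fR_one: "fR \<one>\<^bsub>R\<^esub> = \<one>\<^bsub>QA\<^esub>"
  by (rule ring_hom_one[OF from_R_hom])

lemma fR_zero: "fR \<zero>\<^bsub>R\<^esub> = \<zero>\<^bsub>QA\<^esub>"
  by (rule ring_hom_zero[OF from_R_hom ring_axioms ring_Q])

lemma fR_smult:
  assumes "a \<in> carrier R" shows "fR (c \<odot>\<^bsub>R\<^esub> a) = c \<odot>\<^bsub>QA\<^esub> fR a"
  unfolding Q_simps(6) using assms
  by (simp flip: ring_hom_mult[OF from_R_hom] add: smult_one_mult)

lemma fR_scalar: "fR (sc c) = c \<odot>\<^bsub>QA\<^esub> \<one>\<^bsub>QA\<^esub>"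
  by (simp add: fR_smult fR_one)

sublocale ae: amalg_elements QA q s qx qy "fR z1" "fR z2" "fR z3"
proof (intro amalg_elements.intro kalg_Q amalg_elements_axioms.intro)
  interpret QA: ring QA by (rule ring_Q)
  note u = ring_hom_inv(1)[OF ring_axioms ring_Q from_R_hom z_Units]
  show "fR z1 \<in> Units QA" "fR z2 \<in> Units QA" "fR z3 \<in> Units QA" by (rule u)+
  note flips = ring_hom_mult[OF from_R_hom, symmetric] ring_hom_add[OF from_R_hom, symmetric]
    fR_smult[symmetric]
  show "fR z2 \<otimes>\<^bsub>QA\<^esub> fR z1 = fR z1 \<otimes>\<^bsub>QA\<^esub> fR z2" by (simp add: flips z_rel12)
  show "fR z3 \<otimes>\<^bsub>QA\<^esub> fR z1 = q \<odot>\<^bsub>QA\<^esub> (fR z1 \<otimes>\<^bsub>QA\<^esub> fR z3)" by (simp add: flips z_rel13)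
  show "fR z3 \<otimes>\<^bsub>QA\<^esub> fR z2 = q \<odot>\<^bsub>QA\<^esub> (fR z2 \<otimes>\<^bsub>QA\<^esub> fR z3)" by (simp add: flips z_rel23)
  show "qx \<otimes>\<^bsub>QA\<^esub> fR z1 = fR z2 \<otimes>\<^bsub>QA\<^esub> qx \<oplus>\<^bsub>QA\<^esub> (- alpha s) \<odot>\<^bsub>QA\<^esub> (fR z1 \<oplus>\<^bsub>QA\<^esub> fR z2)"
    by (simp add: flips qx_rel tau1_props delta1_gens)
  show "qx \<otimes>\<^bsub>QA\<^esub> fR z3 = fR z3 \<otimes>\<^bsub>QA\<^esub> qx"
    by (simp add: qx_rel tau1_props delta1_gens fR_zero)
  show "qx \<otimes>\<^bsub>QA\<^esub> qx = (((s + inverse s) / 2)\<^sup>2) \<odot>\<^bsub>QA\<^esub> \<one>\<^bsub>QA\<^esub>"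
    by (simp add: qx_sq fR_scalar)
  show "qy \<otimes>\<^bsub>QA\<^esub> fR z1 = fR z2 \<otimes>\<^bsub>QA\<^esub> qy" by (simp add: qy_rel tau2_props)
  show "qy \<otimes>\<^bsub>QA\<^esub> fR z2 = inverse q \<odot>\<^bsub>QA\<^esub> (fR z1 \<otimes>\<^bsub>QA\<^esub> qy)"
    by (simp add: qy_rel tau2_props fR_smult kalg.smult_mult_left[OF kalg_Q])
  show "qy \<otimes>\<^bsub>QA\<^esub> fR z3 = fR z3 \<otimes>\<^bsub>QA\<^esub> qy" by (simp add: qy_rel tau2_props)
  show "qy \<otimes>\<^bsub>QA\<^esub> qy = inv\<^bsub>QA\<^esub> fR z3"
    by (simp add: qy_sq ring_hom_inv(2)[OF ring_axioms ring_Q from_R_hom])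
qed (use q_nz s_nz two_nz in auto)


section \<open>The isomorphism\<close>

abbreviation "H \<equiv> daha q s"
abbreviation "hT \<equiv> hgen q s T"
abbreviation "hX1 \<equiv> hgen q s X1"
abbreviation "hX2 \<equiv> hgen q s X2"
abbreviation "hY1 \<equiv> hgen q s Y1"
abbreviation "hY2 \<equiv> hgen q s Y2"

lemma kalg_H: "kalg H"
  unfolding daha_def by (rule kalg_inv_pres)

lemma h_Units: "hgen q s g \<in> Units H"
  unfolding hgen_def daha_def by (rule inv_pres_gen_Units)

sublocale de: daha_elements H q s hT hX1 hX2 hY1 hY2
proof (intro daha_elements.intro kalg_H daha_elements_axioms.intro h_Units q_nz s_nz two_nz)
  interpret H: kalg H by (rule kalg_H)
  have [simp]: "hgen q s g \<in> carrier H" "inv\<^bsub>H\<^esub> hgen q s g \<in> carrier H" for g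
    using h_Units[of g] by auto
  define cls where "cls = pres_cls (daha_rels q s)"
  have m: "cls (x * y) = cls x \<otimes>\<^bsub>H\<^esub> cls y" "cls (x + y) = cls x \<oplus>\<^bsub>H\<^esub> cls y"
    "cls (x - y) = cls x \<ominus>\<^bsub>H\<^esub> cls y" "cls 0 = \<zero>\<^bsub>H\<^esub>" for x y
    by (simp_all add: cls_def daha_def pres_cls_mult pres_cls_add pres_cls_diff pres_cls_zero)
  have z: "cls (var (Pos g)) = hgen q s g" "cls (var (Neg g)) = inv\<^bsub>H\<^esub> hgen q s g" for g
    by (simp_all add: cls_def hgen_def daha_def inv_pres_gen_inv) (simp add: inv_pres_gen_eq)
  have c: "cls (scalar c) = c \<odot>\<^bsub>H\<^esub> \<one>\<^bsub>H\<^esub>" for c by (simp add: cls_def daha_def inv_pres_smult_one)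
  have "\<forall>(l, r) \<in> daha_rels q s. cls l = cls r" unfolding cls_def using pres_cls_rel by blast
  note rel = this[unfolded daha_rels_def Let_def, simplified, unfolded m z c]
  have front: "c \<odot>\<^bsub>H\<^esub> \<one>\<^bsub>H\<^esub> \<otimes>\<^bsub>H\<^esub> hgen q s f \<otimes>\<^bsub>H\<^esub> hgen q s g \<otimes>\<^bsub>H\<^esub> hgen q s h =
      c \<odot>\<^bsub>H\<^esub> (hgen q s f \<otimes>\<^bsub>H\<^esub> hgen q s g \<otimes>\<^bsub>H\<^esub> hgen q s h)" for c f g h
    by (simp add: H.smult_norm)
  show "hX1 \<otimes>\<^bsub>H\<^esub> hX2 = hX2 \<otimes>\<^bsub>H\<^esub> hX1" "hY1 \<otimes>\<^bsub>H\<^esub> hY2 = hY2 \<otimes>\<^bsub>H\<^esub> hY1"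
    "(hT \<ominus>\<^bsub>H\<^esub> s \<odot>\<^bsub>H\<^esub> \<one>\<^bsub>H\<^esub>) \<otimes>\<^bsub>H\<^esub> (hT \<oplus>\<^bsub>H\<^esub> inverse s \<odot>\<^bsub>H\<^esub> \<one>\<^bsub>H\<^esub>) = \<zero>\<^bsub>H\<^esub>"
    "inv\<^bsub>H\<^esub> hY2 \<otimes>\<^bsub>H\<^esub> hX1 \<otimes>\<^bsub>H\<^esub> hY2 \<otimes>\<^bsub>H\<^esub> inv\<^bsub>H\<^esub> hX1 = hT \<otimes>\<^bsub>H\<^esub> hT"
    "inv\<^bsub>H\<^esub> hT \<otimes>\<^bsub>H\<^esub> hY1 \<otimes>\<^bsub>H\<^esub> inv\<^bsub>H\<^esub> hT = hY2" "hT \<otimes>\<^bsub>H\<^esub> hX1 \<otimes>\<^bsub>H\<^esub> hT = hX2"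
    using rel by blast+
  show "hY1 \<otimes>\<^bsub>H\<^esub> hY2 \<otimes>\<^bsub>H\<^esub> hX1 = q \<odot>\<^bsub>H\<^esub> (hX1 \<otimes>\<^bsub>H\<^esub> hY1 \<otimes>\<^bsub>H\<^esub> hY2)"
    "hY1 \<otimes>\<^bsub>H\<^esub> hY2 \<otimes>\<^bsub>H\<^esub> hX2 = q \<odot>\<^bsub>H\<^esub> (hX2 \<otimes>\<^bsub>H\<^esub> hY1 \<otimes>\<^bsub>H\<^esub> hY2)"
    using rel unfolding front by blast+
qed

text \<open>
  First \<open>R\<close> is mapped by its own presentation, then the relations for \<open>x\<close> and \<open>y\<close> are
  checked on the generators of \<open>R\<close>.
\<close>

lemma Q_to_daha:
  "\<exists>h \<in> ring_hom QA H. (\<forall>c. h (c \<odot>\<^bsub>QA\<^esub> \<one>\<^bsub>QA\<^esub>) = c \<odot>\<^bsub>H\<^esub> \<one>\<^bsub>H\<^esub>) \<and> h (fR z1) = hX1 \<and> h (fR z2) = hX2 \<and>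
     h (fR z3) = hY1 \<otimes>\<^bsub>H\<^esub> hY2 \<and> h qx = de.x \<and> h qy = de.y"
proof -
  have "\<exists>f \<in> ring_hom R H. (\<forall>c. f (sc c) = c \<odot>\<^bsub>H\<^esub> \<one>\<^bsub>H\<^esub>) \<and> f z1 = hX1 \<and> f z2 = hX2 \<and>
      f z3 = hY1 \<otimes>\<^bsub>H\<^esub> hY2"
  proof (rule torus_lift[OF de.ring_axioms de.scalar_map_smult])
    show "hX1 \<in> Units H" "hX2 \<in> Units H" "hY1 \<otimes>\<^bsub>H\<^esub> hY2 \<in> Units H" using de.units by auto
    show "hX1 \<otimes>\<^bsub>H\<^esub> (hY1 \<otimes>\<^bsub>H\<^esub> hY2) = inverse q \<odot>\<^bsub>H\<^esub> \<one>\<^bsub>H\<^esub> \<otimes>\<^bsub>H\<^esub> (hY1 \<otimes>\<^bsub>H\<^esub> hY2 \<otimes>\<^bsub>H\<^esub> hX1)"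
      using q_nz unfolding de.y1y2 by (simp add: de.smult_norm)
    show "hX2 \<otimes>\<^bsub>H\<^esub> (hY1 \<otimes>\<^bsub>H\<^esub> hY2) = inverse q \<odot>\<^bsub>H\<^esub> \<one>\<^bsub>H\<^esub> \<otimes>\<^bsub>H\<^esub> (hY1 \<otimes>\<^bsub>H\<^esub> hY2 \<otimes>\<^bsub>H\<^esub> hX2)"
      using q_nz unfolding de.y1y2 by (simp add: de.smult_norm)
    show "hX1 \<otimes>\<^bsub>H\<^esub> hX2 = hX2 \<otimes>\<^bsub>H\<^esub> hX1" by (rule de.xx)
  qed (simp_all add: de.smult_norm)
  then obtain f where f: "f \<in> ring_hom R H" "\<And>c. f (sc c) = c \<odot>\<^bsub>H\<^esub> \<one>\<^bsub>H\<^esub>"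
    "f z1 = hX1" "f z2 = hX2" "f z3 = hY1 \<otimes>\<^bsub>H\<^esub> hY2" by blast
  have fs: "f (c \<odot>\<^bsub>R\<^esub> a) = c \<odot>\<^bsub>H\<^esub> f a" if "a \<in> carrier R" for c a
    using ring_hom_mult[OF f(1), of "sc c" a] that ring_hom_closed[OF f(1) that]
    by (simp add: f smult_one_mult de.smult_one_mult)
  have f0: "f \<zero>\<^bsub>R\<^esub> = \<zero>\<^bsub>H\<^esub>" by (rule ring_hom_zero[OF f(1) ring_axioms de.ring_axioms])
  have "\<exists>h \<in> ring_hom QA H. (\<forall>r \<in> carrier R. h (fR r) = f r) \<and> h qx = de.x \<and> h qy = de.y"
  proof (rule Q_lift[OF de.ring_axioms f(1) de.x_closed de.y_closed])
    show "q1.skew_rel H f de.x r" if "r \<in> carrier R" for r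
    proof (rule torus_skew_rel[OF ore1 de.ring_axioms f(1) de.x_closed _ _ _ _ that])
      show "q1.skew_rel H f de.x (sc c)" for c
        by (simp add: q1.skew_rel_def tau1_props delta1_gens f f0 de.smult_norm)
      show "q1.skew_rel H f de.x z1" "q1.skew_rel H f de.x z2"
        by (simp_all add: q1.skew_rel_def tau1_props delta1_gens fs ring_hom_add[OF f(1)] f de.x_x1 de.x_x2)
      show "q1.skew_rel H f de.x z3"
        using de.x_yy by (simp add: q1.skew_rel_def tau1_props delta1_gens f f0)
    qed
    show "q2.skew_rel H f de.y r" if "r \<in> carrier R" for r
    proof (rule torus_skew_rel[OF ore2 de.ring_axioms f(1) de.y_closed _ _ _ _ that])
      show "q2.skew_rel H f de.y (sc c)" for c
        by (simp add: q2.skew_rel_def tau2_props f f0 de.smult_norm)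
      show "q2.skew_rel H f de.y z1" "q2.skew_rel H f de.y z2"
        by (simp_all add: q2.skew_rel_def tau2_props fs f0 f de.y_x1 de.y_x2 de.smult_norm)
      show "q2.skew_rel H f de.y z3"
        using de.y_yy by (simp add: q2.skew_rel_def tau2_props f f0)
    qed
    show "de.x \<otimes>\<^bsub>H\<^esub> de.x = f disc" by (simp add: f de.x_sq)
    show "de.y \<otimes>\<^bsub>H\<^esub> de.y = f (inv\<^bsub>R\<^esub> z3)"
      by (simp add: ring_hom_inv(2)[OF ring_axioms de.ring_axioms f(1)] f de.y_sq)
  qed
  then obtain h where h: "h \<in> ring_hom QA H" "\<And>r. r \<in> carrier R \<Longrightarrow> h (fR r) = f r" "h qx = de.x" "h qy = de.y"
    by blast
  have "h (c \<odot>\<^bsub>QA\<^esub> \<one>\<^bsub>QA\<^esub>) = c \<odot>\<^bsub>H\<^esub> \<one>\<^bsub>H\<^esub>" for c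
    using h(2)[of "sc c"] by (simp add: fR_scalar f)
  then show ?thesis by (intro bexI[OF _ h(1)]) (simp add: h f)
qed

lemma daha_to_Q:
  "\<exists>h \<in> ring_hom H QA. (\<forall>c. h (c \<odot>\<^bsub>H\<^esub> \<one>\<^bsub>H\<^esub>) = c \<odot>\<^bsub>QA\<^esub> \<one>\<^bsub>QA\<^esub>) \<and> h hT = ae.t \<and>
     h hX1 = fR z1 \<and> h hX2 = fR z2 \<and> h hY1 = ae.y1 \<and> h hY2 = ae.y2"
proof -
  define b where "b g = (case g of T \<Rightarrow> ae.t | X1 \<Rightarrow> fR z1 | X2 \<Rightarrow> fR z2 | Y1 \<Rightarrow> ae.y1 | Y2 \<Rightarrow> ae.y2)" for g
  have bU: "b g \<in> Units QA" for g
    using ae.units ae.t_Units ae.y12_Units by (simp add: b_def split: daha_gen.split)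
  have bc: "b g \<in> carrier QA" for g using bU by auto
  have "\<exists>h \<in> ring_hom (inv_pres (daha_rels q s)) QA.
      (\<forall>c. h (c \<odot>\<^bsub>inv_pres (daha_rels q s)\<^esub> \<one>\<^bsub>inv_pres (daha_rels q s)\<^esub>) = c \<odot>\<^bsub>QA\<^esub> \<one>\<^bsub>QA\<^esub>) \<and>
      (\<forall>g. h (inv_pres_gen (daha_rels q s) g) = b g)"
  proof (rule inv_pres_lift[OF ae.ring_axioms ae.scalar_map_smult bU])
    show "c \<odot>\<^bsub>QA\<^esub> \<one>\<^bsub>QA\<^esub> \<otimes>\<^bsub>QA\<^esub> b g = b g \<otimes>\<^bsub>QA\<^esub> (c \<odot>\<^bsub>QA\<^esub> \<one>\<^bsub>QA\<^esub>)" for c g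
      using bc by (simp add: ae.smult_norm)
    fix f l r
    assume lr: "(l, r) \<in> daha_rels q s" and f: "f \<in> ring_hom (free_alg UNIV) QA"
      and sc: "\<And>c. f (scalar c) = c \<odot>\<^bsub>QA\<^esub> \<one>\<^bsub>QA\<^esub>" and p: "\<And>g. f (var (Pos g)) = b g"
      and n: "\<And>g. f (var (Neg g)) = inv\<^bsub>QA\<^esub> b g"
    have m: "f (x * y) = f x \<otimes>\<^bsub>QA\<^esub> f y" "f (x + y) = f x \<oplus>\<^bsub>QA\<^esub> f y" for x y
      using ring_hom_mult[OF f, of x y] ring_hom_add[OF f, of x y] by simp_all
    have d: "f (x - y) = f x \<ominus>\<^bsub>QA\<^esub> f y" for x y
      using ring_hom_diff[OF ring_free_alg ae.ring_axioms f, of x y] by (simp add: free_alg_minus)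
    have f0: "f 0 = \<zero>\<^bsub>QA\<^esub>"
      using ring_hom_zero[OF f ring_free_alg ae.ring_axioms] by simp
    note simps = m d f0 sc p n b_def
    note rels = ae.z12 ae.y1y2 ae.y2y1 ae.hecke ae.cross ae.tyt ae.tz1t ae.z13 ae.z23 ae.z12_y1 ae.z12_y2
    show "f l = f r"
      using lr unfolding daha_rels_def Let_def
      by (elim insertE emptyE Pair_inject; hypsubst)
        (simp_all add: simps rels ae.smult_one_mult ae.smult_mult_left ae.m_assoc)
  qed
  then obtain h where h: "h \<in> ring_hom H QA" "\<And>c. h (c \<odot>\<^bsub>H\<^esub> \<one>\<^bsub>H\<^esub>) = c \<odot>\<^bsub>QA\<^esub> \<one>\<^bsub>QA\<^esub>"
    "\<And>g. h (hgen q s g) = b g"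
    by (auto simp: hgen_def daha_def)
  show ?thesis by (intro bexI[OF _ h(1)]) (simp add: h b_def)
qed

text \<open>
  The homomorphisms in both directions are mutually inverse since both composites fix
  generators. For \<open>y\<^sub>1\<close> and \<open>y\<^sub>2\<close> this is the observation that \<open>T y\<^sup>-\<^sup>1 = Y\<^sub>1\<close> and \<open>y\<^sup>-\<^sup>1 T\<^sup>-\<^sup>1 = Y\<^sub>2\<close> when
  \<open>y = Y\<^sub>1\<^sup>-\<^sup>1 T\<close>.
\<close>

theorem amalg_iso_daha:
  "\<exists>\<phi> \<in> alg_iso QA H. \<phi> (fR z1) = hX1 \<and> \<phi> (fR z2) = hX2 \<and> \<phi> (fR z3) = hY1 \<otimes>\<^bsub>H\<^esub> hY2 \<and>
     \<phi> qx = de.x \<and> \<phi> qy = de.y"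
proof -
  obtain \<phi> where phi: "\<phi> \<in> ring_hom QA H" "\<And>c. \<phi> (c \<odot>\<^bsub>QA\<^esub> \<one>\<^bsub>QA\<^esub>) = c \<odot>\<^bsub>H\<^esub> \<one>\<^bsub>H\<^esub>"
    "\<phi> (fR z1) = hX1" "\<phi> (fR z2) = hX2" "\<phi> (fR z3) = hY1 \<otimes>\<^bsub>H\<^esub> hY2" "\<phi> qx = de.x" "\<phi> qy = de.y"
    using Q_to_daha by blast
  obtain \<psi> where psi: "\<psi> \<in> ring_hom H QA" "\<And>c. \<psi> (c \<odot>\<^bsub>H\<^esub> \<one>\<^bsub>H\<^esub>) = c \<odot>\<^bsub>QA\<^esub> \<one>\<^bsub>QA\<^esub>"
    "\<psi> hT = ae.t" "\<psi> hX1 = fR z1" "\<psi> hX2 = fR z2" "\<psi> hY1 = ae.y1" "\<psi> hY2 = ae.y2"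
    using daha_to_Q by blast
  have phi_smult: "\<phi> (c \<odot>\<^bsub>QA\<^esub> a) = c \<odot>\<^bsub>H\<^esub> \<phi> a" if "a \<in> carrier QA" for c a
    using ring_hom_mult[OF phi(1), of "c \<odot>\<^bsub>QA\<^esub> \<one>\<^bsub>QA\<^esub>" a] that ring_hom_closed[OF phi(1) that]
    by (simp add: phi ae.smult_one_mult de.smult_one_mult)
  note phi_inv = ring_hom_inv(2)[OF ae.ring_axioms de.ring_axioms phi(1)]
    and psi_inv = ring_hom_inv(2)[OF de.ring_axioms ae.ring_axioms psi(1)]
    and phi_mult = ring_hom_mult[OF phi(1)] and psi_mult = ring_hom_mult[OF psi(1)]
    and phi_add = ring_hom_add[OF phi(1)] and psi_add = ring_hom_add[OF psi(1)]
  have psi_x: "\<psi> de.x = qx"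
    by (simp add: de.x_def psi_add psi ae.t_def ae.a_assoc ae.smult_cancel)
  have psi_y: "\<psi> de.y = qy"
  proof -
    have "\<psi> de.y = inv\<^bsub>QA\<^esub> ae.y1 \<otimes>\<^bsub>QA\<^esub> ae.t"
      using de.units by (simp add: de.y_def psi_mult psi_inv psi)
    also have "\<dots> = qy" by (simp add: ae.y12_inv ae.m_assoc ae.t_ti)
    finally show ?thesis .
  qed
  have phi_t: "\<phi> ae.t = hT"
    by (simp add: ae.t_def phi_add phi de.x_def de.a_assoc de.smult_cancel)
  have phi_yi: "\<phi> ae.yi = inv\<^bsub>H\<^esub> de.y"
    using phi_inv[OF ae.y_Units(1)] by (simp add: ae.y_Units(2) phi)
  have phi_ti: "\<phi> ae.ti = inv\<^bsub>H\<^esub> hT"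
    using phi_inv[OF ae.t_Units(1)] by (simp add: ae.t_Units(2) phi_t)
  have y_inv: "inv\<^bsub>H\<^esub> de.y = inv\<^bsub>H\<^esub> hT \<otimes>\<^bsub>H\<^esub> hY1"
    using de.units by (simp add: de.y_def de.inv_mult_Units)
  have phi_y1: "\<phi> ae.y1 = hY1"
    using de.units by (simp add: ae.y1_def phi_mult phi_t phi_yi y_inv de.Units_cancel_inv_left)
  have phi_y2: "\<phi> ae.y2 = hY2"
    by (simp add: ae.y2_def phi_mult phi_ti phi_yi y_inv de.ty)
  have id_R: "\<psi> (\<phi> (fR r)) = fR r" if "r \<in> carrier R" for r
    using torus_hom_unique[OF ring_Q ring_hom_trans[OF ring_hom_trans[OF from_R_hom phi(1)] psi(1)]
        from_R_hom _ _ _ _ that]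
    by (simp add: fR_scalar phi psi psi_mult ae.y1y2)
  have id_Q: "\<psi> (\<phi> u) = u" if "u \<in> carrier QA" for u
    using that
    by (rule Q_induct)
      (simp_all add: id_R phi psi_x psi_y phi_add phi_mult psi_add psi_mult ring_hom_closed[OF phi(1)])
  have id_H: "\<phi> (\<psi> a) = a" if "a \<in> carrier H" for a
  proof -
    have "\<phi> (\<psi> (hgen q s g)) = hgen q s g" for g
      by (cases g) (simp_all add: psi phi phi_t phi_y1 phi_y2)
    then show ?thesis
      using inv_pres_hom_unique[OF de.ring_axioms, of "\<phi> \<circ> \<psi>" "daha_rels q s" id a]
        ring_hom_trans[OF psi(1) phi(1)] that phi(2) psi(2)
      by (simp add: daha_def hgen_def)
  qed
  have "bij_betw \<phi> (carrier QA) (carrier H)"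
    by (rule bij_betw_byWitness[of _ \<psi>])
      (auto simp: id_Q id_H ring_hom_closed[OF phi(1)] ring_hom_closed[OF psi(1)])
  then have "\<phi> \<in> alg_iso QA H"
    using phi(1) phi_smult by (simp add: alg_iso_def ring_iso_def)
  then show ?thesis using phi by blast
qed

end

theorem theorem3p1:
  fixes q t s :: "'k::field"
  assumes "CHAR('k) \<noteq> 2" and "q \<noteq> 0" and "t \<noteq> 0" and "s ^ 2 = t"
  shows "\<exists>\<phi> \<in> alg_iso (Q q s) (daha q s).
    \<phi> (from_R q s (zgen q Z1)) = hgen q s X1 \<and>
    \<phi> (from_R q s (zgen q Z2)) = hgen q s X2 \<and>
    \<phi> (from_R q s (zgen q Z3)) = hgen q s Y1 \<otimes>\<^bsub>daha q s\<^esub> hgen q s Y2 \<and>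
    \<phi> (from_Q1 q s (Q1_x q s)) =
      hgen q s T \<ominus>\<^bsub>daha q s\<^esub> alpha s \<odot>\<^bsub>daha q s\<^esub> \<one>\<^bsub>daha q s\<^esub> \<and>
    \<phi> (from_Q2 q s (Q2_y q)) = inv\<^bsub>daha q s\<^esub> hgen q s Y1 \<otimes>\<^bsub>daha q s\<^esub> hgen q s T"
proof -
  have "(2::'k) \<noteq> 0"
  proof
    assume "(2::'k) = 0"
    then have "CHAR('k) dvd 2" using of_nat_eq_0_iff_char_dvd[where 'a = 'k, of 2] by simp
    then have "CHAR('k) \<le> 2" "CHAR('k) \<noteq> 0" using dvd_imp_le by (auto intro: Nat.gr0I)
    moreover have "CHAR('k) \<noteq> 1" using of_nat_CHAR[where 'a = 'k] by auto
    ultimately show False using assms(1) by simp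
  qed
  then interpret amalg_data q s
    using assms by unfold_locales auto
  have "de.x = hgen q s T \<ominus>\<^bsub>daha q s\<^esub> alpha s \<odot>\<^bsub>daha q s\<^esub> \<one>\<^bsub>daha q s\<^esub>"
    by (simp add: de.x_def de.minus_eq de.uminus_smult)
  then show ?thesis using amalg_iso_daha de.y_def by metis
qed

end
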